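(* Let $X$ be an infinite dimensional operator space. If the bounded subsets of $X$ almost completely coarsely embed into $\mathrm{OH}$, then $X$ is completely isomorphic to $\mathrm{OH}$.
   Context: An operator space is a closed linear subspace $X$ of $\mathcal{B}(H)$ for some complex Hilbert space $H$. For $n\in\mathbb{N}$, $\mathrm{M}_n(X)$ is the space of $n\times n$ matrices over $X$ with the norm inherited from $\mathrm{M}_n(\mathcal{B}(H))\cong\mathcal{B}(H^{\oplus n})$. For a (not necessarily linear) map $f$ defined on a set $A$, its $n$-th amplification $f_n$ is defined on $\mathrm{M}_n(A)$ by $f_n([x_{ij}])=[f(x_{ij})]$. A linear map $f$ is completely bounded if $\sup_n\|f_n\|<\infty$; a complete isomorphism is a linear bijection $f$ such that $f$ and $f^{-1}$ are completely bounded. $B_E$ denotes the closed unit ball of a Banach space $E$. A sequence $\bar f=(F^n\colon A_n\to B_n)_n$ of maps between metric spaces $(A_n,d_n)$, $(B_n,\partial_n)$ is an equi-coarse embedding (the maps are equi-coarse embeddings) if $\omega_{\bar f}(t)<\infty$ for all $t\ge 0$ and $\lim_{t\to\infty}\rho_{\bar f}(t)=\infty$, where $\omega_{\bar f}(t)=\sup_n\sup\{\partial_n(F^n(x),F^n(y))\mid d_n(x,y)\le t\}$ and $\rho_{\bar f}(t)=\inf_n\inf\{\partial_n(F^n(x),F^n(y))\mid d_n(x,y)\ge t\}$ (with $\inf\emptyset=\infty$). For operator spaces $X,Y$, the bounded subsets of $X$ almost completely coarsely embed into $Y$ if there is a sequence of maps $(f^n\colon n\cdot B_X\to Y)_n$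 such that the restricted amplifications $(f^n_n\restriction_{n\cdot B_{\mathrm{M}_n(X)}}\colon n\cdot B_{\mathrm{M}_n(X)}\to\mathrm{M}_n(Y))_{n=1}^\infty$ are equi-coarse embeddings (note $n\cdot B_{\mathrm{M}_n(X)}\subset\mathrm{M}_n(n\cdot B_X)$). $\mathrm{OH}$ is Pisier's (separable, infinite dimensional) operator Hilbert space: completely isometrically $\mathrm{OH}=(R,C)_{1/2}$, the complex interpolation space of the row operator space $R=\overline{\mathrm{span}}\{e_{1,j}\}_j\subset\mathcal{B}(\ell_2)$ and the column operator space $C=\overline{\mathrm{span}}\{e_{j,1}\}_j\subset\mathcal{B}(\ell_2)$ (both identified canonically with $\ell_2$), with $\mathrm{M}_n((R,C)_{1/2})=(\mathrm{M}_n(R),\mathrm{M}_n(C))_{1/2}$ for all $n$. *)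

theory Defs
  imports "HOL-Analysis.Analysis" "HOL-Library.Function_Algebras" "HOL-Real_Asymp.Real_Asymp"
begin

section \<open>Complex vector spaces and complex Hilbert spaces\<close>

class complex_vector = ab_group_add +
  fixes scaleC :: "complex \<Rightarrow> 'a \<Rightarrow> 'a"  (infixr "*\<^sub>C" 75)
  assumes scaleC_add_right: "a *\<^sub>C (x + y) = a *\<^sub>C x + a *\<^sub>C y"
    and scaleC_add_left: "(a + b) *\<^sub>C x = a *\<^sub>C x + b *\<^sub>C x"
    and scaleC_scaleC: "a *\<^sub>C (b *\<^sub>C x) = (a * b) *\<^sub>C x"
    and scaleC_one: "1 *\<^sub>C x = x"

global_interpretation complex_vector: vector_space "scaleC :: complex \<Rightarrow> 'a \<Rightarrow> 'a::complex_vector"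
  defines csubspace_raw_def: csubspace = complex_vector.subspace
    and cspan_raw_def: cspan = complex_vector.span
  by unfold_locales (simp_all add: scaleC_add_right scaleC_add_left scaleC_scaleC scaleC_one)

class complex_normed_vector = complex_vector + real_normed_vector +
  assumes scaleR_scaleC: "r *\<^sub>R x = complex_of_real r *\<^sub>C x"
    and norm_scaleC: "norm (a *\<^sub>C x) = cmod a * norm x"

text \<open>The inner product is linear in its first argument.\<close>

class chilbert_space = complex_normed_vector + complete_space +
  fixes cinner :: "'a \<Rightarrow> 'a \<Rightarrow> complex"
  assumes cinner_commute: "cinner x y = cnj (cinner y x)"
    and cinner_add_left: "cinner (x + y) z = cinner x z + cinner y z"
    and cinner_scaleC_left: "cinner (a *\<^sub>C x) y = a * cinner x y"
    and norm_eq_sqrt_cinner: "norm x = sqrt (Re (cinner x x))"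

instantiation "fun" :: (type, complex_vector) complex_vector
begin

definition scaleC_fun :: "complex \<Rightarrow> ('a \<Rightarrow> 'b) \<Rightarrow> 'a \<Rightarrow> 'b"
  where "scaleC_fun c f = (\<lambda>x. c *\<^sub>C f x)"

instance
  by standard
    (simp_all add: scaleC_fun_def fun_eq_iff scaleC_add_right scaleC_add_left scaleC_scaleC scaleC_one)

end

lemma bounded_linear_scaleC_blinfun:
  fixes T :: "'a::real_normed_vector \<Rightarrow>\<^sub>L 'b::complex_normed_vector"
  shows "bounded_linear (\<lambda>x. c *\<^sub>C blinfun_apply T x)"
proof (rule bounded_linear_intro[where K = "cmod c * norm T"])
  show "c *\<^sub>C blinfun_apply T (x + y) = c *\<^sub>C blinfun_apply T x + c *\<^sub>C blinfun_apply T y" for x y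
    by (simp add: blinfun.add_right scaleC_add_right)
  show "c *\<^sub>C blinfun_apply T (r *\<^sub>R x) = r *\<^sub>R c *\<^sub>C blinfun_apply T x" for r x
    by (simp add: blinfun.scaleR_right scaleR_scaleC scaleC_scaleC mult.commute)
  show "norm (c *\<^sub>C blinfun_apply T x) \<le> norm x * (cmod c * norm T)" for x
    using mult_left_mono[OF norm_blinfun[of T x], of "cmod c"]
    by (simp add: norm_scaleC mult_ac)
qed

instantiation blinfun :: (real_normed_vector, complex_normed_vector) complex_normed_vector
begin

definition scaleC_blinfun :: "complex \<Rightarrow> ('a \<Rightarrow>\<^sub>L 'b) \<Rightarrow> 'a \<Rightarrow>\<^sub>L 'b"
  where "scaleC_blinfun c T = Blinfun (\<lambda>x. c *\<^sub>C blinfun_apply T x)"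

lemma blinfun_apply_scaleC: "blinfun_apply (c *\<^sub>C T) x = c *\<^sub>C blinfun_apply T x"
  for T :: "'a \<Rightarrow>\<^sub>L 'b"
  by (simp add: scaleC_blinfun_def bounded_linear_Blinfun_apply bounded_linear_scaleC_blinfun)

instance
proof
  fix a b :: complex and r :: real and x y :: "'a \<Rightarrow>\<^sub>L 'b"
  show "a *\<^sub>C (x + y) = a *\<^sub>C x + a *\<^sub>C y"
    by (rule blinfun_eqI) (simp add: blinfun_apply_scaleC blinfun.add_left scaleC_add_right)
  show "(a + b) *\<^sub>C x = a *\<^sub>C x + b *\<^sub>C x"
    by (rule blinfun_eqI) (simp add: blinfun_apply_scaleC blinfun.add_left scaleC_add_left)
  show "a *\<^sub>C (b *\<^sub>C x) = (a * b) *\<^sub>C x"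
    by (rule blinfun_eqI) (simp add: blinfun_apply_scaleC scaleC_scaleC)
  show "1 *\<^sub>C x = x"
    by (rule blinfun_eqI) (simp add: blinfun_apply_scaleC scaleC_one)
  show "r *\<^sub>R x = complex_of_real r *\<^sub>C x"
    by (rule blinfun_eqI) (simp add: blinfun_apply_scaleC blinfun.scaleR_left scaleR_scaleC)
  have le: "norm (c *\<^sub>C T) \<le> cmod c * norm T" for c and T :: "'a \<Rightarrow>\<^sub>L 'b"
  proof (rule norm_blinfun_bound)
    fix v
    show "norm (blinfun_apply (c *\<^sub>C T) v) \<le> cmod c * norm T * norm v"
      using mult_left_mono[OF norm_blinfun[of T v], of "cmod c"]
      by (simp add: blinfun_apply_scaleC norm_scaleC mult_ac)
  qed simp
  show "norm (a *\<^sub>C x) = cmod a * norm x"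
  proof (cases "a = 0")
    case True
    then show ?thesis using le[of a x] by simp
  next
    case False
    have "x = inverse a *\<^sub>C (a *\<^sub>C x)"
      using False by (intro blinfun_eqI) (simp add: blinfun_apply_scaleC scaleC_scaleC scaleC_one)
    then have "norm x \<le> inverse (cmod a) * norm (a *\<^sub>C x)"
      using le[of "inverse a" "a *\<^sub>C x"] by (simp add: norm_inverse)
    then have "cmod a * norm x \<le> norm (a *\<^sub>C x)"
      using False by (simp add: field_simps)
    then show ?thesis using le[of a x] by simp
  qed
qed

end


section \<open>The Hilbert space of square summable sequences\<close>

typedef ell2 = "{x :: nat \<Rightarrow> complex. summable (\<lambda>j. (cmod (x j))\<^sup>2)}"
  morphisms coord Abs_ell2
  by (rule exI[of _ "\<lambda>_. 0"]) simp

lemma summable_coord: "summable (\<lambda>j. (cmod (coord x j))\<^sup>2)"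
  using coord[of x] by simp

lemma coord_Abs_ell2: "summable (\<lambda>j. (cmod (x j))\<^sup>2) \<Longrightarrow> coord (Abs_ell2 x) = x"
  by (simp add: Abs_ell2_inverse)

lemma ell2_eqI: "(\<And>j. coord x j = coord y j) \<Longrightarrow> x = y"
  by (metis coord_inject ext)

lemma ell2_summable_add:
  assumes "summable (\<lambda>j. (cmod (x j))\<^sup>2)" "summable (\<lambda>j. (cmod (y j))\<^sup>2)"
  shows "summable (\<lambda>j. (cmod (x j + y j))\<^sup>2)"
proof (rule summable_comparison_test')
  show "summable (\<lambda>j. 2 * (cmod (x j))\<^sup>2 + 2 * (cmod (y j))\<^sup>2)"
    by (intro summable_add summable_mult assms)
  fix j :: nat assume "0 \<le> j"
  have "(cmod (x j + y j))\<^sup>2 \<le> (cmod (x j) + cmod (y j))\<^sup>2"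
    by (intro power_mono norm_triangle_ineq) simp
  also have "\<dots> \<le> 2 * (cmod (x j))\<^sup>2 + 2 * (cmod (y j))\<^sup>2"
    using sum_squares_bound[of "cmod (x j)" "cmod (y j)"] by (simp add: power2_sum)
  finally show "norm ((cmod (x j + y j))\<^sup>2) \<le> 2 * (cmod (x j))\<^sup>2 + 2 * (cmod (y j))\<^sup>2"
    by simp
qed

lemma ell2_summable_scale:
  "summable (\<lambda>j. (cmod (x j))\<^sup>2) \<Longrightarrow> summable (\<lambda>j. (cmod (c * x j))\<^sup>2)"
  by (simp add: norm_mult power_mult_distrib summable_mult)

lemma ell2_summable_mult: "summable (\<lambda>j. coord x j * cnj (coord y j))"
proof (rule summable_comparison_test')
  show "summable (\<lambda>j. (cmod (coord x j))\<^sup>2 + (cmod (coord y j))\<^sup>2)"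
    by (intro summable_add summable_coord)
  fix j :: nat assume "0 \<le> j"
  have "0 \<le> cmod (coord x j) * cmod (coord y j)"
    by simp
  with sum_squares_bound[of "cmod (coord x j)" "cmod (coord y j)"]
  have "cmod (coord x j) * cmod (coord y j) \<le> (cmod (coord x j))\<^sup>2 + (cmod (coord y j))\<^sup>2"
    by linarith
  then show "norm (coord x j * cnj (coord y j)) \<le> (cmod (coord x j))\<^sup>2 + (cmod (coord y j))\<^sup>2"
    by (simp add: norm_mult)
qed

instantiation ell2 :: complex_vector
begin

definition "0 = Abs_ell2 (\<lambda>_. 0)"
definition "x + y = Abs_ell2 (\<lambda>j. coord x j + coord y j)"
definition "- x = Abs_ell2 (\<lambda>j. - coord x j)"
definition "x - y = Abs_ell2 (\<lambda>j. coord x j - coord y j)"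
definition "c *\<^sub>C x = Abs_ell2 (\<lambda>j. c * coord x j)"

lemma coord_zero [simp]: "coord 0 j = 0"
  by (simp add: zero_ell2_def coord_Abs_ell2)

lemma coord_add [simp]: "coord (x + y) j = coord x j + coord y j"
  by (simp add: plus_ell2_def coord_Abs_ell2 ell2_summable_add summable_coord)

lemma coord_uminus [simp]: "coord (- x) j = - coord x j"
  by (simp add: uminus_ell2_def coord_Abs_ell2 summable_coord)

lemma coord_minus [simp]: "coord (x - y) j = coord x j - coord y j"
  using ell2_summable_add[of "coord x" "\<lambda>j. - coord y j"]
  by (simp add: minus_ell2_def coord_Abs_ell2 summable_coord)

lemma coord_scaleC [simp]: "coord (c *\<^sub>C x) j = c * coord x j"
  by (simp add: scaleC_ell2_def coord_Abs_ell2 ell2_summable_scale summable_coord)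

instance
  by standard (rule ell2_eqI; simp add: algebra_simps)+

end

instantiation ell2 :: complex_normed_vector
begin

definition "r *\<^sub>R x = complex_of_real r *\<^sub>C x" for x :: ell2
definition "norm x = sqrt (\<Sum>j. (cmod (coord x j))\<^sup>2)"
definition "dist x y = norm (x - y)" for x y :: ell2
definition "sgn x = inverse (norm x) *\<^sub>R x" for x :: ell2
definition [code del]: "(uniformity :: (ell2 \<times> ell2) filter) = (INF e\<in>{0 <..}. principal {(x, y). dist x y < e})"
definition [code del]: "open U \<longleftrightarrow> (\<forall>x\<in>U. \<forall>\<^sub>F (x', y) in uniformity. x' = x \<longrightarrow> y \<in> U)" for U :: "ell2 set"

lemma ell2_L2_set_le_norm: "L2_set (\<lambda>j. cmod (coord x j)) {..<n} \<le> norm x"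
  unfolding L2_set_def norm_ell2_def
  by (intro real_sqrt_le_mono sum_le_suminf summable_coord) auto

lemma ell2_norm_le: "norm x \<le> K" if "\<And>n. L2_set (\<lambda>j. cmod (coord x j)) {..<n} \<le> K"
proof -
  have "(\<lambda>n. L2_set (\<lambda>j. cmod (coord x j)) {..<n}) \<longlonglongrightarrow> norm x"
    unfolding L2_set_def norm_ell2_def
    by (intro tendsto_real_sqrt summable_LIMSEQ summable_coord)
  then show ?thesis
    by (rule LIMSEQ_le_const2) (use that in blast)
qed

instance
proof
  fix a b :: complex and r s :: real and x y :: ell2
  show "r *\<^sub>R x = complex_of_real r *\<^sub>C x" by (simp add: scaleR_ell2_def)
  show "norm (a *\<^sub>C x) = cmod a * norm x"
    by (simp add: norm_ell2_def norm_mult power_mult_distrib suminf_mult summable_coord real_sqrt_mult)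
  then have ns: "norm (a *\<^sub>C x) = cmod a * norm x" for a and x :: ell2
    by (simp add: norm_ell2_def norm_mult power_mult_distrib suminf_mult summable_coord real_sqrt_mult)
  show "norm (r *\<^sub>R x) = \<bar>r\<bar> * norm x" by (simp add: scaleR_ell2_def ns)
  show "r *\<^sub>R (x + y) = r *\<^sub>R x + r *\<^sub>R y" by (simp add: scaleR_ell2_def scaleC_add_right)
  show "(r + s) *\<^sub>R x = r *\<^sub>R x + s *\<^sub>R x" by (simp add: scaleR_ell2_def scaleC_add_left)
  show "r *\<^sub>R s *\<^sub>R x = (r * s) *\<^sub>R x" by (simp add: scaleR_ell2_def scaleC_scaleC)
  show "1 *\<^sub>R x = x" by (simp add: scaleR_ell2_def scaleC_one)
  show "dist x y = norm (x - y)" by (simp add: dist_ell2_def)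
  show "sgn x = inverse (norm x) *\<^sub>R x" by (simp add: sgn_ell2_def)
  show "(uniformity :: (ell2 \<times> ell2) filter) = (INF e\<in>{0 <..}. principal {(x, y). dist x y < e})"
    by (simp add: uniformity_ell2_def)
  show "open U \<longleftrightarrow> (\<forall>x\<in>U. \<forall>\<^sub>F (x', y) in uniformity. x' = x \<longrightarrow> y \<in> U)" for U :: "ell2 set"
    by (simp add: open_ell2_def)
  show "norm x = 0 \<longleftrightarrow> x = 0"
  proof
    assume "norm x = 0"
    then have "(\<Sum>j. (cmod (coord x j))\<^sup>2) = 0" by (simp add: norm_ell2_def)
    then have "\<forall>j. (cmod (coord x j))\<^sup>2 = 0"
      by (subst (asm) suminf_eq_zero_iff) (auto intro: summable_coord)
    then show "x = 0" by (intro ell2_eqI) simp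
  qed (simp add: norm_ell2_def)
  show "norm (x + y) \<le> norm x + norm y"
  proof (rule ell2_norm_le)
    fix n
    have "L2_set (\<lambda>j. cmod (coord (x + y) j)) {..<n}
        \<le> L2_set (\<lambda>j. cmod (coord x j) + cmod (coord y j)) {..<n}"
      by (intro L2_set_mono) (auto intro: norm_triangle_ineq)
    also have "\<dots> \<le> L2_set (\<lambda>j. cmod (coord x j)) {..<n} + L2_set (\<lambda>j. cmod (coord y j)) {..<n}"
      by (rule L2_set_triangle_ineq)
    also have "\<dots> \<le> norm x + norm y" by (intro add_mono ell2_L2_set_le_norm)
    finally show "L2_set (\<lambda>j. cmod (coord (x + y) j)) {..<n} \<le> norm x + norm y" .
  qed
qed

end

lemma norm_coord_le: "cmod (coord x j) \<le> norm x"
proof -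
  have "cmod (coord x j) \<le> L2_set (\<lambda>j. cmod (coord x j)) {..<Suc j}"
    by (rule member_le_L2_set) auto
  then show ?thesis using ell2_L2_set_le_norm[of x "Suc j"] by linarith
qed

instantiation ell2 :: chilbert_space
begin

definition "cinner x y = (\<Sum>j. coord x j * cnj (coord y j))"

instance
proof
  fix a :: complex and x y z :: ell2
  show "cinner x y = cnj (cinner y x)"
    using summable_sums[OF ell2_summable_mult[of y x]]
    by (subst (asm) sums_cnj[symmetric]) (simp add: cinner_ell2_def sums_iff mult.commute)
  show "cinner (x + y) z = cinner x z + cinner y z"
    by (simp add: cinner_ell2_def suminf_add ell2_summable_mult distrib_right)
  show "cinner (a *\<^sub>C x) y = a * cinner x y"
    by (simp add: cinner_ell2_def suminf_mult ell2_summable_mult mult.assoc)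
  have "Re (\<Sum>j. coord x j * cnj (coord x j)) = (\<Sum>j. Re (coord x j * cnj (coord x j)))"
    by (rule Re_suminf[OF ell2_summable_mult])
  also have "\<dots> = (\<Sum>j. (cmod (coord x j))\<^sup>2)"
    by (simp add: complex_mult_cnj cmod_power2)
  finally show "norm x = sqrt (Re (cinner x x))"
    by (simp add: cinner_ell2_def norm_ell2_def)
next
  fix X :: "nat \<Rightarrow> ell2" assume X: "Cauchy X"
  have cau: "Cauchy (\<lambda>n. coord (X n) j)" for j
  proof (rule metric_CauchyI)
    fix e :: real assume "0 < e"
    then obtain M where M: "\<And>m n. m \<ge> M \<Longrightarrow> n \<ge> M \<Longrightarrow> dist (X m) (X n) < e"
      using metric_CauchyD[OF X] by blast
    have "dist (coord (X m) j) (coord (X n) j) \<le> dist (X m) (X n)" for m n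
      using norm_coord_le[of "X m - X n" j] by (simp add: dist_norm)
    then show "\<exists>M. \<forall>m\<ge>M. \<forall>n\<ge>M. dist (coord (X m) j) (coord (X n) j) < e"
      using M by (meson le_less_trans)
  qed
  define l where "l j = lim (\<lambda>n. coord (X n) j)" for j
  have l: "(\<lambda>n. coord (X n) j) \<longlonglongrightarrow> l j" for j
    unfolding l_def using cau[of j] by (simp add: Cauchy_convergent convergent_LIMSEQ_iff[symmetric])
  have bd: "\<exists>M. \<forall>m\<ge>M. \<forall>n. L2_set (\<lambda>j. cmod (coord (X m) j - l j)) {..<n} \<le> e" if "0 < e" for e
  proof -
    obtain M where M: "\<And>m n. m \<ge> M \<Longrightarrow> n \<ge> M \<Longrightarrow> dist (X m) (X n) < e"
      using metric_CauchyD[OF X \<open>0 < e\<close>] by blast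
    have "L2_set (\<lambda>j. cmod (coord (X m) j - l j)) {..<n} \<le> e" if "m \<ge> M" for m n
    proof (rule LIMSEQ_le_const2)
      show "(\<lambda>k. L2_set (\<lambda>j. cmod (coord (X m) j - coord (X k) j)) {..<n})
          \<longlonglongrightarrow> L2_set (\<lambda>j. cmod (coord (X m) j - l j)) {..<n}"
        unfolding L2_set_def by (intro tendsto_intros l)
      show "\<exists>N. \<forall>k\<ge>N. L2_set (\<lambda>j. cmod (coord (X m) j - coord (X k) j)) {..<n} \<le> e"
      proof (intro exI allI impI)
        fix k assume "M \<le> k"
        then show "L2_set (\<lambda>j. cmod (coord (X m) j - coord (X k) j)) {..<n} \<le> e"
          using ell2_L2_set_le_norm[of "X m - X k" n] M[OF that \<open>M \<le> k\<close>] by (simp add: dist_norm)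
      qed
    qed
    then show ?thesis by blast
  qed
  obtain m where m: "\<And>n. L2_set (\<lambda>j. cmod (coord (X m) j - l j)) {..<n} \<le> 1"
    using bd[of 1] by auto
  have "summable (\<lambda>j. (cmod (coord (X m) j - l j))\<^sup>2)"
  proof (rule summableI_nonneg_bounded)
    fix n
    have "(L2_set (\<lambda>j. cmod (coord (X m) j - l j)) {..<n})\<^sup>2 \<le> 1\<^sup>2"
      by (intro power_mono m L2_set_nonneg)
    then show "(\<Sum>j<n. (cmod (coord (X m) j - l j))\<^sup>2) \<le> 1"
      by (simp add: L2_set_def sum_nonneg)
  qed simp
  then have "summable (\<lambda>j. (cmod (l j - coord (X m) j))\<^sup>2)" by (simp add: norm_minus_commute)
  from ell2_summable_add[OF this summable_coord[of "X m"]]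
  have sl: "summable (\<lambda>j. (cmod (l j))\<^sup>2)" by simp
  have "X \<longlonglongrightarrow> Abs_ell2 l"
  proof (rule metric_LIMSEQ_I)
    fix e :: real assume "0 < e"
    then obtain M where M: "\<And>m n. m \<ge> M \<Longrightarrow> L2_set (\<lambda>j. cmod (coord (X m) j - l j)) {..<n} \<le> e / 2"
      using bd[of "e/2"] by auto
    have "norm (X m - Abs_ell2 l) \<le> e / 2" if "m \<ge> M" for m
      by (rule ell2_norm_le) (use M[OF that] in \<open>simp add: coord_Abs_ell2 sl\<close>)
    then show "\<exists>no. \<forall>n\<ge>no. dist (X n) (Abs_ell2 l) < e"
      using \<open>0 < e\<close> by (intro exI[of _ M]) (force simp: dist_norm)
  qed
  then show "convergent X" by (auto simp: convergent_def)
qed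

end


definition ket :: "nat \<Rightarrow> ell2"
  where "ket i = Abs_ell2 (\<lambda>k. if k = i then 1 else 0)"

lemma coord_ket [simp]: "coord (ket i) k = (if k = i then 1 else 0)"
proof -
  have "summable (\<lambda>k. (cmod (if k = i then 1 else 0))\<^sup>2)"
    by (rule summable_finite[of "{i}"]) auto
  then show ?thesis by (simp add: ket_def coord_Abs_ell2)
qed

lemma coord_sum: "coord (sum f A) k = (\<Sum>i\<in>A. coord (f i) k)"
  by (induction A rule: infinite_finite_induct) auto

lemma ell2_sums_ket: "(\<lambda>j. coord x j *\<^sub>C ket j) sums x"
proof -
  have eq: "(norm (x - (\<Sum>j<n. coord x j *\<^sub>C ket j)))\<^sup>2
      = (\<Sum>j. (cmod (coord x j))\<^sup>2) - (\<Sum>j<n. (cmod (coord x j))\<^sup>2)" for n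
  proof -
    have c: "coord (x - (\<Sum>j<n. coord x j *\<^sub>C ket j)) k = (if k < n then 0 else coord x k)" for k
      by (simp add: coord_sum if_distrib[of "(*) _"] cong: if_cong)
    have "(norm (x - (\<Sum>j<n. coord x j *\<^sub>C ket j)))\<^sup>2
        = (\<Sum>k. (cmod (coord (x - (\<Sum>j<n. coord x j *\<^sub>C ket j)) k))\<^sup>2)"
      unfolding norm_ell2_def by (intro real_sqrt_pow2 suminf_nonneg summable_coord) simp
    also have "\<dots> = (\<Sum>k. (cmod (coord x k))\<^sup>2 - (if k \<in> {..<n} then (cmod (coord x k))\<^sup>2 else 0))"
      unfolding c by (intro suminf_cong) simp
    also have "\<dots> = (\<Sum>j. (cmod (coord x j))\<^sup>2) - (\<Sum>k. if k \<in> {..<n} then (cmod (coord x k))\<^sup>2 else 0)"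
      by (intro suminf_diff[symmetric] summable_coord summable_If_finite_set) simp
    also have "(\<Sum>k. if k \<in> {..<n} then (cmod (coord x k))\<^sup>2 else 0) = (\<Sum>j<n. (cmod (coord x j))\<^sup>2)"
      by (subst suminf_finite[of "{..<n}"]) auto
    finally show ?thesis .
  qed
  have "(\<lambda>n. (norm (x - (\<Sum>j<n. coord x j *\<^sub>C ket j)))\<^sup>2) \<longlonglongrightarrow>
      (\<Sum>j. (cmod (coord x j))\<^sup>2) - (\<Sum>j. (cmod (coord x j))\<^sup>2)"
    unfolding eq by (intro tendsto_diff tendsto_const summable_LIMSEQ summable_coord)
  then have "(\<lambda>n. sqrt ((norm (x - (\<Sum>j<n. coord x j *\<^sub>C ket j)))\<^sup>2)) \<longlonglongrightarrow> sqrt 0"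
    by (intro tendsto_real_sqrt) simp
  then have "(\<lambda>n. norm ((\<Sum>j<n. coord x j *\<^sub>C ket j) - x)) \<longlonglongrightarrow> 0"
    by (simp add: norm_minus_commute)
  then show ?thesis
    unfolding sums_def by (simp add: LIM_zero_iff tendsto_norm_zero_iff)
qed


section \<open>Matrix norms and operator spaces\<close>

text \<open>An \<open>n \<times> n\<close> matrix is a function on pairs of indices that vanishes unless both
  indices are below \<open>n\<close>. With this convention matrices form a complex vector space under
  pointwise operations.\<close>

type_synonym 'a mtx = "nat \<Rightarrow> nat \<Rightarrow> 'a"

definition Mat :: "nat \<Rightarrow> 'a::zero set \<Rightarrow> 'a mtx set"
  where "Mat n A = {x. \<forall>i j. if i < n \<and> j < n then x i j \<in> A else x i j = 0}"

definition amp :: "nat \<Rightarrow> ('a \<Rightarrow> 'b::zero) \<Rightarrow> 'a mtx \<Rightarrow> 'b mtx"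
  where "amp n f x = (\<lambda>i j. if i < n \<and> j < n then f (x i j) else 0)"

text \<open>The norm of a matrix of operators on \<open>H\<close>, acting on the Hilbert space direct sum
  of \<open>n\<close> copies of \<open>H\<close>.\<close>

definition op_mnorm :: "nat \<Rightarrow> ('h::chilbert_space \<Rightarrow>\<^sub>L 'k::chilbert_space) mtx \<Rightarrow> real"
  where "op_mnorm n T =
    (SUP \<xi>\<in>{\<xi> :: nat \<Rightarrow> 'h. L2_set (\<lambda>j. norm (\<xi> j)) {..<n} \<le> 1}.
       L2_set (\<lambda>i. norm (\<Sum>j<n. blinfun_apply (T i j) (\<xi> j))) {..<n})"

definition operator_space :: "('h::chilbert_space \<Rightarrow>\<^sub>L 'h) set \<Rightarrow> bool"
  where "operator_space X \<longleftrightarrow> csubspace X \<and> closed X \<and>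
    (\<forall>T\<in>X. \<forall>c \<xi>. blinfun_apply T (c *\<^sub>C \<xi>) = c *\<^sub>C blinfun_apply T \<xi>)"

definition infinite_dimensional :: "'a::complex_vector set \<Rightarrow> bool"
  where "infinite_dimensional X \<longleftrightarrow> \<not> (\<exists>B. finite B \<and> X \<subseteq> cspan B)"

text \<open>The vector space underlying an operator space together with the norms on the
  matrix spaces over it. All notions below depend on an operator space only through these data;
  the norm of the space itself is the norm of \<open>1 \<times> 1\<close> matrices.\<close>

record 'a matrix_normed =
  carr :: "'a set"
  mnorm :: "nat \<Rightarrow> 'a mtx \<Rightarrow> real"

definition entry :: "'a::zero \<Rightarrow> 'a mtx"
  where "entry x = (\<lambda>i j. if i = 0 \<and> j = 0 then x else 0)"

definition norm1 :: "'a::zero matrix_normed \<Rightarrow> 'a \<Rightarrow> real"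
  where "norm1 E x = mnorm E 1 (entry x)"

definition opsp :: "('h::chilbert_space \<Rightarrow>\<^sub>L 'h) set \<Rightarrow> ('h \<Rightarrow>\<^sub>L 'h) matrix_normed"
  where "opsp X = \<lparr>carr = X, mnorm = op_mnorm\<rparr>"

definition mball :: "'a::zero matrix_normed \<Rightarrow> nat \<Rightarrow> real \<Rightarrow> 'a mtx set"
  where "mball E n r = {x \<in> Mat n (carr E). mnorm E n x \<le> r}"

lemma norm1_opsp: "norm1 (opsp X) T = norm T"
proof -
  have *: "L2_set g {..<Suc 0} = \<bar>g 0\<bar>" for g :: "nat \<Rightarrow> real"
    by (simp add: lessThan_Suc)
  have "norm1 (opsp X) T
      = (SUP \<xi>\<in>{\<xi>. norm (\<xi> 0) \<le> 1}. norm (blinfun_apply T (\<xi> (0::nat))))"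
    by (simp add: norm1_def opsp_def op_mnorm_def * entry_def)
  also have "\<dots> = norm T"
  proof (rule antisym)
    have bd: "norm (blinfun_apply T v) \<le> norm T" if "norm v \<le> 1" for v
      using norm_blinfun[of T v] mult_left_mono[OF that norm_ge_zero[of T]] by linarith
    then show "(SUP \<xi>\<in>{\<xi>. norm (\<xi> 0) \<le> 1}. norm (blinfun_apply T (\<xi> (0::nat)))) \<le> norm T"
      by (intro cSUP_least) (auto intro: exI[of _ "\<lambda>_. 0"])
    have bdd: "bdd_above ((\<lambda>\<xi>. norm (blinfun_apply T (\<xi> (0::nat)))) ` {\<xi>. norm (\<xi> 0) \<le> 1})"
      using bd by (intro bdd_aboveI2) auto
    let ?s = "SUP \<xi>\<in>{\<xi>. norm (\<xi> 0) \<le> 1}. norm (blinfun_apply T (\<xi> (0::nat)))"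
    have up: "norm (blinfun_apply T v) \<le> ?s" if "norm v \<le> 1" for v
      using cSUP_upper[OF _ bdd, of "\<lambda>_. v"] that by simp
    show "norm T \<le> ?s"
    proof (rule norm_blinfun_bound)
      show "0 \<le> ?s" using up[of 0] by simp
      fix v show "norm (blinfun_apply T v) \<le> ?s * norm v"
      proof (cases "v = 0")
        case False
        then have "norm (blinfun_apply T ((1 / norm v) *\<^sub>R v)) \<le> ?s" by (intro up) simp
        then show ?thesis using False by (simp add: blinfun.scaleR_right field_simps)
      qed simp
    qed
  qed
  finally show ?thesis .
qed


section \<open>Complete isomorphisms\<close>

definition clinear_between :: "'a::complex_vector set \<Rightarrow> 'b::complex_vector set \<Rightarrow> ('a \<Rightarrow> 'b) \<Rightarrow> bool"
  where "clinear_between V W f \<longleftrightarrow> f ` V \<subseteq> W \<and>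
    (\<forall>x\<in>V. \<forall>y\<in>V. f (x + y) = f x + f y) \<and> (\<forall>c. \<forall>x\<in>V. f (c *\<^sub>C x) = c *\<^sub>C f x)"

definition completely_bounded ::
    "'a::complex_vector matrix_normed \<Rightarrow> 'b::complex_vector matrix_normed \<Rightarrow> ('a \<Rightarrow> 'b) \<Rightarrow> bool"
  where "completely_bounded E F f \<longleftrightarrow> clinear_between (carr E) (carr F) f \<and>
    (SUP n\<in>{1..}. SUP x\<in>mball E n 1. ereal (mnorm F n (amp n f x))) < \<infinity>"

definition completely_isomorphic ::
    "'a::complex_vector matrix_normed \<Rightarrow> 'b::complex_vector matrix_normed \<Rightarrow> bool"
  where "completely_isomorphic E F \<longleftrightarrow> (\<exists>f. bij_betw f (carr E) (carr F) \<and>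
    completely_bounded E F f \<and> completely_bounded F E (inv_into (carr E) f))"


section \<open>Coarse embeddings\<close>

text \<open>Sequences are indexed by \<open>n \<ge> 1\<close>. The moduli take values in the extended reals, where the
  infimum of the empty set is \<open>\<infinity>\<close>.\<close>

definition expansion_modulus ::
    "(nat \<Rightarrow> 'a set) \<Rightarrow> (nat \<Rightarrow> 'a \<Rightarrow> 'a \<Rightarrow> real) \<Rightarrow> (nat \<Rightarrow> 'b \<Rightarrow> 'b \<Rightarrow> real) \<Rightarrow>
     (nat \<Rightarrow> 'a \<Rightarrow> 'b) \<Rightarrow> real \<Rightarrow> ereal"
  where "expansion_modulus A d d' F t =
    (SUP n\<in>{1..}. SUP (x, y)\<in>{(x, y). x \<in> A n \<and> y \<in> A n \<and> d n x y \<le> t}. ereal (d' n (F n x) (F n y)))"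

definition compression_modulus ::
    "(nat \<Rightarrow> 'a set) \<Rightarrow> (nat \<Rightarrow> 'a \<Rightarrow> 'a \<Rightarrow> real) \<Rightarrow> (nat \<Rightarrow> 'b \<Rightarrow> 'b \<Rightarrow> real) \<Rightarrow>
     (nat \<Rightarrow> 'a \<Rightarrow> 'b) \<Rightarrow> real \<Rightarrow> ereal"
  where "compression_modulus A d d' F t =
    (INF n\<in>{1..}. INF (x, y)\<in>{(x, y). x \<in> A n \<and> y \<in> A n \<and> t \<le> d n x y}. ereal (d' n (F n x) (F n y)))"

definition equi_coarse_embedding ::
    "(nat \<Rightarrow> 'a set) \<Rightarrow> (nat \<Rightarrow> 'a \<Rightarrow> 'a \<Rightarrow> real) \<Rightarrow> (nat \<Rightarrow> 'b set) \<Rightarrow> (nat \<Rightarrow> 'b \<Rightarrow> 'b \<Rightarrow> real) \<Rightarrow>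
     (nat \<Rightarrow> 'a \<Rightarrow> 'b) \<Rightarrow> bool"
  where "equi_coarse_embedding A d B d' F \<longleftrightarrow>
    (\<forall>n\<ge>1. F n ` A n \<subseteq> B n) \<and>
    (\<forall>t\<ge>0. expansion_modulus A d d' F t < \<infinity>) \<and>
    (compression_modulus A d d' F \<longlongrightarrow> \<infinity>) at_top"

definition almost_completely_coarsely_embed ::
    "'a::complex_vector matrix_normed \<Rightarrow> 'b::complex_vector matrix_normed \<Rightarrow> bool"
  where "almost_completely_coarsely_embed E F \<longleftrightarrow>
    (\<exists>f :: nat \<Rightarrow> 'a \<Rightarrow> 'b.
      (\<forall>n\<ge>1. f n ` {x \<in> carr E. norm1 E x \<le> real n} \<subseteq> carr F) \<and>
      equi_coarse_embedding
        (\<lambda>n. mball E n (real n)) (\<lambda>n x y. mnorm E n (x - y))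
        (\<lambda>n. Mat n (carr F)) (\<lambda>n x y. mnorm F n (x - y))
        (\<lambda>n. amp n (f n)))"


section \<open>Complex interpolation\<close>

text \<open>Calderon's complex method for a compatible couple given by two normed subspaces
  \<open>(V0, N0)\<close> and \<open>(V1, N1)\<close> of one complex vector space. Continuity and holomorphy
  of functions into \<open>V0 + V1\<close> refer to the norm \<open>sum_norm\<close>.\<close>

definition sum_space :: "'v::complex_vector set \<Rightarrow> 'v set \<Rightarrow> 'v set"
  where "sum_space V0 V1 = {a + b | a b. a \<in> V0 \<and> b \<in> V1}"

definition sum_norm ::
    "'v::complex_vector set \<Rightarrow> ('v \<Rightarrow> real) \<Rightarrow> 'v set \<Rightarrow> ('v \<Rightarrow> real) \<Rightarrow> 'v \<Rightarrow> real"
  where "sum_norm V0 N0 V1 N1 x = Inf {N0 a + N1 b | a b. a \<in> V0 \<and> b \<in> V1 \<and> x = a + b}"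

definition ncontinuous_on :: "('v::complex_vector \<Rightarrow> real) \<Rightarrow> 's::topological_space set \<Rightarrow> ('s \<Rightarrow> 'v) \<Rightarrow> bool"
  where "ncontinuous_on N S F \<longleftrightarrow> (\<forall>z\<in>S. ((\<lambda>w. N (F w - F z)) \<longlongrightarrow> 0) (at z within S))"

definition nholomorphic_on ::
    "'v::complex_vector set \<Rightarrow> ('v \<Rightarrow> real) \<Rightarrow> complex set \<Rightarrow> (complex \<Rightarrow> 'v) \<Rightarrow> bool"
  where "nholomorphic_on V N S F \<longleftrightarrow>
    (\<forall>z\<in>S. \<exists>D\<in>V. ((\<lambda>w. N (inverse (w - z) *\<^sub>C (F w - F z) - D)) \<longlongrightarrow> 0) (at z within S))"

definition calderon_functions ::
    "'v::complex_vector set \<Rightarrow> ('v \<Rightarrow> real) \<Rightarrow> 'v set \<Rightarrow> ('v \<Rightarrow> real) \<Rightarrow> (complex \<Rightarrow> 'v) set"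
  where "calderon_functions V0 N0 V1 N1 = {F.
    (\<forall>z. 0 \<le> Re z \<and> Re z \<le> 1 \<longrightarrow> F z \<in> sum_space V0 V1) \<and>
    (\<exists>M. \<forall>z. 0 \<le> Re z \<and> Re z \<le> 1 \<longrightarrow> sum_norm V0 N0 V1 N1 (F z) \<le> M) \<and>
    ncontinuous_on (sum_norm V0 N0 V1 N1) {z. 0 \<le> Re z \<and> Re z \<le> 1} F \<and>
    nholomorphic_on (sum_space V0 V1) (sum_norm V0 N0 V1 N1) {z. 0 < Re z \<and> Re z < 1} F \<and>
    (\<forall>t. F (Complex 0 t) \<in> V0) \<and> (\<forall>t. F (Complex 1 t) \<in> V1) \<and>
    ncontinuous_on N0 UNIV (\<lambda>t. F (Complex 0 t)) \<and>
    ncontinuous_on N1 UNIV (\<lambda>t. F (Complex 1 t)) \<and>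
    ((\<lambda>t. N0 (F (Complex 0 t))) \<longlongrightarrow> 0) at_infinity \<and>
    ((\<lambda>t. N1 (F (Complex 1 t))) \<longlongrightarrow> 0) at_infinity}"

definition calderon_norm :: "('v \<Rightarrow> real) \<Rightarrow> ('v \<Rightarrow> real) \<Rightarrow> (complex \<Rightarrow> 'v) \<Rightarrow> real"
  where "calderon_norm N0 N1 F = max (SUP t. N0 (F (Complex 0 t))) (SUP t. N1 (F (Complex 1 t)))"

definition interp_space ::
    "'v::complex_vector set \<Rightarrow> ('v \<Rightarrow> real) \<Rightarrow> 'v set \<Rightarrow> ('v \<Rightarrow> real) \<Rightarrow> real \<Rightarrow> 'v set"
  where "interp_space V0 N0 V1 N1 \<theta> = {F (of_real \<theta>) | F. F \<in> calderon_functions V0 N0 V1 N1}"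

definition interp_norm ::
    "'v::complex_vector set \<Rightarrow> ('v \<Rightarrow> real) \<Rightarrow> 'v set \<Rightarrow> ('v \<Rightarrow> real) \<Rightarrow> real \<Rightarrow> 'v \<Rightarrow> real"
  where "interp_norm V0 N0 V1 N1 \<theta> x =
    Inf {calderon_norm N0 N1 F | F. F \<in> calderon_functions V0 N0 V1 N1 \<and> F (of_real \<theta>) = x}"

definition opsp_interp ::
    "'v::complex_vector matrix_normed \<Rightarrow> 'v matrix_normed \<Rightarrow> real \<Rightarrow> 'v matrix_normed"
  where "opsp_interp E0 E1 \<theta> =
    \<lparr>carr = interp_space (carr E0) (norm1 E0) (carr E1) (norm1 E1) \<theta>,
     mnorm = (\<lambda>n. interp_norm (Mat n (carr E0)) (mnorm E0 n) (Mat n (carr E1)) (mnorm E1 n) \<theta>)\<rparr>"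


section \<open>The operator Hilbert space\<close>

definition munit :: "nat \<Rightarrow> nat \<Rightarrow> ell2 \<Rightarrow>\<^sub>L ell2"
  where "munit i j = Blinfun (\<lambda>\<xi>. coord \<xi> j *\<^sub>C ket i)"

definition row_space :: "(ell2 \<Rightarrow>\<^sub>L ell2) set"
  where "row_space = closure (cspan (range (\<lambda>j. munit 0 j)))"

definition col_space :: "(ell2 \<Rightarrow>\<^sub>L ell2) set"
  where "col_space = closure (cspan (range (\<lambda>j. munit j 0)))"

text \<open>The canonical identifications of the sequence space with the row space and the column space.
  The series converge in operator norm, and the maps are isometries onto these spaces, as shown below.\<close>

definition row_embed :: "ell2 \<Rightarrow> ell2 \<Rightarrow>\<^sub>L ell2"
  where "row_embed x = (\<Sum>j. coord x j *\<^sub>C munit 0 j)"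

definition col_embed :: "ell2 \<Rightarrow> ell2 \<Rightarrow>\<^sub>L ell2"
  where "col_embed x = (\<Sum>j. coord x j *\<^sub>C munit j 0)"

lemma norm_ket [simp]: "norm (ket i) = 1"
  by (simp add: norm_ell2_def if_distrib[of cmod] if_distrib[of "\<lambda>x. x\<^sup>2"] cong: if_cong)
    (subst suminf_finite[of "{i}"]; simp)

lemma cmod_pairing_le: "cmod (\<Sum>j. coord x j * coord y j) \<le> norm x * norm y"
  and summable_pairing: "summable (\<lambda>j. coord x j * coord y j)"
proof -
  define y' where "y' = Abs_ell2 (\<lambda>j. cnj (coord y j))"
  have "coord y' j = cnj (coord y j)" for j
    by (simp add: y'_def coord_Abs_ell2 summable_coord)
  then show sm: "summable (\<lambda>j. coord x j * coord y j)"
    using ell2_summable_mult[of x y'] by simp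
  have "(\<lambda>n. cmod (\<Sum>j<n. coord x j * coord y j)) \<longlonglongrightarrow> cmod (\<Sum>j. coord x j * coord y j)"
    by (intro tendsto_norm summable_LIMSEQ sm)
  moreover have "cmod (\<Sum>j<n. coord x j * coord y j) \<le> norm x * norm y" for n
  proof -
    have "cmod (\<Sum>j<n. coord x j * coord y j) \<le> (\<Sum>j<n. \<bar>cmod (coord x j)\<bar> * \<bar>cmod (coord y j)\<bar>)"
      by (rule order_trans[OF norm_sum]) (simp add: norm_mult)
    also have "\<dots> \<le> L2_set (\<lambda>j. cmod (coord x j)) {..<n} * L2_set (\<lambda>j. cmod (coord y j)) {..<n}"
      by (rule L2_set_mult_ineq)
    also have "\<dots> \<le> norm x * norm y"
      by (intro mult_mono ell2_L2_set_le_norm L2_set_nonneg) simp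
    finally show ?thesis .
  qed
  ultimately show "cmod (\<Sum>j. coord x j * coord y j) \<le> norm x * norm y"
    by (intro LIMSEQ_le_const2) auto
qed

lemma munit_apply: "blinfun_apply (munit i j) \<xi> = coord \<xi> j *\<^sub>C ket i"
proof -
  have "bounded_linear (\<lambda>\<xi>. coord \<xi> j *\<^sub>C ket i)"
    by (rule bounded_linear_intro[where K = 1])
      (simp_all add: scaleC_add_left scaleR_scaleC scaleC_scaleC norm_scaleC norm_coord_le)
  then show ?thesis by (simp add: munit_def bounded_linear_Blinfun_apply)
qed

lemma isometric_embedding:
  fixes R :: "ell2 \<Rightarrow> ell2 \<Rightarrow>\<^sub>L ell2"
  assumes add: "\<And>x y. R (x + y) = R x + R y"
    and sc: "\<And>c x. R (c *\<^sub>C x) = c *\<^sub>C R x"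
    and iso: "\<And>x. norm (R x) = norm x"
  shows "(\<lambda>j. coord x j *\<^sub>C R (ket j)) sums R x"
    and "range R = closure (cspan (range (\<lambda>j. R (ket j))))"
proof -
  have bl: "bounded_linear R"
    by (rule bounded_linear_intro[where K = 1]) (simp_all add: add sc iso scaleR_scaleC)
  have sums: "(\<lambda>j. coord x j *\<^sub>C R (ket j)) sums R x" for x
    using bounded_linear.sums[OF bl ell2_sums_ket[of x]] by (simp add: sc)
  then show "(\<lambda>j. coord x j *\<^sub>C R (ket j)) sums R x" .
  have "csubspace (range R)"
  proof (rule complex_vector.subspaceI)
    show "0 \<in> range R" using linear_0[OF bounded_linear.linear[OF bl]] by (metis rangeI)
    show "x + y \<in> range R" if "x \<in> range R" "y \<in> range R" for x y
      using that by (auto simp flip: add)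
    show "c *\<^sub>C x \<in> range R" if "x \<in> range R" for c x
      using that by (auto simp flip: sc)
  qed
  then have 1: "cspan (range (\<lambda>j. R (ket j))) \<subseteq> range R"
    by (intro complex_vector.span_minimal) auto
  have "complete (range R)"
    by (rule complete_isometric_image[OF zero_less_one _ bl])
      (auto simp: iso real_vector.subspace_UNIV complete_UNIV)
  then have "closed (range R)" by (rule complete_imp_closed)
  with 1 have "closure (cspan (range (\<lambda>j. R (ket j)))) \<subseteq> range R"
    by (rule closure_minimal)
  moreover have "R x \<in> closure (cspan (range (\<lambda>j. R (ket j))))" for x
    unfolding closure_sequential
  proof (intro exI conjI allI)
    show "(\<lambda>n. \<Sum>j<n. coord x j *\<^sub>C R (ket j)) \<longlonglongrightarrow> R x"
      using sums by (simp add: sums_def)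
    show "(\<Sum>j<n. coord x j *\<^sub>C R (ket j)) \<in> cspan (range (\<lambda>j. R (ket j)))" for n
      by (intro complex_vector.span_sum complex_vector.span_scale complex_vector.span_base) auto
  qed
  ultimately show "range R = closure (cspan (range (\<lambda>j. R (ket j))))" by blast
qed

lemma row_embed_apply: "blinfun_apply (row_embed x) \<xi> = (\<Sum>j. coord x j * coord \<xi> j) *\<^sub>C ket 0"
  and norm_row_embed: "norm (row_embed x) = norm x"
  and row_embed_sums: "(\<lambda>j. coord x j *\<^sub>C munit 0 j) sums row_embed x"
  and range_row_embed: "range row_embed = row_space"
proof -
  define R where "R x = Blinfun (\<lambda>\<xi>. (\<Sum>j. coord x j * coord \<xi> j) *\<^sub>C ket 0)" for x
  have "bounded_linear (\<lambda>\<xi>. (\<Sum>j. coord x j * coord \<xi> j) *\<^sub>C ket 0)" for x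
  proof (rule bounded_linear_intro[where K = "norm x"])
    show "(\<Sum>j. coord x j * coord (u + v) j) *\<^sub>C ket 0
        = (\<Sum>j. coord x j * coord u j) *\<^sub>C ket 0 + (\<Sum>j. coord x j * coord v j) *\<^sub>C ket 0" for u v
      by (simp add: distrib_left flip: scaleC_add_left suminf_add[OF summable_pairing summable_pairing])
    show "(\<Sum>j. coord x j * coord (r *\<^sub>R v) j) *\<^sub>C ket 0 = r *\<^sub>R (\<Sum>j. coord x j * coord v j) *\<^sub>C ket 0" for r v
      using suminf_mult[OF summable_pairing[of x v], of "complex_of_real r"]
      by (simp add: scaleR_scaleC scaleC_scaleC mult.left_commute)
    show "norm ((\<Sum>j. coord x j * coord v j) *\<^sub>C ket 0) \<le> norm v * norm x" for v
      using cmod_pairing_le[of x v] by (simp add: norm_scaleC mult.commute)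
  qed
  then have R: "blinfun_apply (R x) \<xi> = (\<Sum>j. coord x j * coord \<xi> j) *\<^sub>C ket 0" for x \<xi>
    by (simp add: R_def bounded_linear_Blinfun_apply)
  have add: "R (x + y) = R x + R y" for x y
    by (rule blinfun_eqI)
      (simp add: R blinfun.add_left distrib_right flip: scaleC_add_left suminf_add[OF summable_pairing summable_pairing])
  have sc: "R (c *\<^sub>C x) = c *\<^sub>C R x" for c x
    using suminf_mult[OF summable_pairing[of x], of c]
    by (intro blinfun_eqI) (simp add: R blinfun_apply_scaleC scaleC_scaleC mult.assoc)
  have iso: "norm (R x) = norm x" for x
  proof (rule antisym)
    show "norm (R x) \<le> norm x"
      using cmod_pairing_le[of x] by (intro norm_blinfun_bound) (simp_all add: R norm_scaleC)
    define x' where "x' = Abs_ell2 (\<lambda>j. cnj (coord x j))"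
    have x': "coord x' j = cnj (coord x j)" for j
      by (simp add: x'_def coord_Abs_ell2 summable_coord)
    have n: "norm x' = norm x" by (simp add: norm_ell2_def x')
    have "(\<lambda>j. of_real ((cmod (coord x j))\<^sup>2)) sums (complex_of_real (\<Sum>j. (cmod (coord x j))\<^sup>2))"
      by (intro sums_of_real summable_sums summable_coord)
    then have "(\<lambda>j. coord x j * coord x' j) sums (complex_of_real (\<Sum>j. (cmod (coord x j))\<^sup>2))"
      by (simp only: complex_norm_square x')
    then have "(\<Sum>j. coord x j * coord x' j) = complex_of_real (\<Sum>j. (cmod (coord x j))\<^sup>2)"
      by (rule sums_unique[symmetric])
    also have "(\<Sum>j. (cmod (coord x j))\<^sup>2) = (norm x)\<^sup>2"
      by (simp add: norm_ell2_def suminf_nonneg summable_coord)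
    finally have "(norm x)\<^sup>2 = norm (blinfun_apply (R x) x')"
      by (simp add: R norm_scaleC norm_power)
    also have "\<dots> \<le> norm (R x) * norm x"
      using norm_blinfun[of "R x" x'] n by simp
    finally show "norm x \<le> norm (R x)"
      by (cases "norm x = 0") (auto simp: power2_eq_square)
  qed
  have ket: "R (ket j) = munit 0 j" for j
  proof (rule blinfun_eqI)
    fix \<xi>
    have "(\<Sum>k. coord (ket j) k * coord \<xi> k) = coord \<xi> j"
      by (subst suminf_finite[of "{j}"]) auto
    then show "blinfun_apply (R (ket j)) \<xi> = blinfun_apply (munit 0 j) \<xi>"
      by (simp add: R munit_apply)
  qed
  note E = isometric_embedding[of R, OF add sc iso, unfolded ket]
  have eq: "row_embed = R"
    unfolding row_embed_def fun_eq_iff using E(1) by (simp add: sums_iff)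
  show "blinfun_apply (row_embed x) \<xi> = (\<Sum>j. coord x j * coord \<xi> j) *\<^sub>C ket 0"
    and "norm (row_embed x) = norm x"
    and "(\<lambda>j. coord x j *\<^sub>C munit 0 j) sums row_embed x"
    and "range row_embed = row_space"
    by (simp_all add: eq R iso E row_space_def)
qed

lemma col_embed_apply: "blinfun_apply (col_embed x) \<xi> = coord \<xi> 0 *\<^sub>C x"
  and norm_col_embed: "norm (col_embed x) = norm x"
  and col_embed_sums: "(\<lambda>j. coord x j *\<^sub>C munit j 0) sums col_embed x"
  and range_col_embed: "range col_embed = col_space"
proof -
  define R :: "ell2 \<Rightarrow> ell2 \<Rightarrow>\<^sub>L ell2" where "R x = Blinfun (\<lambda>\<xi>. coord \<xi> 0 *\<^sub>C x)" for x
  have "bounded_linear (\<lambda>\<xi>. coord \<xi> 0 *\<^sub>C x)" for x :: ell2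
    by (rule bounded_linear_intro[where K = "norm x"])
      (simp_all add: scaleC_add_left scaleR_scaleC scaleC_scaleC norm_scaleC mult_right_mono norm_coord_le)
  then have R: "blinfun_apply (R x) \<xi> = coord \<xi> 0 *\<^sub>C x" for x \<xi>
    by (simp add: R_def bounded_linear_Blinfun_apply)
  have add: "R (x + y) = R x + R y" for x y
    by (rule blinfun_eqI) (simp add: R blinfun.add_left scaleC_add_right)
  have sc: "R (c *\<^sub>C x) = c *\<^sub>C R x" for c x
    by (rule blinfun_eqI) (simp add: R blinfun_apply_scaleC scaleC_scaleC mult.commute)
  have iso: "norm (R x) = norm x" for x
  proof (rule antisym)
    have "norm (blinfun_apply (R x) \<xi>) \<le> norm x * norm \<xi>" for \<xi>
      using mult_left_mono[OF norm_coord_le[of \<xi> 0] norm_ge_zero[of x]]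
      by (simp add: R norm_scaleC mult.commute)
    then show "norm (R x) \<le> norm x"
      by (intro norm_blinfun_bound) simp_all
    show "norm x \<le> norm (R x)"
      using norm_blinfun[of "R x" "ket 0"] by (simp add: R scaleC_one)
  qed
  have ket: "R (ket j) = munit j 0" for j
    by (rule blinfun_eqI) (simp add: R munit_apply)
  note E = isometric_embedding[of R, OF add sc iso, unfolded ket]
  have eq: "col_embed = R"
    unfolding col_embed_def fun_eq_iff using E(1) by (simp add: sums_iff)
  show "blinfun_apply (col_embed x) \<xi> = coord \<xi> 0 *\<^sub>C x"
    and "norm (col_embed x) = norm x"
    and "(\<lambda>j. coord x j *\<^sub>C munit j 0) sums col_embed x"
    and "range col_embed = col_space"
    by (simp_all add: eq R iso E col_space_def)
qed

definition row_opsp :: "ell2 matrix_normed"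
  where "row_opsp = \<lparr>carr = UNIV, mnorm = (\<lambda>n x. op_mnorm n (amp n row_embed x))\<rparr>"

definition col_opsp :: "ell2 matrix_normed"
  where "col_opsp = \<lparr>carr = UNIV, mnorm = (\<lambda>n x. op_mnorm n (amp n col_embed x))\<rparr>"

definition OH :: "ell2 matrix_normed"
  where "OH = opsp_interp row_opsp col_opsp (1/2)"

lemma norm1_row_opsp: "norm1 row_opsp x = norm x"
  and norm1_col_opsp: "norm1 col_opsp x = norm x"
proof -
  have "amp 1 f (entry x) = entry (f x)" for f :: "ell2 \<Rightarrow> ell2 \<Rightarrow>\<^sub>L ell2"
    by (simp add: amp_def entry_def fun_eq_iff)
  then show "norm1 row_opsp x = norm x" "norm1 col_opsp x = norm x"
    using norm1_opsp[of UNIV "row_embed x"] norm1_opsp[of UNIV "col_embed x"]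
    by (simp_all add: norm1_def row_opsp_def col_opsp_def opsp_def norm_row_embed norm_col_embed)
qed

lemma carr_OH: "carr OH = UNIV"
proof -
  have sum_norm: "sum_norm UNIV norm UNIV norm x = norm x" for x :: ell2
    unfolding sum_norm_def
  proof (rule cInf_eq_minimum)
    show "norm x \<in> {norm a + norm b |a b. a \<in> UNIV \<and> b \<in> UNIV \<and> x = a + b}"
      by (rule CollectI, rule exI[of _ x], rule exI[of _ 0]) simp
  qed (auto intro: norm_triangle_ineq)
  have sum_space: "sum_space UNIV UNIV = (UNIV :: ell2 set)"
    unfolding sum_space_def by (auto intro: exI[of _ 0])
  have "\<exists>F. x = F (1/2) \<and> F \<in> calderon_functions UNIV norm UNIV norm" for x :: ell2
  proof (intro exI conjI)
    define g where "g z = exp (z\<^sup>2 - 1/4)" for z :: complex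
    let ?F = "\<lambda>z. g z *\<^sub>C x"
    show "x = ?F (1/2)" by (simp add: g_def power2_eq_square scaleC_one)
    have diff: "a *\<^sub>C x - b *\<^sub>C x = (a - b) *\<^sub>C x" for a b
      by (simp add: complex_vector.scale_left_diff_distrib)
    have ng: "cmod (g z) = exp ((Re z)\<^sup>2 - (Im z)\<^sup>2 - 1/4)" for z
      by (simp add: g_def Re_power2)
    have cont: "((\<lambda>w. cmod (g w - g z) * norm x) \<longlongrightarrow> 0) (at z within S)" for z S
    proof -
      have "(g \<longlongrightarrow> g z) (at z within S)"
        unfolding g_def by (intro tendsto_intros)
      then show ?thesis
        by (intro tendsto_mult_left_zero tendsto_norm_zero LIM_zero)
    qed
    have cont': "((\<lambda>t. cmod (g (Complex c t) - g (Complex c s)) * norm x) \<longlongrightarrow> 0) (at s)" for c s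
    proof -
      have "((\<lambda>t. g (Complex c t)) \<longlongrightarrow> g (Complex c s)) (at s)"
        unfolding g_def Complex_eq by (intro tendsto_intros)
      then show ?thesis
        by (intro tendsto_mult_left_zero tendsto_norm_zero LIM_zero)
    qed
    have van: "((\<lambda>t. cmod (g (Complex c t)) * norm x) \<longlongrightarrow> 0) at_infinity" for c
    proof (rule tendsto_mult_left_zero)
      have "filterlim (\<lambda>t::real. \<bar>t\<bar>) at_top at_infinity"
      proof -
        have "(norm :: real \<Rightarrow> real) = (\<lambda>t. \<bar>t\<bar>)" by (simp add: fun_eq_iff)
        then show ?thesis
          by (rule subst[where P = "\<lambda>f. filterlim f at_top at_infinity"]) (rule filterlim_norm_at_top)
      qed
      moreover have "((\<lambda>s::real. exp (c\<^sup>2 - s\<^sup>2 - 1/4)) \<longlongrightarrow> 0) at_top"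
        by real_asymp
      ultimately have "((\<lambda>t::real. exp (c\<^sup>2 - \<bar>t\<bar>\<^sup>2 - 1/4)) \<longlongrightarrow> 0) at_infinity"
        by (rule filterlim_compose[rotated])
      then show "((\<lambda>t. cmod (g (Complex c t))) \<longlongrightarrow> 0) at_infinity"
        by (simp add: ng)
    qed
    have hol: "((\<lambda>w. cmod (inverse (w - z) * (g w - g z) - 2 * z * g z) * norm x) \<longlongrightarrow> 0) (at z within S)"
      for z S
    proof -
      have "(g has_field_derivative 2 * z * g z) (at z within S)"
        unfolding g_def by (auto intro!: derivative_eq_intros)
      then have "((\<lambda>w. inverse (w - z) * (g w - g z)) \<longlongrightarrow> 2 * z * g z) (at z within S)"
        by (simp add: has_field_derivative_iff field_class.field_divide_inverse mult.commute)
      then show ?thesis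
        by (intro tendsto_mult_left_zero tendsto_norm_zero LIM_zero)
    qed
    have bd: "norm (?F z) \<le> exp 1 * norm x" if "0 \<le> Re z" "Re z \<le> 1" for z
    proof -
      have "(Re z)\<^sup>2 \<le> 1" using that by (simp add: power_le_one)
      then have "(Re z)\<^sup>2 - (Im z)\<^sup>2 - 1/4 \<le> 1" using zero_le_power2[of "Im z"] by linarith
      then show ?thesis by (simp add: norm_scaleC ng mult_right_mono)
    qed
    show "?F \<in> calderon_functions UNIV norm UNIV norm"
      unfolding calderon_functions_def sum_norm sum_space ncontinuous_on_def nholomorphic_on_def
    proof (intro CollectI conjI allI impI ballI)
      show "\<exists>M. \<forall>z. 0 \<le> Re z \<and> Re z \<le> 1 \<longrightarrow> norm (?F z) \<le> M"
        using bd by blast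
      show "\<exists>D\<in>UNIV. ((\<lambda>w. norm (inverse (w - z) *\<^sub>C (?F w - ?F z) - D)) \<longlongrightarrow> 0)
          (at z within {z. 0 < Re z \<and> Re z < 1})" for z
        using hol by (intro bexI[of _ "(2 * z * g z) *\<^sub>C x"]) (simp_all add: diff norm_scaleC scaleC_scaleC)
    qed (use cont cont' van in \<open>simp_all add: diff norm_scaleC\<close>)
  qed
  then have "interp_space UNIV norm UNIV norm (1/2) = (UNIV :: ell2 set)"
    unfolding interp_space_def of_real_divide of_real_1 of_real_numeral by blast
  moreover have "norm1 row_opsp = norm" "norm1 col_opsp = norm"
    by (simp_all add: fun_eq_iff norm1_row_opsp norm1_col_opsp)
  ultimately show ?thesis
    by (simp add: OH_def opsp_interp_def row_opsp_def col_opsp_def)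
qed

end

theory Submission
  imports Defs "HOL-Complex_Analysis.Conformal_Mappings"
begin

text \<open>
  A coarse map on a ball is Lipschitz at large distances. For maps that are coarse together with their
  amplifications, uniformly in the size of the matrices, this is a strong restriction. Distribute the
  entries \<open>a + h\<close> and \<open>a - h\<close> over a matrix of size \<open>M = 2 ^ k\<close> according to a sign matrix of norm
  \<open>sqrt M\<close>. This matrix has distance of order \<open>sqrt M\<close> from the matrix with constant entry \<open>a\<close>, so the
  images have distance of order \<open>sqrt M\<close> as well; but a second difference
  \<open>f (a + h) + f (a - h) - 2 f a\<close> contributes to the distance of the images with weight of order \<open>M\<close>.
  Hence the maps of an almost complete coarse embedding are asymptotically additive
  (\<open>second_difference_le\<close>, \<open>g_additive\<close>).

  The matrix norms of OH are homogeneous: a bounded operator on the sequence space, linear or antilinear,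
  acts on matrices over OH with norm at most its own (\<open>OH_homogeneous\<close>). Homogeneity implies that
  the norm of a matrix over OH is a continuous function of the Gram matrix of its entries
  (\<open>OH_gram_le\<close>). Therefore estimates for matrices of a fixed size survive a passage to the limit in
  which only inner products of images converge. Tychonoff's theorem provides such a limit \<open>H\<close>
  (\<open>limit_form\<close>). The limit of the maps is real linear; since OH is its own complex conjugate, its
  complex linear part and the conjugate of its antilinear part can be put side by side into two
  orthogonal copies of the sequence space, and \<open>H\<close> becomes a sesquilinear inner product on
  \<open>X\<close> whose norm is equivalent to the given one.

  The space \<open>X\<close> is separable, because a coarse embedding into a separable space separates distant
  points, so it has an orthonormal basis for \<open>H\<close>. The coordinate map \<open>G\<close> of this basis is a linear
  bijection onto the sequence space with \<open>cinner (G x) (G y) = H x y\<close>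
  (\<open>hilbert_coordinates\<close>). For matrices of every size the norms of \<open>amp n G x\<close> and
  \<open>x\<close> are then comparable, with the constants of the coarse embedding.

  Complex interpolation enters through its functoriality (\<open>interp_norm_map\<close>), crude upper
  bounds from Gaussian functions, and lower bounds from linear functionals by the maximum principle
  on the strip (\<open>functional_le_I\<close>).
\<close>

section \<open>Inner products and matrices of operators\<close>

instance chilbert_space \<subseteq> banach ..

lemma cinner_add_right: "cinner x (y + z) = cinner x y + cinner x (z::'a::chilbert_space)"
  using arg_cong[OF cinner_add_left[of y z x], of cnj] by (simp flip: cinner_commute)

lemma cinner_scaleC_right: "cinner x (c *\<^sub>C y) = cnj c * cinner x (y::'a::chilbert_space)"
  using arg_cong[OF cinner_scaleC_left[of c y x], of cnj] by (simp flip: cinner_commute)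

lemma scaleC_minus1: "(- 1) *\<^sub>C x = - (x::'a::complex_vector)"
  using complex_vector.scale_minus_left[of 1 x] by (simp add: scaleC_one)

lemma cinner_minus_left: "cinner (- x) y = - cinner x (y::'a::chilbert_space)"
  using cinner_scaleC_left[of "- 1" x y] by (simp add: scaleC_minus1)

lemma cinner_minus_right: "cinner x (- y) = - cinner x (y::'a::chilbert_space)"
  using cinner_scaleC_right[of x "- 1" y] by (simp add: scaleC_minus1)

lemma cinner_diff_left: "cinner (x - z) y = cinner x y - cinner z (y::'a::chilbert_space)"
  using cinner_add_left[of x "- z" y] by (simp add: cinner_minus_left)

lemma cinner_diff_right: "cinner x (y - z) = cinner x y - cinner x (z::'a::chilbert_space)"
  using cinner_add_right[of x y "- z"] by (simp add: cinner_minus_right)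

lemma cinner_zero_left: "cinner 0 y = 0" for y :: "'a::chilbert_space"
  using cinner_diff_left[of y y y] by simp

lemma cinner_zero_right: "cinner y 0 = 0" for y :: "'a::chilbert_space"
  using cinner_diff_right[of y y y] by simp

lemma cinner_sum_left: "cinner (\<Sum>i\<in>A. f i) y = (\<Sum>i\<in>A. cinner (f i) y)" for y :: "'a::chilbert_space"
  by (induction A rule: infinite_finite_induct) (auto simp: cinner_zero_left cinner_add_left)

lemma cinner_sum_right: "cinner y (\<Sum>i\<in>A. f i) = (\<Sum>i\<in>A. cinner y (f i))" for y :: "'a::chilbert_space"
  by (induction A rule: infinite_finite_induct) (auto simp: cinner_zero_right cinner_add_right)

lemma cinner_self: "cinner x x = complex_of_real ((norm x)\<^sup>2)" for x :: "'a::chilbert_space"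
proof -
  have "Im (cinner x x) = 0"
    using arg_cong[OF cinner_commute[of x x], of Im] by simp
  moreover have "0 \<le> Re (cinner x x)"
    using norm_ge_zero[of x] by (simp add: norm_eq_sqrt_cinner)
  ultimately show ?thesis
    by (simp add: complex_eq_iff norm_eq_sqrt_cinner)
qed

lemma norm_sq_cinner: "(norm x)\<^sup>2 = Re (cinner x x)" for x :: "'a::chilbert_space"
  by (simp add: cinner_self)

lemma norm_add_sq: "(norm (x + y))\<^sup>2 = (norm x)\<^sup>2 + 2 * Re (cinner x y) + (norm y)\<^sup>2"
  for x y :: "'a::chilbert_space"
  using arg_cong[OF cinner_commute[of y x], of Re]
  by (simp add: norm_sq_cinner cinner_add_left cinner_add_right)

lemma parallelogram:
  "(norm (x + y))\<^sup>2 + (norm (x - y))\<^sup>2 = 2 * (norm x)\<^sup>2 + 2 * (norm y)\<^sup>2" for x y :: "'a::chilbert_space"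
  using norm_add_sq[of x y] norm_add_sq[of x "- y"] by (simp add: cinner_minus_right)

lemma cauchy_schwarz: "cmod (cinner x y) \<le> norm x * norm (y::'a::chilbert_space)"
proof (cases "y = 0")
  case False
  define c where "c = cinner x y / complex_of_real ((norm y)\<^sup>2)"
  have "Re (cinner x (- (c *\<^sub>C y))) = - ((cmod (cinner x y))\<^sup>2 / (norm y)\<^sup>2)"
    by (simp add: cinner_minus_right cinner_scaleC_right c_def field_simps complex_norm_square
        flip: of_real_power) (simp add: cmod_def power2_eq_square)
  moreover have "(norm (- (c *\<^sub>C y)))\<^sup>2 = (cmod (cinner x y))\<^sup>2 / (norm y)\<^sup>2"
    using False by (simp add: norm_scaleC c_def norm_divide norm_power power2_eq_square norm_mult)
  ultimately have "0 \<le> (norm x)\<^sup>2 - (cmod (cinner x y))\<^sup>2 / (norm y)\<^sup>2"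
    using norm_add_sq[of x "- (c *\<^sub>C y)"] zero_le_power2[of "norm (x + - (c *\<^sub>C y))"] by linarith
  then have "(cmod (cinner x y))\<^sup>2 \<le> (norm x * norm y)\<^sup>2"
    using False by (simp add: field_simps)
  then show ?thesis by (simp add: abs_le_square_iff[symmetric])
qed (simp add: cinner_zero_right)

lemma norm_sum_le_L2:
  fixes v :: "nat \<Rightarrow> 'a::complex_normed_vector"
  shows "norm (\<Sum>i\<in>A. c i *\<^sub>C v i) \<le> L2_set (\<lambda>i. cmod (c i)) A * L2_set (\<lambda>i. norm (v i)) A"
proof -
  have "norm (\<Sum>i\<in>A. c i *\<^sub>C v i) \<le> (\<Sum>i\<in>A. \<bar>cmod (c i)\<bar> * \<bar>norm (v i)\<bar>)"
    by (rule order_trans[OF norm_sum]) (simp add: norm_scaleC)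
  also have "\<dots> \<le> L2_set (\<lambda>i. cmod (c i)) A * L2_set (\<lambda>i. norm (v i)) A"
    by (rule L2_set_mult_ineq)
  finally show ?thesis .
qed

lemma L2_set_mono_set: "A \<subseteq> B \<Longrightarrow> finite B \<Longrightarrow> L2_set f A \<le> L2_set f B"
  unfolding L2_set_def by (intro real_sqrt_le_mono sum_mono2) auto

lemma op_mnorm_apply:
  fixes T :: "('h::chilbert_space \<Rightarrow>\<^sub>L 'k::chilbert_space) mtx"
  shows "L2_set (\<lambda>i. norm (\<Sum>j<n. blinfun_apply (T i j) (\<xi> j))) {..<n}
     \<le> op_mnorm n T * L2_set (\<lambda>j. norm (\<xi> j)) {..<n}"
    and op_mnorm_nonneg: "0 \<le> op_mnorm n T"
    and op_mnorm_le_sum: "op_mnorm n T \<le> (\<Sum>i<n. \<Sum>j<n. norm (T i j))"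
proof -
  let ?A = "\<lambda>\<xi>. L2_set (\<lambda>i. norm (\<Sum>j<n. blinfun_apply (T i j) (\<xi> j))) {..<n}"
  let ?D = "{\<xi> :: nat \<Rightarrow> 'h. L2_set (\<lambda>j. norm (\<xi> j)) {..<n} \<le> 1}"
  have le: "?A \<xi> \<le> (\<Sum>i<n. \<Sum>j<n. norm (T i j))" if "\<xi> \<in> ?D" for \<xi>
  proof -
    have n1: "norm (\<xi> j) \<le> 1" if "j < n" for j
      using member_le_L2_set[of "{..<n}" j "\<lambda>j. norm (\<xi> j)"] that \<open>\<xi> \<in> ?D\<close> by auto
    have "?A \<xi> \<le> (\<Sum>i<n. norm (\<Sum>j<n. blinfun_apply (T i j) (\<xi> j)))"
      by (intro L2_set_le_sum) simp
    also have "\<dots> \<le> (\<Sum>i<n. \<Sum>j<n. norm (T i j))"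
    proof (intro sum_mono order_trans[OF norm_sum])
      fix i j assume "j \<in> {..<n}"
      then show "norm (blinfun_apply (T i j) (\<xi> j)) \<le> norm (T i j)"
        using norm_blinfun[of "T i j" "\<xi> j"] mult_left_mono[OF n1[of j] norm_ge_zero[of "T i j"]] by simp
    qed
    finally show ?thesis .
  qed
  have z: "(\<lambda>_. 0) \<in> ?D" by (simp add: L2_set_def)
  have bdd: "bdd_above (?A ` ?D)"
    using le by (intro bdd_aboveI2) blast
  have up: "?A \<xi> \<le> op_mnorm n T" if "\<xi> \<in> ?D" for \<xi>
    unfolding op_mnorm_def by (rule cSUP_upper[OF that bdd])
  show nn: "0 \<le> op_mnorm n T"
    using up[OF z] by (simp add: L2_set_def)
  show "op_mnorm n T \<le> (\<Sum>i<n. \<Sum>j<n. norm (T i j))"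
    unfolding op_mnorm_def by (rule cSUP_least[OF _ le]) (use z in \<open>metis empty_iff\<close>)
  let ?L = "L2_set (\<lambda>j. norm (\<xi> j)) {..<n}"
  show "?A \<xi> \<le> op_mnorm n T * ?L"
  proof (cases "?L = 0")
    case True
    then have "\<xi> j = 0" if "j < n" for j
      using that by (auto simp: L2_set_eq_0_iff)
    then show ?thesis by (simp add: L2_set_def True)
  next
    case False
    have pos: "0 < ?L"
      using False L2_set_nonneg[of "\<lambda>j. norm (\<xi> j)"] by (metis antisym_conv2)
    have "L2_set (\<lambda>j. norm (inverse ?L *\<^sub>R \<xi> j)) {..<n} = inverse ?L * ?L"
      using pos by (simp add: L2_set_right_distrib)
    then have "?A (\<lambda>j. inverse ?L *\<^sub>R \<xi> j) \<le> op_mnorm n T"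
      using False by (intro up) simp
    moreover have "?A (\<lambda>j. inverse ?L *\<^sub>R \<xi> j) = inverse ?L * ?A \<xi>"
      using pos by (simp add: blinfun.scaleR_right L2_set_right_distrib flip: scaleR_sum_right)
    ultimately have "?L * (inverse ?L * ?A \<xi>) \<le> ?L * op_mnorm n T"
      using pos by (intro mult_left_mono) auto
    then show ?thesis using False by (simp add: mult.commute flip: mult.assoc)
  qed
qed

lemma op_mnorm_leI:
  assumes "0 \<le> K"
    and "\<And>\<xi>. L2_set (\<lambda>i. norm (\<Sum>j<n. blinfun_apply (T i j) (\<xi> j))) {..<n} \<le> K * L2_set (\<lambda>j. norm (\<xi> j)) {..<n}"
  shows "op_mnorm n T \<le> K"
  unfolding op_mnorm_def
proof (rule cSUP_least)
  show "{\<xi>. L2_set (\<lambda>j. norm (\<xi> j)) {..<n} \<le> 1} \<noteq> {}"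
    by (auto simp: L2_set_def intro: exI[of _ "\<lambda>_. 0"])
  fix \<xi> assume "\<xi> \<in> {\<xi>. L2_set (\<lambda>j. norm (\<xi> j :: 'a)) {..<n} \<le> 1}"
  then show "L2_set (\<lambda>i. norm (\<Sum>j<n. blinfun_apply (T i j) (\<xi> j))) {..<n} \<le> K"
    using assms(2)[of \<xi>] mult_left_mono[of "L2_set (\<lambda>j. norm (\<xi> j)) {..<n}" 1 K] assms(1) by simp
qed

lemma op_mnorm_triangle: "op_mnorm n (S + T) \<le> op_mnorm n S + op_mnorm n T"
proof (rule op_mnorm_leI)
  show "0 \<le> op_mnorm n S + op_mnorm n T" by (intro add_nonneg_nonneg op_mnorm_nonneg)
  fix \<xi> :: "nat \<Rightarrow> 'a"
  let ?S = "\<lambda>i. norm (\<Sum>j<n. blinfun_apply (S i j) (\<xi> j))"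
  let ?T = "\<lambda>i. norm (\<Sum>j<n. blinfun_apply (T i j) (\<xi> j))"
  have "L2_set (\<lambda>i. norm (\<Sum>j<n. blinfun_apply ((S + T) i j) (\<xi> j))) {..<n} \<le> L2_set (\<lambda>i. ?S i + ?T i) {..<n}"
    by (intro L2_set_mono) (auto simp: blinfun.add_left sum.distrib intro: norm_triangle_ineq)
  also have "\<dots> \<le> L2_set ?S {..<n} + L2_set ?T {..<n}" by (rule L2_set_triangle_ineq)
  also have "\<dots> \<le> (op_mnorm n S + op_mnorm n T) * L2_set (\<lambda>j. norm (\<xi> j)) {..<n}"
    unfolding distrib_right by (intro add_mono op_mnorm_apply)
  finally show "L2_set (\<lambda>i. norm (\<Sum>j<n. blinfun_apply ((S + T) i j) (\<xi> j))) {..<n}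
    \<le> (op_mnorm n S + op_mnorm n T) * L2_set (\<lambda>j. norm (\<xi> j)) {..<n}" .
qed

lemma op_mnorm_scaleC: "op_mnorm n (c *\<^sub>C T) = cmod c * op_mnorm n T"
  for T :: "('h::chilbert_space \<Rightarrow>\<^sub>L 'k::chilbert_space) mtx"
proof -
  have eq: "L2_set (\<lambda>i. norm (\<Sum>j<n. blinfun_apply ((c *\<^sub>C T) i j) (\<xi> j))) {..<n}
     = cmod c * L2_set (\<lambda>i. norm (\<Sum>j<n. blinfun_apply (T i j) (\<xi> j))) {..<n}"
    for c and T :: "('h \<Rightarrow>\<^sub>L 'k) mtx" and \<xi>
    by (simp add: scaleC_fun_def blinfun_apply_scaleC norm_scaleC L2_set_right_distrib
        flip: complex_vector.scale_sum_right)
  have le: "op_mnorm n (c *\<^sub>C T) \<le> cmod c * op_mnorm n T" for c and T :: "('h \<Rightarrow>\<^sub>L 'k) mtx"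
    by (rule op_mnorm_leI)
      (auto simp: eq op_mnorm_nonneg mult.assoc intro: mult_left_mono op_mnorm_apply)
  show ?thesis
  proof (cases "c = 0")
    case True
    then show ?thesis using le[of c T] op_mnorm_nonneg[of n "c *\<^sub>C T"] by simp
  next
    case False
    have "inverse c *\<^sub>C (c *\<^sub>C T) = T"
      using False by (simp add: scaleC_scaleC scaleC_one)
    then have "op_mnorm n T \<le> inverse (cmod c) * op_mnorm n (c *\<^sub>C T)"
      using le[of "inverse c" "c *\<^sub>C T"] by (simp add: norm_inverse)
    then show ?thesis using le[of c T] False by (simp add: field_simps)
  qed
qed

lemma L2_set_single: "finite A \<Longrightarrow> k \<in> A \<Longrightarrow> L2_set (\<lambda>j. if j = k then a else 0) A = \<bar>a\<bar>"
  by (simp add: L2_set_def if_distrib[of "\<lambda>x. x\<^sup>2"] sum.delta cong: if_cong)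

lemma norm_entry_le_op_mnorm:
  assumes "i < n" "j < n"
  shows "norm (T i j) \<le> op_mnorm n T"
proof (rule norm_blinfun_bound)
  show "0 \<le> op_mnorm n T" by (rule op_mnorm_nonneg)
  fix x :: 'a
  let ?\<xi> = "\<lambda>k. if k = j then x else 0"
  have "(\<Sum>k<n. blinfun_apply (T i k) (?\<xi> k)) = blinfun_apply (T i j) x"
    using assms by (simp add: if_distrib[of "blinfun_apply _"] sum.delta cong: if_cong)
  then have "norm (blinfun_apply (T i j) x) \<le> L2_set (\<lambda>i. norm (\<Sum>k<n. blinfun_apply (T i k) (?\<xi> k))) {..<n}"
    using member_le_L2_set[of "{..<n}" i "\<lambda>i. norm (\<Sum>k<n. blinfun_apply (T i k) (?\<xi> k))"] assms by simp
  also have "\<dots> \<le> op_mnorm n T * L2_set (\<lambda>k. norm (?\<xi> k)) {..<n}"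
    by (rule op_mnorm_apply)
  also have "L2_set (\<lambda>k. norm (?\<xi> k)) {..<n} = norm x"
    using assms L2_set_single[of "{..<n}" j "norm x"] by (simp add: if_distrib[of norm] cong: if_cong)
  finally show "norm (blinfun_apply (T i j) x) \<le> op_mnorm n T * norm x" .
qed

lemma L2_set_corner:
  fixes n m :: nat
  assumes "n \<le> m" "\<And>i. i < m \<Longrightarrow> n \<le> i \<Longrightarrow> f i = 0"
  shows "L2_set f {..<m} = L2_set f {..<n}"
proof -
  have "(\<Sum>i<m. (f i)\<^sup>2) = (\<Sum>i<n. (f i)\<^sup>2)"
  proof (rule sum.mono_neutral_right)
    show "\<forall>i\<in>{..<m} - {..<n}. (f i)\<^sup>2 = 0" using assms(2) by simp
  qed (use assms(1) in auto)
  then show ?thesis by (simp add: L2_set_def)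
qed

lemma op_mnorm_mono_size:
  assumes "n \<le> m"
  shows "op_mnorm n T \<le> op_mnorm m T"
proof (rule op_mnorm_leI[OF op_mnorm_nonneg])
  fix \<xi> :: "nat \<Rightarrow> 'a"
  let ?\<eta> = "\<lambda>j. if j < n then \<xi> j else 0"
  have "(\<Sum>j<m. blinfun_apply (T i j) (?\<eta> j)) = (\<Sum>j<n. blinfun_apply (T i j) (\<xi> j))" for i
    using assms by (intro sum.mono_neutral_cong_right) auto
  then have "L2_set (\<lambda>i. norm (\<Sum>j<n. blinfun_apply (T i j) (\<xi> j))) {..<n}
      \<le> L2_set (\<lambda>i. norm (\<Sum>j<m. blinfun_apply (T i j) (?\<eta> j))) {..<m}"
    using assms by (simp add: L2_set_mono_set)
  also have "\<dots> \<le> op_mnorm m T * L2_set (\<lambda>j. norm (?\<eta> j)) {..<m}"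
    by (rule op_mnorm_apply)
  also have "L2_set (\<lambda>j. norm (?\<eta> j)) {..<m} = L2_set (\<lambda>j. norm (\<xi> j)) {..<n}"
    using assms L2_set_corner[of n m "\<lambda>j. norm (?\<eta> j)"]
    by (simp add: L2_set_def if_distrib[of norm] cong: if_cong)
  finally show "L2_set (\<lambda>i. norm (\<Sum>j<n. blinfun_apply (T i j) (\<xi> j))) {..<n}
      \<le> op_mnorm m T * L2_set (\<lambda>j. norm (\<xi> j)) {..<n}" .
qed

lemma op_mnorm_corner:
  assumes "n \<le> m" "T \<in> Mat n UNIV"
  shows "op_mnorm m T = op_mnorm n T"
proof -
  have z: "T i j = 0" if "n \<le> i \<or> n \<le> j" for i j
    using assms(2) that by (auto simp: Mat_def not_less dest!: spec[of _ i] spec[of _ j] split: if_splits)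
  have cols: "(\<Sum>j<m. blinfun_apply (T i j) (\<xi> j)) = (\<Sum>j<n. blinfun_apply (T i j) (\<xi> j))" for i \<xi>
    using assms(1) z by (intro sum.mono_neutral_right) auto
  have eq: "L2_set (\<lambda>i. norm (\<Sum>j<m. blinfun_apply (T i j) (\<xi> j))) {..<m}
      = L2_set (\<lambda>i. norm (\<Sum>j<n. blinfun_apply (T i j) (\<xi> j))) {..<n}" for \<xi>
    unfolding cols using assms(1) z by (intro L2_set_corner) auto
  show ?thesis
  proof (rule antisym)
    show "op_mnorm m T \<le> op_mnorm n T"
    proof (rule op_mnorm_leI[OF op_mnorm_nonneg])
      fix \<xi> :: "nat \<Rightarrow> 'a"
      have "L2_set (\<lambda>i. norm (\<Sum>j<m. blinfun_apply (T i j) (\<xi> j))) {..<m}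
          \<le> op_mnorm n T * L2_set (\<lambda>j. norm (\<xi> j)) {..<n}"
        unfolding eq by (rule op_mnorm_apply)
      also have "\<dots> \<le> op_mnorm n T * L2_set (\<lambda>j. norm (\<xi> j)) {..<m}"
        using assms(1) by (intro mult_left_mono L2_set_mono_set op_mnorm_nonneg) auto
      finally show "L2_set (\<lambda>i. norm (\<Sum>j<m. blinfun_apply (T i j) (\<xi> j))) {..<m}
          \<le> op_mnorm n T * L2_set (\<lambda>j. norm (\<xi> j)) {..<m}" .
    qed
    show "op_mnorm n T \<le> op_mnorm m T" by (rule op_mnorm_mono_size[OF assms(1)])
  qed
qed

section \<open>The complex method for two seminorms on one space\<close>

abbreviation closed_strip :: "complex set" where "closed_strip \<equiv> {z. 0 \<le> Re z \<and> Re z \<le> 1}"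

abbreviation open_strip :: "complex set" where "open_strip \<equiv> {z. 0 < Re z \<and> Re z < 1}"

text \<open>The factor \<open>exp (\<delta> (z\<^sup>2 - 1))\<close> has modulus at most one on the strip and makes bounded functions
  vanish at its ends, which reduces the claim to the maximum principle on rectangles; then \<open>\<delta>\<close> tends
  to zero.\<close>

lemma strip_maximum_principle:
  fixes \<phi> :: "complex \<Rightarrow> complex"
  assumes cont: "continuous_on closed_strip \<phi>"
    and hol: "\<phi> holomorphic_on open_strip"
    and bdd: "\<And>z. 0 \<le> Re z \<Longrightarrow> Re z \<le> 1 \<Longrightarrow> cmod (\<phi> z) \<le> M"
    and edge: "\<And>t. cmod (\<phi> (Complex 0 t)) \<le> B" "\<And>t. cmod (\<phi> (Complex 1 t)) \<le> B"
  shows "cmod (\<phi> (1/2)) \<le> B"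
proof -
  have main: "cmod (\<phi> (1/2)) * exp (- \<delta>) \<le> B'" if "0 < \<delta>" "B < B'" for \<delta> B'
  proof -
    have "0 \<le> B" using edge(1)[of 0] norm_ge_zero by (rule order_trans[rotated])
    then have "0 < B'" using that by linarith
    define \<psi> where "\<psi> z = exp (of_real \<delta> * (z\<^sup>2 - 1)) * \<phi> z" for z
    have damp: "cmod (exp (of_real \<delta> * (z\<^sup>2 - 1))) = exp (\<delta> * ((Re z)\<^sup>2 - (Im z)\<^sup>2 - 1))" for z
      by (simp add: Re_power2)
    have damp_le: "cmod (exp (of_real \<delta> * (z\<^sup>2 - 1))) \<le> exp (- (\<delta> * (Im z)\<^sup>2))"
      if "0 \<le> Re z" "Re z \<le> 1" for z
    proof -
      have "(Re z)\<^sup>2 \<le> 1" using that by (simp add: power_le_one)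
      then have "\<delta> * ((Re z)\<^sup>2 - (Im z)\<^sup>2 - 1) \<le> \<delta> * (- (Im z)\<^sup>2)"
        using \<open>0 < \<delta>\<close> by (intro mult_left_mono) auto
      then show ?thesis unfolding damp by simp
    qed
    have "((\<lambda>y::real. exp (- (\<delta> * y\<^sup>2)) * M) \<longlongrightarrow> 0) at_top"
      using \<open>0 < \<delta>\<close> by real_asymp
    then have "\<forall>\<^sub>F y in at_top. exp (- (\<delta> * y\<^sup>2)) * M < B'"
      using \<open>0 < B'\<close> by (rule order_tendstoD)
    then have "\<forall>\<^sub>F y in at_top. exp (- (\<delta> * y\<^sup>2)) * M < B' \<and> 1 \<le> y"
      using eventually_ge_at_top[of 1] by (rule eventually_conj)
    then obtain Y where Y: "Y \<ge> 1" "exp (- (\<delta> * Y\<^sup>2)) * M < B'"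
      using eventually_happens' trivial_limit_at_top_linorder by blast
    let ?R = "cbox (Complex 0 (-Y)) (Complex 1 Y)"
    have R: "z \<in> ?R \<longleftrightarrow> 0 \<le> Re z \<and> Re z \<le> 1 \<and> -Y \<le> Im z \<and> Im z \<le> Y" for z
      by (auto simp: in_cbox_complex_iff)
    have R': "z \<in> box (Complex 0 (-Y)) (Complex 1 Y) \<longleftrightarrow> 0 < Re z \<and> Re z < 1 \<and> -Y < Im z \<and> Im z < Y" for z
      by (auto simp: in_box_complex_iff)
    have "cmod (\<psi> (1/2)) \<le> B'"
    proof (rule maximum_modulus_frontier[of \<psi> ?R])
      have "\<phi> holomorphic_on box (Complex 0 (-Y)) (Complex 1 Y)"
        by (rule holomorphic_on_subset[OF hol]) (auto simp: R')
      then show "\<psi> holomorphic_on interior ?R"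
        unfolding \<psi>_def interior_cbox by (intro holomorphic_intros)
      have "continuous_on ?R \<phi>"
        by (rule continuous_on_subset[OF cont]) (auto simp: R)
      then show "continuous_on (closure ?R) \<psi>"
        unfolding \<psi>_def by (auto intro!: continuous_intros)
      show "bounded ?R" by simp
      show "1/2 \<in> ?R" using Y by (simp add: R)
      fix z assume "z \<in> frontier ?R"
      then have "z \<in> ?R - box (Complex 0 (-Y)) (Complex 1 Y)" by (simp add: frontier_cbox)
      then have z: "0 \<le> Re z" "Re z \<le> 1" and or: "Re z = 0 \<or> Re z = 1 \<or> \<bar>Im z\<bar> = Y"
        using Y by (auto simp: R R')
      have d1: "cmod (exp (of_real \<delta> * (z\<^sup>2 - 1))) \<le> 1"
      proof -
        have "exp (- (\<delta> * (Im z)\<^sup>2)) \<le> 1" using \<open>0 < \<delta>\<close> by simp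
        then show ?thesis using damp_le[OF z] by linarith
      qed
      show "cmod (\<psi> z) \<le> B'"
      proof (cases "Re z = 0 \<or> Re z = 1")
        case True
        then have "z = Complex 0 (Im z) \<or> z = Complex 1 (Im z)" by (auto simp: complex_eq_iff)
        then have "cmod (\<phi> z) \<le> B" using edge by metis
        then have "cmod (\<psi> z) \<le> 1 * B"
          unfolding \<psi>_def norm_mult using d1 by (intro mult_mono) auto
        then show ?thesis using \<open>B < B'\<close> by simp
      next
        case False
        then have "(Im z)\<^sup>2 = Y\<^sup>2" using or by (metis power2_abs)
        then have "cmod (\<psi> z) \<le> exp (- (\<delta> * Y\<^sup>2)) * M"
          unfolding \<psi>_def norm_mult using damp_le[OF z] bdd[OF z] by (intro mult_mono) auto
        then show ?thesis using Y by linarith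
      qed
    qed
    moreover have "exp (- \<delta>) \<le> exp (- (\<delta> * (3/4)))" using \<open>0 < \<delta>\<close> by simp
    moreover have "cmod (\<psi> (1/2)) = exp (- (\<delta> * (3/4))) * cmod (\<phi> (1/2))"
      unfolding \<psi>_def norm_mult damp by (simp add: power2_eq_square)
    ultimately have "exp (- \<delta>) * cmod (\<phi> (1/2)) \<le> B'"
      by (metis mult_right_mono norm_ge_zero order_trans)
    then show ?thesis by (simp add: mult.commute)
  qed
  have "((\<lambda>\<delta>. cmod (\<phi> (1/2)) * exp (- \<delta>)) \<longlongrightarrow> cmod (\<phi> (1/2)) * exp (- 0)) (at_right 0)"
    by (intro tendsto_intros)
  then have "cmod (\<phi> (1/2)) * exp (- 0) \<le> B'" if "B < B'" for B'
    by (rule tendsto_upperbound)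
      (use main[OF _ that] in \<open>auto simp: eventually_at_right_less intro: eventually_mono[OF eventually_at_right_less]\<close>)
  then show ?thesis by (metis (no_types, lifting) dense_ge exp_zero minus_zero mult.right_neutral)
qed

text \<open>Over the row and the column space the matrices of a given size form the same vector space, so the
  couples that occur here have one carrier and two seminorms on it.\<close>

locale seminorm_pair =
  fixes V :: "'v::complex_vector set" and N0 N1 :: "'v \<Rightarrow> real"
  assumes subspace: "csubspace V"
    and N0_nonneg: "x \<in> V \<Longrightarrow> 0 \<le> N0 x"
    and N1_nonneg: "x \<in> V \<Longrightarrow> 0 \<le> N1 x"
    and N0_triangle: "x \<in> V \<Longrightarrow> y \<in> V \<Longrightarrow> N0 (x + y) \<le> N0 x + N0 y"
    and N1_triangle: "x \<in> V \<Longrightarrow> y \<in> V \<Longrightarrow> N1 (x + y) \<le> N1 x + N1 y"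
    and N0_scale: "x \<in> V \<Longrightarrow> N0 (c *\<^sub>C x) = cmod c * N0 x"
    and N1_scale: "x \<in> V \<Longrightarrow> N1 (c *\<^sub>C x) = cmod c * N1 x"
begin

abbreviation "S \<equiv> sum_norm V N0 V N1"
abbreviation "\<F> \<equiv> calderon_functions V N0 V N1"
abbreviation "I \<equiv> interp_norm V N0 V N1 (1/2)"

lemma zero_mem: "0 \<in> V" and add_mem: "x \<in> V \<Longrightarrow> y \<in> V \<Longrightarrow> x + y \<in> V"
  and diff_mem: "x \<in> V \<Longrightarrow> y \<in> V \<Longrightarrow> x - y \<in> V" and scale_mem: "x \<in> V \<Longrightarrow> c *\<^sub>C x \<in> V"
  using subspace complex_vector.subspace_diff[OF subspace] by (auto simp: complex_vector.subspace_def)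

lemma N0_zero: "N0 0 = 0" and N1_zero: "N1 0 = 0"
  using N0_scale[of 0 0] N1_scale[of 0 0] zero_mem by simp_all

lemma sum_space_self: "sum_space V V = V"
  unfolding sum_space_def using zero_mem add_mem by (force intro: exI[of _ 0])

lemma S_le:
  assumes "a \<in> V" "b \<in> V"
  shows "S (a + b) \<le> N0 a + N1 b"
  unfolding sum_norm_def using assms N0_nonneg N1_nonneg
  by (intro cInf_lower bdd_belowI[of _ 0]) auto

lemma S_greatest:
  assumes "x \<in> V" "\<And>a b. a \<in> V \<Longrightarrow> b \<in> V \<Longrightarrow> x = a + b \<Longrightarrow> K \<le> N0 a + N1 b"
  shows "K \<le> S x"
  unfolding sum_norm_def
proof (rule cInf_greatest)
  have "N0 x + N1 0 \<in> {N0 a + N1 b |a b. a \<in> V \<and> b \<in> V \<and> x = a + b}"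
    using assms(1) zero_mem by (intro CollectI exI[of _ x] exI[of _ 0]) simp
  then show "{N0 a + N1 b |a b. a \<in> V \<and> b \<in> V \<and> x = a + b} \<noteq> {}" by blast
qed (use assms(2) in blast)

lemma S_le_N0: "x \<in> V \<Longrightarrow> S x \<le> N0 x"
  using S_le[of x 0] by (simp add: zero_mem N1_zero)

lemma S_nonneg: "x \<in> V \<Longrightarrow> 0 \<le> S x"
  using N0_nonneg N1_nonneg by (intro S_greatest) (auto intro: add_nonneg_nonneg)

lemma S_triangle:
  assumes "x \<in> V" "y \<in> V"
  shows "S (x + y) \<le> S x + S y"
proof -
  have "S (x + y) - (N0 a + N1 b) \<le> S y" if "a \<in> V" "b \<in> V" "x = a + b" for a b
  proof (rule S_greatest[OF assms(2)])
    fix c d assume cd: "c \<in> V" "d \<in> V" "y = c + d"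
    have "x + y = (a + c) + (b + d)" using that cd by simp
    then have "S (x + y) \<le> N0 (a + c) + N1 (b + d)"
      using S_le[of "a + c" "b + d"] that cd add_mem by metis
    then show "S (x + y) - (N0 a + N1 b) \<le> N0 c + N1 d"
      using N0_triangle[of a c] N1_triangle[of b d] that cd by linarith
  qed
  then have "S (x + y) - S y \<le> S x"
    by (intro S_greatest[OF assms(1)]) (force simp: algebra_simps)
  then show ?thesis by simp
qed

lemma abs_N0_diff_le: "x \<in> V \<Longrightarrow> y \<in> V \<Longrightarrow> \<bar>N0 x - N0 y\<bar> \<le> N0 (x - y)"
  and abs_N1_diff_le: "x \<in> V \<Longrightarrow> y \<in> V \<Longrightarrow> \<bar>N1 x - N1 y\<bar> \<le> N1 (x - y)"
  using N0_triangle[of "x - y" y] N0_triangle[of "y - x" x] N0_scale[of "x - y" "- 1"]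
    N1_triangle[of "x - y" y] N1_triangle[of "y - x" x] N1_scale[of "x - y" "- 1"] diff_mem
  by (auto simp: scaleC_minus1)

lemma calderonD:
  assumes "F \<in> \<F>"
  shows "0 \<le> Re z \<Longrightarrow> Re z \<le> 1 \<Longrightarrow> F z \<in> V"
    and "\<exists>M. \<forall>z. 0 \<le> Re z \<and> Re z \<le> 1 \<longrightarrow> S (F z) \<le> M"
    and "0 \<le> Re z \<Longrightarrow> Re z \<le> 1 \<Longrightarrow> ((\<lambda>w. S (F w - F z)) \<longlongrightarrow> 0) (at z within closed_strip)"
    and "0 < Re z \<Longrightarrow> Re z < 1 \<Longrightarrow>
      \<exists>D\<in>V. ((\<lambda>w. S (inverse (w - z) *\<^sub>C (F w - F z) - D)) \<longlongrightarrow> 0) (at z within open_strip)"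
    and "((\<lambda>t. N0 (F (Complex 0 t) - F (Complex 0 s))) \<longlongrightarrow> 0) (at s)"
    and "((\<lambda>t. N1 (F (Complex 1 t) - F (Complex 1 s))) \<longlongrightarrow> 0) (at s)"
    and "((\<lambda>t. N0 (F (Complex 0 t))) \<longlongrightarrow> 0) at_infinity"
    and "((\<lambda>t. N1 (F (Complex 1 t))) \<longlongrightarrow> 0) at_infinity"
  using assms unfolding calderon_functions_def sum_space_self ncontinuous_on_def nholomorphic_on_def
  by auto

lemma calderonI:
  assumes "\<And>z. 0 \<le> Re z \<Longrightarrow> Re z \<le> 1 \<Longrightarrow> F z \<in> V"
    and "\<And>z. 0 \<le> Re z \<Longrightarrow> Re z \<le> 1 \<Longrightarrow> S (F z) \<le> M"
    and "\<And>z. 0 \<le> Re z \<Longrightarrow> Re z \<le> 1 \<Longrightarrow> ((\<lambda>w. S (F w - F z)) \<longlongrightarrow> 0) (at z within closed_strip)"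
    and "\<And>z. 0 < Re z \<Longrightarrow> Re z < 1 \<Longrightarrow>
      \<exists>D\<in>V. ((\<lambda>w. S (inverse (w - z) *\<^sub>C (F w - F z) - D)) \<longlongrightarrow> 0) (at z within open_strip)"
    and "\<And>s. ((\<lambda>t. N0 (F (Complex 0 t) - F (Complex 0 s))) \<longlongrightarrow> 0) (at s)"
    and "\<And>s. ((\<lambda>t. N1 (F (Complex 1 t) - F (Complex 1 s))) \<longlongrightarrow> 0) (at s)"
    and "((\<lambda>t. N0 (F (Complex 0 t))) \<longlongrightarrow> 0) at_infinity"
    and "((\<lambda>t. N1 (F (Complex 1 t))) \<longlongrightarrow> 0) at_infinity"
  shows "F \<in> \<F>"
  unfolding calderon_functions_def sum_space_self ncontinuous_on_def nholomorphic_on_def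
  using assms by auto

text \<open>The suprema in the definition of the Calderon norm are suprema of bounded sets of reals: continuity
  bounds the function on a compact interval, and its limit at infinity bounds it elsewhere.\<close>

lemma bdd_above_edge:
  fixes f :: "real \<Rightarrow> real"
  assumes "\<And>s. ((\<lambda>t. f t) \<longlongrightarrow> f s) (at s)" "(f \<longlongrightarrow> 0) at_infinity"
  shows "bdd_above (range f)"
proof -
  have "\<forall>\<^sub>F t in at_infinity. f t < 1" using assms(2) by (rule order_tendstoD) simp
  then obtain R where R: "\<And>t. R \<le> norm t \<Longrightarrow> f t < 1" unfolding eventually_at_infinity by blast
  have "continuous_on {-R..R} f"
    using assms(1) by (auto simp: continuous_on_def intro: tendsto_within_subset)
  then have "compact (f ` {-R..R})" by (intro compact_continuous_image) auto
  then obtain M where M: "\<And>t. t \<in> {-R..R} \<Longrightarrow> f t \<le> M"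
    using compact_imp_bounded bounded_imp_bdd_above by (metis bdd_above.unfold imageI)
  have "f t \<le> max M 1" for t
  proof (cases "t \<in> {-R..R}")
    case False
    then have "R \<le> norm t" by auto
    then show ?thesis using R[of t] by (intro max.coboundedI2) simp
  qed (use M in fastforce)
  then show ?thesis by (intro bdd_aboveI2) auto
qed

lemma
  assumes F: "F \<in> \<F>"
  shows N0_edge_le: "N0 (F (Complex 0 t)) \<le> calderon_norm N0 N1 F"
    and N1_edge_le: "N1 (F (Complex 1 t)) \<le> calderon_norm N0 N1 F"
    and calderon_norm_nonneg: "0 \<le> calderon_norm N0 N1 F"
proof -
  have m: "F (Complex 0 t) \<in> V" "F (Complex 1 t) \<in> V" for t
    using calderonD(1)[OF F] by simp_all
  have "((\<lambda>t. N0 (F (Complex 0 t))) \<longlongrightarrow> N0 (F (Complex 0 s))) (at s)" for s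
    by (rule LIM_zero_cancel, rule tendsto_rabs_zero_cancel, rule tendsto_sandwich[OF _ _ tendsto_const calderonD(5)[OF F]])
      (auto intro!: always_eventually abs_N0_diff_le m)
  from bdd_above_edge[OF this calderonD(7)[OF F]]
  have 0: "bdd_above (range (\<lambda>t. N0 (F (Complex 0 t))))" .
  have "((\<lambda>t. N1 (F (Complex 1 t))) \<longlongrightarrow> N1 (F (Complex 1 s))) (at s)" for s
    by (rule LIM_zero_cancel, rule tendsto_rabs_zero_cancel, rule tendsto_sandwich[OF _ _ tendsto_const calderonD(6)[OF F]])
      (auto intro!: always_eventually abs_N1_diff_le m)
  from bdd_above_edge[OF this calderonD(8)[OF F]]
  have 1: "bdd_above (range (\<lambda>t. N1 (F (Complex 1 t))))" .
  show *: "N0 (F (Complex 0 t)) \<le> calderon_norm N0 N1 F" for t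
    unfolding calderon_norm_def by (rule max.coboundedI1, rule cSUP_upper[OF UNIV_I 0])
  show "N1 (F (Complex 1 t)) \<le> calderon_norm N0 N1 F"
    unfolding calderon_norm_def by (rule max.coboundedI2, rule cSUP_upper[OF UNIV_I 1])
  show "0 \<le> calderon_norm N0 N1 F"
    using *[of 0] N0_nonneg[OF m(1)[of 0]] by linarith
qed

lemma I_leI:
  assumes "F \<in> \<F>" "F (1/2) = x"
    and "\<And>t. N0 (F (Complex 0 t)) \<le> K" "\<And>t. N1 (F (Complex 1 t)) \<le> K"
  shows "I x \<le> K"
proof -
  have "I x \<le> calderon_norm N0 N1 F"
    unfolding interp_norm_def
  proof (rule cInf_lower)
    show "calderon_norm N0 N1 F \<in> {calderon_norm N0 N1 F |F. F \<in> \<F> \<and> F (complex_of_real (1/2)) = x}"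
      using assms by (intro CollectI exI[of _ F]) simp
  qed (auto intro!: bdd_belowI[of _ 0] calderon_norm_nonneg)
  also have "\<dots> \<le> K"
    unfolding calderon_norm_def using assms(3,4) by (intro max.boundedI cSUP_least) auto
  finally show ?thesis .
qed

text \<open>Constant functions do not decay on the edges of the strip. The Gaussian factor repairs this and is one
  at the point \<open>1/2\<close>.\<close>

lemma gaussian_mem:
  assumes x: "x \<in> V"
  shows "(\<lambda>z. exp (z\<^sup>2 - 1/4) *\<^sub>C x) \<in> \<F>"
proof -
  define g where "g z = exp (z\<^sup>2 - 1/4)" for z :: complex
  have diff: "a *\<^sub>C x - b *\<^sub>C x = (a - b) *\<^sub>C x" for a b
    by (simp add: complex_vector.scale_left_diff_distrib)
  have ng: "cmod (g z) = exp ((Re z)\<^sup>2 - (Im z)\<^sup>2 - 1/4)" for z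
    by (simp add: g_def Re_power2)
  have S0: "S (c *\<^sub>C x) \<le> cmod c * N0 x" for c
    using S_le_N0[of "c *\<^sub>C x"] x by (simp add: scale_mem N0_scale)
  have cont: "((\<lambda>w. S ((a w) *\<^sub>C x)) \<longlongrightarrow> 0) G" if "(a \<longlongrightarrow> 0) G" for a and G :: "complex filter"
    by (rule tendsto_sandwich[OF _ _ tendsto_const tendsto_mult_left_zero[OF tendsto_norm_zero[OF that], of "N0 x"]])
      (auto intro!: always_eventually S_nonneg scale_mem x S0)
  have "filterlim (\<lambda>t::real. \<bar>t\<bar>) at_top at_infinity"
    using filterlim_norm_at_top[where 'a = real] by (simp only: real_norm_def[abs_def])
  moreover have "((\<lambda>s::real. exp (c\<^sup>2 - s\<^sup>2 - 1/4)) \<longlongrightarrow> 0) at_top" for c :: real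
    by real_asymp
  ultimately have "((\<lambda>t::real. exp (c\<^sup>2 - \<bar>t\<bar>\<^sup>2 - 1/4)) \<longlongrightarrow> 0) at_infinity" for c :: real
    by (rule filterlim_compose[rotated])
  then have van: "((\<lambda>t. cmod (g (Complex c t)) * r) \<longlongrightarrow> 0) at_infinity" for c r
    by (intro tendsto_mult_left_zero) (simp add: ng)
  have line: "((\<lambda>t. cmod (g (Complex c t) - g (Complex c s)) * r) \<longlongrightarrow> 0) (at s)" for c s r
  proof -
    have "((\<lambda>t. g (Complex c t)) \<longlongrightarrow> g (Complex c s)) (at s)"
      unfolding g_def Complex_eq by (intro tendsto_intros)
    then show ?thesis by (intro tendsto_mult_left_zero tendsto_norm_zero LIM_zero)
  qed
  have "(\<lambda>z. g z *\<^sub>C x) \<in> \<F>"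
  proof (rule calderonI)
    show "g z *\<^sub>C x \<in> V" for z by (rule scale_mem[OF x])
    show "S (g z *\<^sub>C x) \<le> exp 1 * N0 x" if "0 \<le> Re z" "Re z \<le> 1" for z
    proof -
      have "(Re z)\<^sup>2 \<le> 1" using that by (simp add: power_le_one)
      then have "(Re z)\<^sup>2 - (Im z)\<^sup>2 - 1/4 \<le> 1" using zero_le_power2[of "Im z"] by linarith
      then show ?thesis using N0_nonneg[OF x] by (intro order_trans[OF S0] mult_right_mono) (simp_all add: ng)
    qed
    show "((\<lambda>w. S (g w *\<^sub>C x - g z *\<^sub>C x)) \<longlongrightarrow> 0) (at z within closed_strip)" for z
      unfolding diff by (intro cont LIM_zero) (auto simp: g_def intro!: tendsto_intros)
    show "\<exists>D\<in>V. ((\<lambda>w. S (inverse (w - z) *\<^sub>C (g w *\<^sub>C x - g z *\<^sub>C x) - D)) \<longlongrightarrow> 0)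
        (at z within open_strip)" for z
    proof (intro bexI)
      have "(g has_field_derivative 2 * z * g z) (at z within open_strip)"
        unfolding g_def by (auto intro!: derivative_eq_intros)
      then have "((\<lambda>w. inverse (w - z) * (g w - g z)) \<longlongrightarrow> 2 * z * g z) (at z within open_strip)"
        by (simp add: has_field_derivative_iff field_class.field_divide_inverse mult.commute)
      then show "((\<lambda>w. S (inverse (w - z) *\<^sub>C (g w *\<^sub>C x - g z *\<^sub>C x) - (2 * z * g z) *\<^sub>C x)) \<longlongrightarrow> 0)
          (at z within open_strip)"
        unfolding diff scaleC_scaleC by (intro cont LIM_zero)
    qed (rule scale_mem[OF x])
  qed (simp_all add: diff N0_scale N1_scale x scale_mem van line)
  then show ?thesis by (simp add: g_def)
qed

lemma I_greatest:
  assumes "x \<in> V"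
    and "\<And>F B. F \<in> \<F> \<Longrightarrow> F (1/2) = x \<Longrightarrow> (\<And>t. N0 (F (Complex 0 t)) \<le> B) \<Longrightarrow>
      (\<And>t. N1 (F (Complex 1 t)) \<le> B) \<Longrightarrow> K \<le> B"
  shows "K \<le> I x"
  unfolding interp_norm_def
proof (rule cInf_greatest)
  have "calderon_norm N0 N1 (\<lambda>z. exp (z\<^sup>2 - 1/4) *\<^sub>C x)
      \<in> {calderon_norm N0 N1 F |F. F \<in> \<F> \<and> F (complex_of_real (1/2)) = x}"
    using gaussian_mem[OF assms(1)]
    by (intro CollectI exI[of _ "\<lambda>z. exp (z\<^sup>2 - 1/4) *\<^sub>C x"]) (simp add: power2_eq_square scaleC_one)
  then show "{calderon_norm N0 N1 F |F. F \<in> \<F> \<and> F (complex_of_real (1/2)) = x} \<noteq> {}" by blast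
qed (auto intro: assms(2) N0_edge_le N1_edge_le)

lemma I_approx:
  assumes "x \<in> V" "0 < e"
  obtains F where "F \<in> \<F>" "F (1/2) = x" "\<And>t. N0 (F (Complex 0 t)) \<le> I x + e" "\<And>t. N1 (F (Complex 1 t)) \<le> I x + e"
proof (rule ccontr)
  assume "\<not> thesis"
  with that have no: "\<not> (F \<in> \<F> \<and> F (1/2) = x \<and> (\<forall>t. N0 (F (Complex 0 t)) \<le> I x + e) \<and> (\<forall>t. N1 (F (Complex 1 t)) \<le> I x + e))" for F
    by blast
  have "I x + e \<le> I x"
  proof (rule I_greatest[OF assms(1)])
    fix F B assume "F \<in> \<F>" "F (1/2) = x" "\<And>t. N0 (F (Complex 0 t)) \<le> B" "\<And>t. N1 (F (Complex 1 t)) \<le> B"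
    then show "I x + e \<le> B" using no[of F] by (meson linear order_trans)
  qed
  with assms(2) show False by simp
qed

lemma I_nonneg: "x \<in> V \<Longrightarrow> 0 \<le> I x"
proof (rule I_greatest)
  fix F B assume "F \<in> \<F>" "\<And>t. N0 (F (Complex 0 t)) \<le> B"
  moreover have "0 \<le> N0 (F (Complex 0 0))" using calderonD(1)[OF \<open>F \<in> \<F>\<close>] by (intro N0_nonneg) simp
  ultimately show "0 \<le> B" by (meson order_trans)
qed

lemma I_le_max:
  assumes "x \<in> V" "N0 x \<le> K" "N1 x \<le> K"
  shows "I x \<le> exp 1 * K"
proof (rule I_leI[OF gaussian_mem[OF assms(1)]])
  show "exp ((1/2)\<^sup>2 - 1/4 :: complex) *\<^sub>C x = x" by (simp add: power2_eq_square scaleC_one)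
  have e: "exp (- t\<^sup>2 - 1/4) \<le> exp 1" "exp (1 - t\<^sup>2 - 1/4) \<le> exp 1" for t :: real
    using zero_le_power2[of t] by (simp_all only: exp_le_cancel_iff)
  show "N0 (exp ((Complex 0 t)\<^sup>2 - 1/4) *\<^sub>C x) \<le> exp 1 * K" for t
    using assms N0_nonneg e[of t] by (simp add: N0_scale Re_power2 mult_mono)
  show "N1 (exp ((Complex 1 t)\<^sup>2 - 1/4) *\<^sub>C x) \<le> exp 1 * K" for t
    using assms N1_nonneg e[of t] by (simp add: N1_scale Re_power2 mult_mono)
qed

lemma calderon_add:
  assumes F: "F \<in> \<F>" and G: "G \<in> \<F>"
  shows "(\<lambda>z. F z + G z) \<in> \<F>"
proof -
  have diff: "(F w + G w) - (F z + G z) = (F w - F z) + (G w - G z)" for w z by simp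
  have lim: "((\<lambda>w. N (a w + b w)) \<longlongrightarrow> 0) A"
    if "\<And>x y. x \<in> V \<Longrightarrow> y \<in> V \<Longrightarrow> N (x + y) \<le> N x + N y" "\<And>x. x \<in> V \<Longrightarrow> 0 \<le> N x"
      "((\<lambda>w. N (a w)) \<longlongrightarrow> 0) A" "((\<lambda>w. N (b w)) \<longlongrightarrow> 0) A" "\<forall>\<^sub>F w in A. a w \<in> V \<and> b w \<in> V"
    for N :: "'v \<Rightarrow> real" and a b and A :: "'t filter"
  proof (rule tendsto_sandwich[OF _ _ tendsto_const])
    show "((\<lambda>w. N (a w) + N (b w)) \<longlongrightarrow> 0) A" using tendsto_add[OF that(3,4)] by simp
    show "\<forall>\<^sub>F w in A. 0 \<le> N (a w + b w)"
      using that(5) by eventually_elim (auto intro: that(2) add_mem)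
    show "\<forall>\<^sub>F w in A. N (a w + b w) \<le> N (a w) + N (b w)"
      using that(5) by eventually_elim (auto intro: that(1))
  qed
  obtain M1 M2 where M: "\<And>z. 0 \<le> Re z \<Longrightarrow> Re z \<le> 1 \<Longrightarrow> S (F z) \<le> M1"
    "\<And>z. 0 \<le> Re z \<Longrightarrow> Re z \<le> 1 \<Longrightarrow> S (G z) \<le> M2"
    using calderonD(2)[OF F] calderonD(2)[OF G] by blast
  note mF = calderonD(1)[OF F] and mG = calderonD(1)[OF G]
  show ?thesis
  proof (rule calderonI)
    show "F z + G z \<in> V" if "0 \<le> Re z" "Re z \<le> 1" for z using mF mG that by (intro add_mem)
    show "S (F z + G z) \<le> M1 + M2" if "0 \<le> Re z" "Re z \<le> 1" for z
      using S_triangle[OF mF mG, of z z] M[of z] that by linarith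
    show "((\<lambda>w. S (F w + G w - (F z + G z))) \<longlongrightarrow> 0) (at z within closed_strip)"
      if "0 \<le> Re z" "Re z \<le> 1" for z
      unfolding diff
      by (intro lim S_triangle S_nonneg calderonD(3)[OF F] calderonD(3)[OF G] that)
        (use that in \<open>auto simp: eventually_at_filter intro!: always_eventually diff_mem mF mG\<close>)
    show "\<exists>D\<in>V. ((\<lambda>w. S (inverse (w - z) *\<^sub>C (F w + G w - (F z + G z)) - D)) \<longlongrightarrow> 0)
        (at z within open_strip)" if z: "0 < Re z" "Re z < 1" for z
    proof -
      obtain D E where D: "D \<in> V" "((\<lambda>w. S (inverse (w - z) *\<^sub>C (F w - F z) - D)) \<longlongrightarrow> 0) (at z within open_strip)"
        and E: "E \<in> V" "((\<lambda>w. S (inverse (w - z) *\<^sub>C (G w - G z) - E)) \<longlongrightarrow> 0) (at z within open_strip)"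
        using calderonD(4)[OF F z] calderonD(4)[OF G z] by blast
      have eq: "inverse (w - z) *\<^sub>C (F w + G w - (F z + G z)) - (D + E)
          = (inverse (w - z) *\<^sub>C (F w - F z) - D) + (inverse (w - z) *\<^sub>C (G w - G z) - E)" for w
        unfolding diff scaleC_add_right by simp
      have "((\<lambda>w. S (inverse (w - z) *\<^sub>C (F w + G w - (F z + G z)) - (D + E))) \<longlongrightarrow> 0)
          (at z within open_strip)"
        unfolding eq
        by (intro lim S_triangle S_nonneg D E)
          (use z in \<open>auto simp: eventually_at_filter intro!: always_eventually diff_mem scale_mem mF mG D E\<close>)
      then show ?thesis using add_mem[OF D(1) E(1)] by blast
    qed
    show "((\<lambda>t. N0 (F (Complex 0 t) + G (Complex 0 t) - (F (Complex 0 s) + G (Complex 0 s)))) \<longlongrightarrow> 0) (at s)" for s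
      unfolding diff by (intro lim N0_triangle N0_nonneg calderonD(5)[OF F] calderonD(5)[OF G])
        (auto intro!: always_eventually diff_mem mF mG)
    show "((\<lambda>t. N1 (F (Complex 1 t) + G (Complex 1 t) - (F (Complex 1 s) + G (Complex 1 s)))) \<longlongrightarrow> 0) (at s)" for s
      unfolding diff by (intro lim N1_triangle N1_nonneg calderonD(6)[OF F] calderonD(6)[OF G])
        (auto intro!: always_eventually diff_mem mF mG)
    show "((\<lambda>t. N0 (F (Complex 0 t) + G (Complex 0 t))) \<longlongrightarrow> 0) at_infinity"
      by (intro lim N0_triangle N0_nonneg calderonD(7)[OF F] calderonD(7)[OF G])
        (auto intro!: always_eventually mF mG)
    show "((\<lambda>t. N1 (F (Complex 1 t) + G (Complex 1 t))) \<longlongrightarrow> 0) at_infinity"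
      by (intro lim N1_triangle N1_nonneg calderonD(8)[OF F] calderonD(8)[OF G])
        (auto intro!: always_eventually mF mG)
  qed
qed

lemma I_triangle:
  assumes "x \<in> V" "y \<in> V"
  shows "I (x + y) \<le> I x + I y"
proof (rule field_le_epsilon)
  fix e :: real assume "0 < e"
  then have e: "0 < e / 2" by simp
  obtain F where F: "F \<in> \<F>" "F (1/2) = x" "\<And>t. N0 (F (Complex 0 t)) \<le> I x + e/2" "\<And>t. N1 (F (Complex 1 t)) \<le> I x + e/2"
    using I_approx[OF assms(1) e] by blast
  obtain G where G: "G \<in> \<F>" "G (1/2) = y" "\<And>t. N0 (G (Complex 0 t)) \<le> I y + e/2" "\<And>t. N1 (G (Complex 1 t)) \<le> I y + e/2"
    using I_approx[OF assms(2) e] by blast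
  show "I (x + y) \<le> I x + I y + e"
  proof (rule I_leI[OF calderon_add[OF F(1) G(1)]])
    fix t
    have m: "F (Complex 0 t) \<in> V" "G (Complex 0 t) \<in> V" "F (Complex 1 t) \<in> V" "G (Complex 1 t) \<in> V"
      using calderonD(1)[OF F(1)] calderonD(1)[OF G(1)] by simp_all
    show "N0 (F (Complex 0 t) + G (Complex 0 t)) \<le> I x + I y + e"
      using N0_triangle[OF m(1,2)] F(3)[of t] G(3)[of t] by linarith
    show "N1 (F (Complex 1 t) + G (Complex 1 t)) \<le> I x + I y + e"
      using N1_triangle[OF m(3,4)] F(4)[of t] G(4)[of t] by linarith
  qed (simp add: F G)
qed

text \<open>A linear functional that is bounded for both seminorms turns a Calderon function into a bounded
  scalar function on the strip, to which the maximum principle applies.\<close>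

lemma functional_le_I:
  fixes \<phi> :: "'v \<Rightarrow> complex"
  assumes add: "\<And>x y. \<phi> (x + y) = \<phi> x + \<phi> y" and scale: "\<And>c x. \<phi> (c *\<^sub>C x) = c * \<phi> x"
    and le0: "\<And>x. x \<in> V \<Longrightarrow> cmod (\<phi> x) \<le> K * N0 x" and le1: "\<And>x. x \<in> V \<Longrightarrow> cmod (\<phi> x) \<le> K * N1 x"
    and K: "0 < K" and x: "x \<in> V"
  shows "cmod (\<phi> x) \<le> K * I x"
proof -
  have diff: "\<phi> (x - y) = \<phi> x - \<phi> y" for x y
    using add[of "x - y" y] by simp
  have leS: "cmod (\<phi> y) \<le> K * S y" if "y \<in> V" for y
  proof -
    have "cmod (\<phi> y) / K \<le> S y"
    proof (rule S_greatest[OF that])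
      fix a b assume ab: "a \<in> V" "b \<in> V" "y = a + b"
      then have "cmod (\<phi> y) \<le> K * N0 a + K * N1 b"
        using norm_triangle_ineq[of "\<phi> a" "\<phi> b"] le0[of a] le1[of b] by (simp add: add)
      then show "cmod (\<phi> y) / K \<le> N0 a + N1 b" using K by (simp add: field_simps)
    qed
    then show ?thesis using K by (simp add: field_simps)
  qed
  have "cmod (\<phi> x) / K \<le> I x"
  proof (rule I_greatest[OF x])
    fix F B assume F: "F \<in> \<F>" "F (1/2) = x" "\<And>t. N0 (F (Complex 0 t)) \<le> B" "\<And>t. N1 (F (Complex 1 t)) \<le> B"
    note m = calderonD(1)[OF F(1)]
    obtain M where M: "\<And>z. 0 \<le> Re z \<Longrightarrow> Re z \<le> 1 \<Longrightarrow> S (F z) \<le> M" using calderonD(2)[OF F(1)] by blast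
    have "cmod ((\<lambda>z. \<phi> (F z)) (1/2)) \<le> K * B"
    proof (rule strip_maximum_principle)
      show "continuous_on closed_strip (\<lambda>z. \<phi> (F z))"
        unfolding continuous_on_def
      proof
        fix z assume z: "z \<in> closed_strip"
        show "((\<lambda>z. \<phi> (F z)) \<longlongrightarrow> \<phi> (F z)) (at z within closed_strip)"
        proof (rule LIM_zero_cancel, rule Lim_null_comparison)
          show "((\<lambda>w. K * S (F w - F z)) \<longlongrightarrow> 0) (at z within closed_strip)"
            using z by (intro tendsto_mult_right_zero calderonD(3)[OF F(1)]) auto
          show "\<forall>\<^sub>F w in at z within closed_strip. cmod (\<phi> (F w) - \<phi> (F z)) \<le> K * S (F w - F z)"
            unfolding diff[symmetric] using z
            by (auto simp: eventually_at_filter intro!: always_eventually leS diff_mem m)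
        qed
      qed
      show "(\<lambda>z. \<phi> (F z)) holomorphic_on open_strip"
        unfolding holomorphic_on_def field_differentiable_def
      proof
        fix z assume z: "z \<in> open_strip"
        obtain D where D: "D \<in> V" "((\<lambda>w. S (inverse (w - z) *\<^sub>C (F w - F z) - D)) \<longlongrightarrow> 0) (at z within open_strip)"
          using calderonD(4)[OF F(1)] z by blast
        have "((\<lambda>w. (\<phi> (F w) - \<phi> (F z)) / (w - z)) \<longlongrightarrow> \<phi> D) (at z within open_strip)"
        proof (rule LIM_zero_cancel, rule Lim_null_comparison)
          show "((\<lambda>w. K * S (inverse (w - z) *\<^sub>C (F w - F z) - D)) \<longlongrightarrow> 0) (at z within open_strip)"
            by (intro tendsto_mult_right_zero D)
          have eq: "(\<phi> (F w) - \<phi> (F z)) / (w - z) - \<phi> D = \<phi> (inverse (w - z) *\<^sub>C (F w - F z) - D)" for w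
            by (simp add: diff scale divide_inverse_commute)
          show "\<forall>\<^sub>F w in at z within open_strip.
              cmod ((\<phi> (F w) - \<phi> (F z)) / (w - z) - \<phi> D) \<le> K * S (inverse (w - z) *\<^sub>C (F w - F z) - D)"
            unfolding eq using z D(1)
            by (auto simp: eventually_at_filter intro!: always_eventually leS diff_mem scale_mem m)
        qed
        then show "\<exists>D. ((\<lambda>z. \<phi> (F z)) has_field_derivative D) (at z within open_strip)"
          by (auto simp: has_field_derivative_iff)
      qed
      show "cmod (\<phi> (F z)) \<le> K * M" if "0 \<le> Re z" "Re z \<le> 1" for z
        using leS[OF m[OF that]] M[OF that] K by (meson mult_left_mono less_imp_le order_trans)
      show "cmod (\<phi> (F (Complex 0 t))) \<le> K * B" for t
        using le0[OF m, of "Complex 0 t"] F(3)[of t] K by (simp add: order_trans[OF _ mult_left_mono])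
      show "cmod (\<phi> (F (Complex 1 t))) \<le> K * B" for t
        using le1[OF m, of "Complex 1 t"] F(4)[of t] K by (simp add: order_trans[OF _ mult_left_mono])
    qed
    then show "cmod (\<phi> x) / K \<le> B" using F(2) K by (simp add: field_simps)
  qed
  then show ?thesis using K by (simp add: field_simps)
qed

end

text \<open>Antilinear maps are admitted here because \<open>z \<mapsto> \<Phi> (F (cnj z))\<close> is again holomorphic.\<close>

lemma interp_norm_map:
  fixes \<Phi> :: "'v::complex_vector \<Rightarrow> 'w::complex_vector" and \<tau> :: "complex \<Rightarrow> complex"
  assumes A: "seminorm_pair V N0 N1" and B: "seminorm_pair W M0 M1"
    and \<tau>: "\<tau> = id \<or> \<tau> = cnj"
    and mem: "\<And>x. x \<in> V \<Longrightarrow> \<Phi> x \<in> W"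
    and add: "\<And>x y. \<Phi> (x + y) = \<Phi> x + \<Phi> y" and scale: "\<And>c x. \<Phi> (c *\<^sub>C x) = \<tau> c *\<^sub>C \<Phi> x"
    and le0: "\<And>x. x \<in> V \<Longrightarrow> M0 (\<Phi> x) \<le> K * N0 x" and le1: "\<And>x. x \<in> V \<Longrightarrow> M1 (\<Phi> x) \<le> K * N1 x"
    and K: "0 < K" and x: "x \<in> V"
  shows "interp_norm W M0 W M1 (1/2) (\<Phi> x) \<le> K * interp_norm V N0 V N1 (1/2) x"
proof -
  interpret A: seminorm_pair V N0 N1 by (rule A)
  interpret B: seminorm_pair W M0 M1 by (rule B)
  have diff: "\<Phi> (x - y) = \<Phi> x - \<Phi> y" for x y
    using add[of "x - y" y] by simp
  have Re: "Re (\<tau> z) = Re z" and inv: "\<tau> (\<tau> z) = z" and Cx: "\<tau> (1/2) = 1/2"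
    and op: "\<tau> (a - b) = \<tau> a - \<tau> b" "\<tau> (inverse a) = inverse (\<tau> a)" for z a b
    using \<tau> by auto
  have tl: "filterlim \<tau> (at (\<tau> z) within S) (at z within S)"
    if "S = closed_strip \<or> S = open_strip" for z S
  proof -
    have "(\<tau> \<longlongrightarrow> \<tau> z) (at z within S)" using \<tau> by (auto simp: id_def intro!: tendsto_intros)
    moreover have "\<forall>\<^sub>F w in at z within S. \<tau> w \<in> S \<and> \<tau> w \<noteq> \<tau> z"
      using that inv by (auto simp: eventually_at_filter Re intro!: always_eventually) metis+
    ultimately show ?thesis by (auto simp: filterlim_at)
  qed
  have edge: "\<exists>s. \<tau> (Complex a t) = Complex a s" for a t
    using \<tau> by (auto simp: complex_eq_iff)
  have leS: "B.S (\<Phi> y) \<le> K * A.S y" if "y \<in> V" for y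
  proof -
    have "B.S (\<Phi> y) / K \<le> A.S y"
    proof (rule A.S_greatest[OF that])
      fix a b assume ab: "a \<in> V" "b \<in> V" "y = a + b"
      then have "B.S (\<Phi> y) \<le> K * N0 a + K * N1 b"
        using B.S_le[OF mem mem, of a b] le0[of a] le1[of b] by (simp add: add)
      then show "B.S (\<Phi> y) / K \<le> N0 a + N1 b" using K by (simp add: field_simps)
    qed
    then show ?thesis using K by (simp add: field_simps)
  qed
  have "interp_norm W M0 W M1 (1/2) (\<Phi> x) / K \<le> A.I x"
  proof (rule A.I_greatest[OF x])
    fix F C assume F: "F \<in> A.\<F>" "F (1/2) = x" "\<And>t. N0 (F (Complex 0 t)) \<le> C" "\<And>t. N1 (F (Complex 1 t)) \<le> C"
    note m = A.calderonD(1)[OF F(1)]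
    obtain M where M: "\<And>z. 0 \<le> Re z \<Longrightarrow> Re z \<le> 1 \<Longrightarrow> A.S (F z) \<le> M" using A.calderonD(2)[OF F(1)] by blast
    have lim: "((\<lambda>w. P (\<Phi> (a w))) \<longlongrightarrow> 0) L"
      if "((\<lambda>w. Q (a w)) \<longlongrightarrow> 0) L" "\<And>y. y \<in> V \<Longrightarrow> P (\<Phi> y) \<le> K * Q y" "\<And>y. y \<in> W \<Longrightarrow> 0 \<le> P y" "\<forall>\<^sub>F w in L. a w \<in> V"
      for P Q a and L :: "'t filter"
    proof (rule tendsto_sandwich[OF _ _ tendsto_const tendsto_mult_right_zero[OF that(1), of K]])
      show "\<forall>\<^sub>F w in L. 0 \<le> P (\<Phi> (a w))" using that(4) by eventually_elim (auto intro: that(3) mem)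
      show "\<forall>\<^sub>F w in L. P (\<Phi> (a w)) \<le> K * Q (a w)" using that(4) by eventually_elim (rule that(2))
    qed
    have tri0: "\<bar>N0 (a - c) - N0 (b - c)\<bar> \<le> N0 (a - b)"
      and tri1: "\<bar>N1 (a - c) - N1 (b - c)\<bar> \<le> N1 (a - b)" if "a \<in> V" "b \<in> V" "c \<in> V" for a b c
      using A.abs_N0_diff_le[of "a - c" "b - c"] A.abs_N1_diff_le[of "a - c" "b - c"] that by (simp_all add: A.diff_mem)
    have rev: "((\<lambda>t. f (\<tau> (Complex a t)) :: real) \<longlongrightarrow> l) (at s)" if "\<And>s. ((\<lambda>t. f (Complex a t)) \<longlongrightarrow> l' s) (at s)" "l = l' (Im (\<tau> (Complex a s)))" for f a l l' s
    proof (cases "\<tau> = id")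
      case False
      then have c: "\<tau> (Complex a t) = Complex a (- t)" for t using \<tau> by (auto simp: complex_eq_iff)
      have "filterlim uminus (at (-s)) (at s)"
        by (auto simp: filterlim_at eventually_at_filter intro!: tendsto_intros always_eventually)
      from filterlim_compose[OF that(1) this] show ?thesis using that(2) by (simp add: c)
    qed (use that in auto)
    have revinf: "((\<lambda>t. f (\<tau> (Complex a t)) :: real) \<longlongrightarrow> l) at_infinity" if "((\<lambda>t. f (Complex a t)) \<longlongrightarrow> l) at_infinity" for f a l
    proof (cases "\<tau> = id")
      case False
      then have c: "\<tau> (Complex a t) = Complex a (- t)" for t using \<tau> by (auto simp: complex_eq_iff)
      have "filterlim uminus at_infinity (at_infinity :: real filter)"
        by (rule filterlim_norm_at_top_imp_at_infinity) (simp only: norm_minus_cancel filterlim_norm_at_top)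
      from filterlim_compose[OF that this] show ?thesis by (simp add: c)
    qed (use that in auto)
    have "interp_norm W M0 W M1 (1/2) (\<Phi> x) \<le> K * C"
    proof (rule B.I_leI)
      show "(\<lambda>z. \<Phi> (F (\<tau> z))) \<in> B.\<F>"
      proof (rule B.calderonI)
        show "\<Phi> (F (\<tau> z)) \<in> W" if "0 \<le> Re z" "Re z \<le> 1" for z using that by (intro mem m) (simp_all add: Re)
        show "B.S (\<Phi> (F (\<tau> z))) \<le> K * M" if "0 \<le> Re z" "Re z \<le> 1" for z
          using leS[OF m, of "\<tau> z"] M[of "\<tau> z"] K that by (simp add: Re order_trans[OF _ mult_left_mono])
        show "((\<lambda>w. B.S (\<Phi> (F (\<tau> w)) - \<Phi> (F (\<tau> z)))) \<longlongrightarrow> 0) (at z within closed_strip)"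
          if z: "0 \<le> Re z" "Re z \<le> 1" for z
          unfolding diff[symmetric]
        proof (rule lim[of A.S "\<lambda>w. F (\<tau> w) - F (\<tau> z)" "at z within closed_strip" B.S, OF _ leS B.S_nonneg])
          show "((\<lambda>w. A.S (F (\<tau> w) - F (\<tau> z))) \<longlongrightarrow> 0) (at z within closed_strip)"
            by (rule filterlim_compose[OF A.calderonD(3)[OF F(1)] tl]) (use z in \<open>simp_all add: Re\<close>)
          show "\<forall>\<^sub>F w in at z within closed_strip. F (\<tau> w) - F (\<tau> z) \<in> V"
            using z by (auto simp: eventually_at_filter Re intro!: always_eventually A.diff_mem m)
        qed
        show "\<exists>D\<in>W. ((\<lambda>w. B.S (inverse (w - z) *\<^sub>C (\<Phi> (F (\<tau> w)) - \<Phi> (F (\<tau> z))) - D)) \<longlongrightarrow> 0)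
            (at z within open_strip)" if z: "0 < Re z" "Re z < 1" for z
        proof -
          obtain D where D: "D \<in> V" "((\<lambda>w. A.S (inverse (w - \<tau> z) *\<^sub>C (F w - F (\<tau> z)) - D)) \<longlongrightarrow> 0)
              (at (\<tau> z) within open_strip)"
            using A.calderonD(4)[OF F(1), of "\<tau> z"] z by (auto simp: Re)
          have eq: "inverse (w - z) *\<^sub>C (\<Phi> (F (\<tau> w)) - \<Phi> (F (\<tau> z))) - \<Phi> D
              = \<Phi> (inverse (\<tau> w - \<tau> z) *\<^sub>C (F (\<tau> w) - F (\<tau> z)) - D)" for w
            by (simp add: diff scale op inv)
          have "((\<lambda>w. B.S (inverse (w - z) *\<^sub>C (\<Phi> (F (\<tau> w)) - \<Phi> (F (\<tau> z))) - \<Phi> D)) \<longlongrightarrow> 0)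
              (at z within open_strip)"
            unfolding eq
          proof (rule lim[of A.S "\<lambda>w. inverse (\<tau> w - \<tau> z) *\<^sub>C (F (\<tau> w) - F (\<tau> z)) - D" "at z within open_strip" B.S, OF _ leS B.S_nonneg])
            show "((\<lambda>w. A.S (inverse (\<tau> w - \<tau> z) *\<^sub>C (F (\<tau> w) - F (\<tau> z)) - D)) \<longlongrightarrow> 0)
                (at z within open_strip)"
              by (rule filterlim_compose[OF D(2) tl]) simp
            show "\<forall>\<^sub>F w in at z within open_strip. inverse (\<tau> w - \<tau> z) *\<^sub>C (F (\<tau> w) - F (\<tau> z)) - D \<in> V"
              using z D(1) by (auto simp: eventually_at_filter Re intro!: always_eventually A.diff_mem A.scale_mem m)
          qed
          then show ?thesis using mem[OF D(1)] by blast
        qed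
        show "((\<lambda>t. M0 (\<Phi> (F (\<tau> (Complex 0 t))) - \<Phi> (F (\<tau> (Complex 0 s))))) \<longlongrightarrow> 0) (at s)" for s
          unfolding diff[symmetric]
        proof (rule lim[of N0 "\<lambda>t. F (\<tau> (Complex 0 t)) - F (\<tau> (Complex 0 s))" "at s" M0, OF _ le0 B.N0_nonneg])
          obtain s' where s': "\<tau> (Complex 0 s) = Complex 0 s'" using edge by blast
          have "((\<lambda>t. N0 (F (Complex 0 t) - F (Complex 0 s'))) \<longlongrightarrow> N0 (F (Complex 0 u) - F (Complex 0 s'))) (at u)" for u
            by (rule LIM_zero_cancel, rule tendsto_rabs_zero_cancel,
                rule tendsto_sandwich[OF _ _ tendsto_const A.calderonD(5)[OF F(1)]])
              (auto intro!: always_eventually tri0 m)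
          from rev[of "\<lambda>z. N0 (F z - F (Complex 0 s'))" 0 "\<lambda>u. N0 (F (Complex 0 u) - F (Complex 0 s'))", OF this refl, of s]
          show "((\<lambda>t. N0 (F (\<tau> (Complex 0 t)) - F (\<tau> (Complex 0 s)))) \<longlongrightarrow> 0) (at s)"
            by (simp add: s' A.N0_zero)
        qed (auto simp: Re intro!: always_eventually A.diff_mem m)
        show "((\<lambda>t. M1 (\<Phi> (F (\<tau> (Complex 1 t))) - \<Phi> (F (\<tau> (Complex 1 s))))) \<longlongrightarrow> 0) (at s)" for s
          unfolding diff[symmetric]
        proof (rule lim[of N1 "\<lambda>t. F (\<tau> (Complex 1 t)) - F (\<tau> (Complex 1 s))" "at s" M1, OF _ le1 B.N1_nonneg])
          obtain s' where s': "\<tau> (Complex 1 s) = Complex 1 s'" using edge by blast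
          have "((\<lambda>t. N1 (F (Complex 1 t) - F (Complex 1 s'))) \<longlongrightarrow> N1 (F (Complex 1 u) - F (Complex 1 s'))) (at u)" for u
            by (rule LIM_zero_cancel, rule tendsto_rabs_zero_cancel,
                rule tendsto_sandwich[OF _ _ tendsto_const A.calderonD(6)[OF F(1)]])
              (auto intro!: always_eventually tri1 m)
          from rev[of "\<lambda>z. N1 (F z - F (Complex 1 s'))" 1 "\<lambda>u. N1 (F (Complex 1 u) - F (Complex 1 s'))", OF this refl, of s]
          show "((\<lambda>t. N1 (F (\<tau> (Complex 1 t)) - F (\<tau> (Complex 1 s)))) \<longlongrightarrow> 0) (at s)"
            by (simp add: s' A.N1_zero)
        qed (auto simp: Re intro!: always_eventually A.diff_mem m)
        show "((\<lambda>t. M0 (\<Phi> (F (\<tau> (Complex 0 t))))) \<longlongrightarrow> 0) at_infinity"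
          by (rule lim[of N0 "\<lambda>t. F (\<tau> (Complex 0 t))" at_infinity M0, OF revinf[of "\<lambda>z. N0 (F z)" 0 0, OF A.calderonD(7)[OF F(1)]] le0 B.N0_nonneg])
            (auto simp: Re intro!: always_eventually m)
        show "((\<lambda>t. M1 (\<Phi> (F (\<tau> (Complex 1 t))))) \<longlongrightarrow> 0) at_infinity"
          by (rule lim[of N1 "\<lambda>t. F (\<tau> (Complex 1 t))" at_infinity M1, OF revinf[of "\<lambda>z. N1 (F z)" 1 0, OF A.calderonD(8)[OF F(1)]] le1 B.N1_nonneg])
            (auto simp: Re intro!: always_eventually m)
      qed
      show "\<Phi> (F (\<tau> (1/2))) = \<Phi> x" by (simp add: Cx F)
      fix t
      show "M0 (\<Phi> (F (\<tau> (Complex 0 t)))) \<le> K * C"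
        using edge[of 0 t] le0[OF m, of "\<tau> (Complex 0 t)"] F(3) K
        by (metis (no_types) Re complex.sel(1) less_imp_le mult_left_mono order_refl order_trans zero_le_one)
      show "M1 (\<Phi> (F (\<tau> (Complex 1 t)))) \<le> K * C"
        using edge[of 1 t] le1[OF m, of "\<tau> (Complex 1 t)"] F(4) K
        by (metis (no_types) Re complex.sel(1) less_imp_le mult_left_mono order_refl order_trans zero_le_one)
    qed
    then show "interp_norm W M0 W M1 (1/2) (\<Phi> x) / K \<le> C" using K by (simp add: field_simps)
  qed
  then show ?thesis using K by (simp add: field_simps)
qed

section \<open>The matrix norms of OH\<close>

definition conj_ell2 :: "ell2 \<Rightarrow> ell2"
  where "conj_ell2 x = Abs_ell2 (\<lambda>k. cnj (coord x k))"

lemma coord_conj_ell2 [simp]: "coord (conj_ell2 x) k = cnj (coord x k)"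
  by (simp add: conj_ell2_def coord_Abs_ell2 summable_coord)

lemma norm_conj_ell2 [simp]: "norm (conj_ell2 x) = norm x"
  by (simp add: norm_ell2_def)

lemma conj_ell2_linear:
  "conj_ell2 (x + y) = conj_ell2 x + conj_ell2 y" "conj_ell2 (x - y) = conj_ell2 x - conj_ell2 y"
  "conj_ell2 (c *\<^sub>C x) = cnj c *\<^sub>C conj_ell2 x" "conj_ell2 (conj_ell2 x) = x"
  by (simp_all add: ell2_eqI)

lemma pairing_eq: "(\<Sum>k. coord x k * coord y k) = cinner x (conj_ell2 y)"
  by (simp add: cinner_ell2_def)

lemma row_embed_linear: "row_embed (x + y) = row_embed x + row_embed y" "row_embed (c *\<^sub>C x) = c *\<^sub>C row_embed x"
  by (rule blinfun_eqI, unfold row_embed_apply pairing_eq blinfun.add_left blinfun_apply_scaleC,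
      simp add: cinner_add_left scaleC_add_left cinner_scaleC_left scaleC_scaleC)+

lemma col_embed_linear: "col_embed (x + y) = col_embed x + col_embed y" "col_embed (c *\<^sub>C x) = c *\<^sub>C col_embed x"
  by (rule blinfun_eqI, unfold col_embed_apply blinfun.add_left blinfun_apply_scaleC,
      simp add: scaleC_add_right scaleC_scaleC mult.commute)+

lemma embed_zero: "row_embed 0 = 0" "col_embed 0 = 0"
  using row_embed_linear(2)[of 0 0] col_embed_linear(2)[of 0 0] by simp_all

lemma mnorm_row_opsp: "mnorm row_opsp n v = op_mnorm n (amp n row_embed v)"
  and mnorm_col_opsp: "mnorm col_opsp n v = op_mnorm n (amp n col_embed v)"
  by (simp_all add: row_opsp_def col_opsp_def)

lemma col_action:
  "(\<Sum>j<n. blinfun_apply (amp n col_embed v i j) (\<xi> j)) = (\<Sum>j<n. coord (\<xi> j) 0 *\<^sub>C v i j)" if "i < n"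
  using that by (intro sum.cong) (auto simp: amp_def col_embed_apply)

lemma row_action:
  "(\<Sum>j<n. blinfun_apply (amp n row_embed v i j) (\<xi> j)) = (\<Sum>j<n. cinner (v i j) (conj_ell2 (\<xi> j))) *\<^sub>C ket 0"
  if "i < n"
  using that unfolding complex_vector.scale_sum_left
  by (intro sum.cong) (auto simp: amp_def row_embed_apply pairing_eq)

text \<open>A column matrix acts on scalar multiples of the first basis vector, so its norm is determined by
  linear combinations of the columns with scalar coefficients.\<close>

lemma col_combination_le:
  "L2_set (\<lambda>i. norm (\<Sum>j<n. c j *\<^sub>C v i j)) {..<n} \<le> mnorm col_opsp n v * L2_set (\<lambda>j. cmod (c j)) {..<n}"
proof -
  have "L2_set (\<lambda>i. norm (\<Sum>j<n. c j *\<^sub>C v i j)) {..<n}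
      = L2_set (\<lambda>i. norm (\<Sum>j<n. blinfun_apply (amp n col_embed v i j) (c j *\<^sub>C ket 0))) {..<n}"
    by (intro L2_set_cong) (simp_all add: col_action)
  also have "\<dots> \<le> op_mnorm n (amp n col_embed v) * L2_set (\<lambda>j. norm (c j *\<^sub>C ket 0)) {..<n}"
    by (rule op_mnorm_apply)
  finally show ?thesis by (simp add: mnorm_col_opsp norm_scaleC)
qed

lemma mnorm_col_leI:
  assumes "0 \<le> K"
    and "\<And>c. L2_set (\<lambda>i. norm (\<Sum>j<n. c j *\<^sub>C v i j)) {..<n} \<le> K * L2_set (\<lambda>j. cmod (c j)) {..<n}"
  shows "mnorm col_opsp n v \<le> K"
  unfolding mnorm_col_opsp
proof (rule op_mnorm_leI[OF assms(1)])
  fix \<xi> :: "nat \<Rightarrow> ell2"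
  have "L2_set (\<lambda>i. norm (\<Sum>j<n. blinfun_apply (amp n col_embed v i j) (\<xi> j))) {..<n}
      = L2_set (\<lambda>i. norm (\<Sum>j<n. coord (\<xi> j) 0 *\<^sub>C v i j)) {..<n}"
    by (intro L2_set_cong) (simp_all add: col_action)
  also have "\<dots> \<le> K * L2_set (\<lambda>j. cmod (coord (\<xi> j) 0)) {..<n}" by (rule assms(2))
  also have "\<dots> \<le> K * L2_set (\<lambda>j. norm (\<xi> j)) {..<n}"
    using assms(1) by (intro mult_left_mono L2_set_mono norm_coord_le) auto
  finally show "L2_set (\<lambda>i. norm (\<Sum>j<n. blinfun_apply (amp n col_embed v i j) (\<xi> j))) {..<n}
      \<le> K * L2_set (\<lambda>j. norm (\<xi> j)) {..<n}" .
qed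

lemma L2_set_sq: "finite A \<Longrightarrow> (L2_set f A)\<^sup>2 = (\<Sum>i\<in>A. (f i)\<^sup>2)"
  by (simp add: L2_set_def sum_nonneg)

lemma square_le_imp_le: "(x::real)\<^sup>2 \<le> c * x \<Longrightarrow> 0 \<le> x \<Longrightarrow> 0 \<le> c \<Longrightarrow> x \<le> c"
  by (cases "x = 0") (auto simp: power2_eq_square)

text \<open>By duality the row norm has the same description as the column norm with rows and columns exchanged:
  the matrix is tested on the conjugates of the combinations themselves.\<close>

lemma row_combination_le:
  "L2_set (\<lambda>j. norm (\<Sum>i<n. c i *\<^sub>C v i j)) {..<n} \<le> mnorm row_opsp n v * L2_set (\<lambda>i. cmod (c i)) {..<n}"
proof -
  define w where "w j = (\<Sum>i<n. c i *\<^sub>C v i j)" for j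
  define a where "a i = (\<Sum>j<n. cinner (v i j) (w j))" for i
  let ?w = "L2_set (\<lambda>j. norm (w j)) {..<n}" and ?c = "L2_set (\<lambda>i. cmod (c i)) {..<n}"
  have "complex_of_real (?w\<^sup>2) = (\<Sum>j<n. cinner (w j) (w j))"
    by (simp add: L2_set_sq cinner_self)
  also have "\<dots> = (\<Sum>j<n. \<Sum>i<n. c i * cinner (v i j) (w j))"
    by (rule sum.cong[OF refl], subst (1) w_def) (simp add: cinner_sum_left cinner_scaleC_left)
  also have "\<dots> = (\<Sum>i<n. c i * a i)"
    unfolding a_def sum_distrib_left by (rule sum.swap)
  finally have "cmod (complex_of_real (?w\<^sup>2)) = cmod (\<Sum>i<n. c i * a i)" by (rule arg_cong)
  then have "?w\<^sup>2 = cmod (\<Sum>i<n. c i * a i)" by (simp only: norm_of_real abs_power2)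
  also have "\<dots> \<le> (\<Sum>i<n. \<bar>cmod (c i)\<bar> * \<bar>cmod (a i)\<bar>)"
    by (rule order_trans[OF norm_sum]) (simp add: norm_mult)
  also have "\<dots> \<le> ?c * L2_set (\<lambda>i. cmod (a i)) {..<n}" by (rule L2_set_mult_ineq)
  also have "\<dots> \<le> ?c * (mnorm row_opsp n v * ?w)"
  proof (rule mult_left_mono)
    have "L2_set (\<lambda>i. cmod (a i)) {..<n}
        = L2_set (\<lambda>i. norm (\<Sum>j<n. blinfun_apply (amp n row_embed v i j) (conj_ell2 (w j)))) {..<n}"
      by (intro L2_set_cong) (simp_all add: row_action conj_ell2_linear norm_scaleC a_def)
    also have "\<dots> \<le> mnorm row_opsp n v * L2_set (\<lambda>j. norm (conj_ell2 (w j))) {..<n}"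
      unfolding mnorm_row_opsp by (rule op_mnorm_apply)
    finally show "L2_set (\<lambda>i. cmod (a i)) {..<n} \<le> mnorm row_opsp n v * ?w" by simp
  qed (rule L2_set_nonneg)
  finally have "?w\<^sup>2 \<le> (mnorm row_opsp n v * ?c) * ?w" by (simp add: mult_ac)
  then have "?w \<le> mnorm row_opsp n v * ?c"
    by (rule square_le_imp_le) (simp_all add: L2_set_nonneg mnorm_row_opsp op_mnorm_nonneg)
  then show ?thesis by (simp add: w_def)
qed

lemma mnorm_row_leI:
  assumes "0 \<le> K"
    and "\<And>c. L2_set (\<lambda>j. norm (\<Sum>i<n. c i *\<^sub>C v i j)) {..<n} \<le> K * L2_set (\<lambda>i. cmod (c i)) {..<n}"
  shows "mnorm row_opsp n v \<le> K"
  unfolding mnorm_row_opsp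
proof (rule op_mnorm_leI[OF assms(1)])
  fix \<xi> :: "nat \<Rightarrow> ell2"
  define a where "a i = (\<Sum>j<n. cinner (v i j) (conj_ell2 (\<xi> j)))" for i
  define w where "w j = (\<Sum>i<n. cnj (a i) *\<^sub>C v i j)" for j
  let ?a = "L2_set (\<lambda>i. cmod (a i)) {..<n}" and ?x = "L2_set (\<lambda>j. norm (\<xi> j)) {..<n}"
  have "complex_of_real (?a\<^sup>2) = (\<Sum>i<n. cnj (a i) * a i)"
    by (simp add: L2_set_sq complex_norm_square mult.commute del: of_real_power)
  also have "\<dots> = (\<Sum>i<n. \<Sum>j<n. cnj (a i) * cinner (v i j) (conj_ell2 (\<xi> j)))"
    by (rule sum.cong[OF refl], subst (2) a_def) (simp add: sum_distrib_left)
  also have "\<dots> = (\<Sum>j<n. cinner (w j) (conj_ell2 (\<xi> j)))"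
    unfolding w_def cinner_sum_left cinner_scaleC_left by (rule sum.swap)
  finally have "cmod (complex_of_real (?a\<^sup>2)) = cmod (\<Sum>j<n. cinner (w j) (conj_ell2 (\<xi> j)))" by (rule arg_cong)
  then have "?a\<^sup>2 = cmod (\<Sum>j<n. cinner (w j) (conj_ell2 (\<xi> j)))" by (simp only: norm_of_real abs_power2)
  also have "\<dots> \<le> (\<Sum>j<n. \<bar>norm (w j)\<bar> * \<bar>norm (\<xi> j)\<bar>)"
    using cauchy_schwarz[of "w _" "conj_ell2 (\<xi> _)"] by (intro order_trans[OF norm_sum] sum_mono) simp
  also have "\<dots> \<le> L2_set (\<lambda>j. norm (w j)) {..<n} * ?x" by (rule L2_set_mult_ineq)
  also have "\<dots> \<le> (K * ?a) * ?x"
    using assms(2)[of "\<lambda>i. cnj (a i)"] by (intro mult_right_mono) (simp_all add: w_def L2_set_nonneg)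
  finally have "?a \<le> K * ?x"
    using assms(1) by (intro square_le_imp_le[of ?a "K * ?x"]) (simp_all add: L2_set_nonneg mult_ac)
  moreover have "L2_set (\<lambda>i. norm (\<Sum>j<n. blinfun_apply (amp n row_embed v i j) (\<xi> j))) {..<n} = ?a"
    by (intro L2_set_cong) (simp_all add: row_action a_def norm_scaleC)
  ultimately show "L2_set (\<lambda>i. norm (\<Sum>j<n. blinfun_apply (amp n row_embed v i j) (\<xi> j))) {..<n} \<le> K * ?x"
    by simp
qed

lemma amp_add: "(\<And>x y. f (x + y) = f x + f y) \<Longrightarrow> amp n f (v + w) = amp n f v + amp n f w"
  for f :: "'a::monoid_add \<Rightarrow> 'b::monoid_add"
  by (simp add: amp_def fun_eq_iff)

lemma amp_scaleC: "(\<And>c x. f (c *\<^sub>C x) = \<tau> c *\<^sub>C f x) \<Longrightarrow> amp n f (c *\<^sub>C v) = \<tau> c *\<^sub>C amp n f v"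
  for f :: "'a::complex_vector \<Rightarrow> 'b::complex_vector"
  by (simp add: amp_def fun_eq_iff scaleC_fun_def)

lemma amp_in_Mat: "amp n f v \<in> Mat n UNIV"
  by (simp add: amp_def Mat_def)

lemma Mat_zero: "v \<in> Mat n A \<Longrightarrow> \<not> (i < n \<and> j < n) \<Longrightarrow> v i j = 0"
  unfolding Mat_def by (metis (mono_tags, lifting) mem_Collect_eq)

lemma Mat_UNIV_mono: "v \<in> Mat n A \<Longrightarrow> n \<le> m \<Longrightarrow> v \<in> Mat m UNIV"
  using Mat_zero[of v n A] unfolding Mat_def by (auto simp: not_less)

lemma csubspace_Mat: "csubspace (Mat n (UNIV :: 'a::complex_vector set))"
  by (rule complex_vector.subspaceI) (auto simp: Mat_def scaleC_fun_def)

interpretation OH: seminorm_pair "Mat n UNIV" "mnorm row_opsp n" "mnorm col_opsp n" for n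
  by unfold_locales
    (simp_all add: csubspace_Mat mnorm_row_opsp mnorm_col_opsp op_mnorm_nonneg amp_add row_embed_linear col_embed_linear
      op_mnorm_triangle op_mnorm_scaleC amp_scaleC[where \<tau> = "\<lambda>c. c"])

lemma mnorm_OH: "mnorm OH n = interp_norm (Mat n UNIV) (mnorm row_opsp n) (Mat n UNIV) (mnorm col_opsp n) (1/2)"
  by (simp add: OH_def opsp_interp_def row_opsp_def col_opsp_def)

lemmas OH_triangle = OH.I_triangle[folded mnorm_OH] and OH_nonneg = OH.I_nonneg[folded mnorm_OH]

text \<open>The row and column norms are homogeneous under bounded linear and antilinear maps of the sequence
  space, and interpolation passes this on to OH.\<close>

lemma OH_homogeneous:
  assumes "\<tau> = id \<or> \<tau> = cnj"
    and add: "\<And>x y. T (x + y) = T x + T y" and scale: "\<And>c x. T (c *\<^sub>C x) = \<tau> c *\<^sub>C T x"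
    and le: "\<And>x. norm (T x) \<le> K * norm x" and K: "0 < K" and v: "v \<in> Mat n UNIV"
  shows "mnorm OH n (amp n T v) \<le> K * mnorm OH n v"
  unfolding mnorm_OH
proof (rule interp_norm_map[OF OH.seminorm_pair_axioms OH.seminorm_pair_axioms assms(1) _ _ _ _ _ K v])
  have inv: "\<tau> (\<tau> c) = c" and mod: "cmod (\<tau> c) = cmod c" for c using assms(1) by auto
  have T0: "T 0 = 0" using add[of 0 0] by simp
  have T_sum: "T (\<Sum>i\<in>A. f i) = (\<Sum>i\<in>A. T (f i))" for f :: "nat \<Rightarrow> ell2" and A
    by (induction A rule: infinite_finite_induct) (auto simp: T0 add)
  have comb: "norm (\<Sum>i<n. c i *\<^sub>C T (f i)) \<le> K * norm (\<Sum>i<n. \<tau> (c i) *\<^sub>C f i)" for c and f :: "nat \<Rightarrow> ell2"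
    using le[of "\<Sum>i<n. \<tau> (c i) *\<^sub>C f i"] by (simp add: T_sum scale inv)
  show "amp n T x \<in> Mat n UNIV" for x by (rule amp_in_Mat)
  show "amp n T (x + y) = amp n T x + amp n T y" for x y by (rule amp_add[OF add])
  show "amp n T (c *\<^sub>C x) = \<tau> c *\<^sub>C amp n T x" for c x by (rule amp_scaleC[OF scale])
  fix x :: "ell2 mtx"
  show "mnorm row_opsp n (amp n T x) \<le> K * mnorm row_opsp n x"
  proof (rule mnorm_row_leI)
    show "0 \<le> K * mnorm row_opsp n x" using K by (simp add: mnorm_row_opsp op_mnorm_nonneg)
    fix c
    have "L2_set (\<lambda>j. norm (\<Sum>i<n. c i *\<^sub>C amp n T x i j)) {..<n}
        \<le> L2_set (\<lambda>j. K * norm (\<Sum>i<n. \<tau> (c i) *\<^sub>C x i j)) {..<n}"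
      using comb by (intro L2_set_mono) (auto simp: amp_def)
    also have "\<dots> = K * L2_set (\<lambda>j. norm (\<Sum>i<n. \<tau> (c i) *\<^sub>C x i j)) {..<n}"
      using K by (simp add: L2_set_right_distrib)
    also have "\<dots> \<le> K * (mnorm row_opsp n x * L2_set (\<lambda>i. cmod (\<tau> (c i))) {..<n})"
      using K by (intro mult_left_mono row_combination_le) simp
    finally show "L2_set (\<lambda>j. norm (\<Sum>i<n. c i *\<^sub>C amp n T x i j)) {..<n}
        \<le> K * mnorm row_opsp n x * L2_set (\<lambda>i. cmod (c i)) {..<n}" by (simp add: mod mult.assoc)
  qed
  show "mnorm col_opsp n (amp n T x) \<le> K * mnorm col_opsp n x"
  proof (rule mnorm_col_leI)
    show "0 \<le> K * mnorm col_opsp n x" using K by (simp add: mnorm_col_opsp op_mnorm_nonneg)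
    fix c
    have "L2_set (\<lambda>i. norm (\<Sum>j<n. c j *\<^sub>C amp n T x i j)) {..<n}
        \<le> L2_set (\<lambda>i. K * norm (\<Sum>j<n. \<tau> (c j) *\<^sub>C x i j)) {..<n}"
      using comb by (intro L2_set_mono) (auto simp: amp_def)
    also have "\<dots> = K * L2_set (\<lambda>i. norm (\<Sum>j<n. \<tau> (c j) *\<^sub>C x i j)) {..<n}"
      using K by (simp add: L2_set_right_distrib)
    also have "\<dots> \<le> K * (mnorm col_opsp n x * L2_set (\<lambda>j. cmod (\<tau> (c j))) {..<n})"
      using K by (intro mult_left_mono col_combination_le) simp
    finally show "L2_set (\<lambda>i. norm (\<Sum>j<n. c j *\<^sub>C amp n T x i j)) {..<n}
        \<le> K * mnorm col_opsp n x * L2_set (\<lambda>j. cmod (c j)) {..<n}" by (simp add: mod mult.assoc)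
  qed
qed

lemma OH_scale_le:
  assumes "c \<noteq> 0" "v \<in> Mat n UNIV"
  shows "mnorm OH n (c *\<^sub>C v) \<le> cmod c * mnorm OH n v"
proof -
  have "amp n ((*\<^sub>C) c) v = c *\<^sub>C v"
    using Mat_zero[OF assms(2)] by (auto simp: amp_def fun_eq_iff scaleC_fun_def)
  moreover have "mnorm OH n (amp n ((*\<^sub>C) c) v) \<le> cmod c * mnorm OH n v"
    using assms by (intro OH_homogeneous[of id])
      (auto simp: scaleC_add_right scaleC_scaleC mult.commute norm_scaleC)
  ultimately show ?thesis by simp
qed

lemma OH_corner:
  assumes "n \<le> m" "v \<in> Mat n UNIV"
  shows "mnorm OH m v = mnorm OH n v"
proof (rule antisym)
  have T: "\<tau> = id \<or> \<tau> = cnj" if "\<tau> = id" for \<tau> :: "complex \<Rightarrow> complex" using that by simp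
  have corner: "op_mnorm m (amp m f x) = op_mnorm n (amp n f x)"
    if "x \<in> Mat n UNIV" "f 0 = 0" for x and f :: "ell2 \<Rightarrow> ell2 \<Rightarrow>\<^sub>L ell2"
  proof -
    have "amp m f x = amp n f x"
      using Mat_zero[OF that(1)] that(2) assms(1) by (auto simp: amp_def fun_eq_iff)
    then show ?thesis using op_mnorm_corner[OF assms(1) amp_in_Mat[of n f x]] by simp
  qed
  have "mnorm OH m (id v) \<le> 1 * mnorm OH n v"
    unfolding mnorm_OH
    by (rule interp_norm_map[OF OH.seminorm_pair_axioms OH.seminorm_pair_axioms T[OF refl]])
      (use assms in \<open>auto simp: mnorm_row_opsp mnorm_col_opsp corner embed_zero fun_eq_iff intro: Mat_UNIV_mono\<close>)
  then show "mnorm OH m v \<le> mnorm OH n v" by simp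
  define P where "P = amp n (\<lambda>a :: ell2. a)"
  have trunc: "op_mnorm n (amp n f (P x)) \<le> op_mnorm m (amp m f x)" for x and f :: "ell2 \<Rightarrow> ell2 \<Rightarrow>\<^sub>L ell2"
  proof -
    have "op_mnorm n (amp n f (P x)) = op_mnorm n (amp m f x)"
      using assms(1) unfolding op_mnorm_def amp_def P_def
      by (intro SUP_cong refl L2_set_cong arg_cong[where f = norm] sum.cong) auto
    then show ?thesis using op_mnorm_mono_size[OF assms(1), of "amp m f x"] by simp
  qed
  have "mnorm OH n (P v) \<le> 1 * mnorm OH m v"
    unfolding mnorm_OH
  proof (rule interp_norm_map[OF OH.seminorm_pair_axioms OH.seminorm_pair_axioms T[OF refl]])
    show "P (x + y) = P x + P y" for x y unfolding P_def by (rule amp_add) simp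
    show "P (c *\<^sub>C x) = id c *\<^sub>C P x" for c x unfolding P_def by (rule amp_scaleC) simp
    show "P x \<in> Mat n UNIV" for x unfolding P_def by (rule amp_in_Mat)
    show "v \<in> Mat m UNIV" using assms by (intro Mat_UNIV_mono)
  qed (simp_all add: mnorm_row_opsp mnorm_col_opsp trunc)
  moreover have "P v = v"
    using Mat_zero[OF assms(2)] by (auto simp: P_def amp_def fun_eq_iff)
  ultimately show "mnorm OH n v \<le> mnorm OH m v" by simp
qed

lemma OH_le_sum:
  assumes "v \<in> Mat n UNIV"
  shows "mnorm OH n v \<le> exp 1 * (\<Sum>i<n. \<Sum>j<n. norm (v i j))"
  unfolding mnorm_OH
proof (rule OH.I_le_max[OF assms])
  show "mnorm row_opsp n v \<le> (\<Sum>i<n. \<Sum>j<n. norm (v i j))"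
    using op_mnorm_le_sum[of n "amp n row_embed v"] by (simp add: mnorm_row_opsp amp_def norm_row_embed)
  show "mnorm col_opsp n v \<le> (\<Sum>i<n. \<Sum>j<n. norm (v i j))"
    using op_mnorm_le_sum[of n "amp n col_embed v"] by (simp add: mnorm_col_opsp amp_def norm_col_embed)
qed

text \<open>The sum is paired with its own value at \<open>v\<close>. The resulting functional is bounded for the row norm and
  for the column norm with the same constant.\<close>

lemma OH_bilinear_le:
  fixes a b :: "nat \<Rightarrow> complex"
  assumes v: "v \<in> Mat n UNIV" and pos: "0 < L2_set (\<lambda>i. cmod (a i)) {..<n}" "0 < L2_set (\<lambda>j. cmod (b j)) {..<n}"
  shows "norm (\<Sum>i<n. \<Sum>j<n. (a i * b j) *\<^sub>C v i j)
    \<le> L2_set (\<lambda>i. cmod (a i)) {..<n} * L2_set (\<lambda>j. cmod (b j)) {..<n} * mnorm OH n v"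
proof -
  let ?a = "L2_set (\<lambda>i. cmod (a i)) {..<n}" and ?b = "L2_set (\<lambda>j. cmod (b j)) {..<n}"
  define s where "s x = (\<Sum>i<n. \<Sum>j<n. (a i * b j) *\<^sub>C x i j)" for x :: "ell2 mtx"
  have s_row: "s x = (\<Sum>j<n. b j *\<^sub>C (\<Sum>i<n. a i *\<^sub>C x i j))" for x
    unfolding s_def complex_vector.scale_sum_right scaleC_scaleC by (subst sum.swap) (simp add: mult.commute)
  have s_col: "s x = (\<Sum>i<n. a i *\<^sub>C (\<Sum>j<n. b j *\<^sub>C x i j))" for x
    unfolding s_def complex_vector.scale_sum_right scaleC_scaleC by simp
  have row: "norm (s x) \<le> ?a * ?b * mnorm row_opsp n x" for x
  proof -
    have "norm (s x) \<le> ?b * L2_set (\<lambda>j. norm (\<Sum>i<n. a i *\<^sub>C x i j)) {..<n}"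
      unfolding s_row by (rule norm_sum_le_L2)
    also have "\<dots> \<le> ?b * (mnorm row_opsp n x * ?a)"
      by (intro mult_left_mono row_combination_le L2_set_nonneg)
    finally show ?thesis by (simp add: mult_ac)
  qed
  have col: "norm (s x) \<le> ?a * ?b * mnorm col_opsp n x" for x
  proof -
    have "norm (s x) \<le> ?a * L2_set (\<lambda>i. norm (\<Sum>j<n. b j *\<^sub>C x i j)) {..<n}"
      unfolding s_col by (rule norm_sum_le_L2)
    also have "\<dots> \<le> ?a * (mnorm col_opsp n x * ?b)"
      by (intro mult_left_mono col_combination_le L2_set_nonneg)
    finally show ?thesis by (simp add: mult_ac)
  qed
  show ?thesis
  proof (cases "s v = 0")
    case True
    then show ?thesis using OH_nonneg[OF v] pos by (simp add: s_def)
  next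
    case False
    have inner_le: "cmod (cinner (s x) (s v)) \<le> ?a * ?b * norm (s v) * r" if "norm (s x) \<le> ?a * ?b * r" for x r
      using order_trans[OF cauchy_schwarz mult_right_mono[OF that norm_ge_zero], of "s v"] by (simp add: mult_ac)
    have "cmod (cinner (s v) (s v)) \<le> (?a * ?b * norm (s v)) * mnorm OH n v"
      unfolding mnorm_OH
    proof (rule OH.functional_le_I[where \<phi> = "\<lambda>x. cinner (s x) (s v)"])
      show "cinner (s (x + y)) (s v) = cinner (s x) (s v) + cinner (s y) (s v)" for x y
        by (simp add: s_def scaleC_add_right sum.distrib cinner_add_left)
      show "cinner (s (c *\<^sub>C x)) (s v) = c * cinner (s x) (s v)" for c x
      proof -
        have "s (c *\<^sub>C x) = c *\<^sub>C s x"
          by (simp add: s_def scaleC_fun_def complex_vector.scale_sum_right scaleC_scaleC mult_ac)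
        then show ?thesis by (simp add: cinner_scaleC_left)
      qed
      show "0 < ?a * ?b * norm (s v)" using pos False by simp
    qed (use v row col inner_le in auto)
    then have "(norm (s v))\<^sup>2 \<le> (?a * ?b * mnorm OH n v) * norm (s v)"
      by (simp add: cinner_self norm_power mult_ac)
    then show ?thesis
      unfolding s_def[symmetric] by (rule square_le_imp_le) (use OH_nonneg[OF v] pos in auto)
  qed
qed

lemma norm_entry_le_OH:
  assumes "v \<in> Mat n UNIV" "i < n" "j < n"
  shows "norm (v i j) \<le> mnorm OH n v"
proof -
  define d where "d k = (\<lambda>l. if l = k then 1 else 0 :: complex)" for k :: nat
  have L: "L2_set (\<lambda>l. cmod (d k l)) {..<n} = 1" if "k < n" for k
    using L2_set_single[of "{..<n}" k 1] that by (simp add: d_def if_distrib[of cmod] cong: if_cong)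
  have "(\<Sum>l<n. (d i k * d j l) *\<^sub>C v k l) = d i k *\<^sub>C v k j" for k
    using assms(3) by (simp add: d_def if_distrib[of "\<lambda>x. (_ * x) *\<^sub>C _"] sum.delta scaleC_one cong: if_cong)
  moreover have "(\<Sum>k<n. d i k *\<^sub>C v k j) = v i j"
    using assms(2) by (simp add: d_def if_distrib[of "\<lambda>x. x *\<^sub>C _"] sum.delta scaleC_one cong: if_cong)
  ultimately show ?thesis
    using OH_bilinear_le[OF assms(1), of "d i" "d j"] L[OF assms(2)] L[OF assms(3)] by simp
qed

lemma norm_total_le_OH:
  assumes "v \<in> Mat n UNIV" "0 < M" "M \<le> n"
  shows "norm (\<Sum>i<M. \<Sum>j<M. v i j) \<le> real M * mnorm OH n v"
proof -
  define d where "d = (\<lambda>l. if l < M then 1 else 0 :: complex)"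
  have L: "L2_set (\<lambda>l. cmod (d l)) {..<n} = sqrt M"
  proof -
    have "L2_set (\<lambda>l. cmod (d l)) {..<n} = L2_set (\<lambda>l. cmod (d l)) {..<M}"
      using assms(3) by (intro L2_set_corner) (auto simp: d_def)
    also have "\<dots> = sqrt M" by (simp add: L2_set_def d_def)
    finally show ?thesis .
  qed
  have "(\<Sum>j<n. (d i * d j) *\<^sub>C v i j) = (if i < M then \<Sum>j<M. v i j else 0)" for i
    using assms(3) by (auto simp: d_def scaleC_one split: if_splits intro!: sum.mono_neutral_cong_right)
  then have "(\<Sum>i<n. \<Sum>j<n. (d i * d j) *\<^sub>C v i j) = (\<Sum>i<M. \<Sum>j<M. v i j)"
    using assms(3) by (auto split: if_splits intro!: sum.mono_neutral_cong_right)
  then show ?thesis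
    using OH_bilinear_le[OF assms(1), of d d] assms(2) by (simp add: L)
qed

section \<open>Gram matrices determine the matrix norms of OH\<close>

text \<open>The sequence space contains two orthogonal isometric copies of itself, on the even and on the odd
  coordinates. They serve as a direct sum that stays within one space.\<close>

definition inj_half :: "nat \<Rightarrow> ell2 \<Rightarrow> ell2"
  where "inj_half b x = Abs_ell2 (\<lambda>k. if k mod 2 = b then coord x (k div 2) else 0)"

definition proj_half :: "nat \<Rightarrow> ell2 \<Rightarrow> ell2"
  where "proj_half b x = Abs_ell2 (\<lambda>k. coord x (2 * k + b))"

lemma half_reindex: "strict_mono (\<lambda>k::nat. 2 * k + b)"
  by (auto simp: strict_mono_def)

lemma half_range: "b < 2 \<Longrightarrow> k \<notin> range (\<lambda>k. 2 * k + b) \<Longrightarrow> k mod 2 \<noteq> b" for k :: nat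
proof
  assume "k \<notin> range (\<lambda>k. 2 * k + b)" "k mod 2 = b"
  then have "k = 2 * (k div 2) + b" by presburger
  then show False using \<open>k \<notin> range (\<lambda>k. 2 * k + b)\<close> by (metis (no_types, lifting) rangeI)
qed

lemma half_arith: "b < 2 \<Longrightarrow> (2 * k + b) mod 2 = b" "b < 2 \<Longrightarrow> (2 * k + b) div 2 = k" for b k :: nat
  by presburger+

lemma coord_inj_half:
  assumes "b < 2"
  shows "coord (inj_half b x) k = (if k mod 2 = b then coord x (k div 2) else 0)"
proof -
  let ?f = "\<lambda>k. (cmod (if k mod 2 = b then coord x (k div 2) else 0))\<^sup>2"
  have "summable (\<lambda>k. ?f (2 * k + b))"
    using summable_coord[of x] by (simp only: half_arith[OF assms] simp_thms if_True)
  moreover have "?f k = 0" if "k \<notin> range (\<lambda>k. 2 * k + b)" for k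
    using half_range[OF assms that] by simp
  ultimately have "summable ?f"
    using summable_mono_reindex[OF half_reindex, of b ?f] by blast
  then show ?thesis
    unfolding inj_half_def
    by (rule coord_Abs_ell2[of "\<lambda>k. if k mod 2 = b then coord x (k div 2) else 0", THEN fun_cong])
qed

lemma coord_proj_half [simp]: "coord (proj_half b x) k = coord x (2 * k + b)"
  and norm_proj_half_le: "norm (proj_half b x) \<le> norm x"
proof -
  let ?g = "\<lambda>k. 2 * k + b" and ?f = "\<lambda>k. (cmod (coord x k))\<^sup>2"
  have inj: "inj ?g" by (auto simp: inj_def)
  have "summable (?f \<circ> ?g)"
    by (rule summable_reindex[OF summable_coord inj]) simp
  then have c: "coord (proj_half b x) k = coord x (2 * k + b)" for k
    unfolding proj_half_def o_def by (rule coord_Abs_ell2[of "\<lambda>k. coord x (2 * k + b)", THEN fun_cong])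
  then show "coord (proj_half b x) k = coord x (2 * k + b)" .
  have "suminf (?f \<circ> ?g) \<le> suminf ?f"
    by (rule suminf_reindex_mono[OF summable_coord inj]) simp
  then show "norm (proj_half b x) \<le> norm x"
    by (simp add: norm_ell2_def c o_def)
qed

lemma proj_inj_half: "b < 2 \<Longrightarrow> proj_half b (inj_half b x) = x"
  by (rule ell2_eqI) (simp only: coord_proj_half coord_inj_half half_arith simp_thms if_True)

lemma proj_inj_half_other: "b < 2 \<Longrightarrow> c < 2 \<Longrightarrow> b \<noteq> c \<Longrightarrow> proj_half b (inj_half c x) = 0"
  by (rule ell2_eqI) (simp only: coord_proj_half coord_inj_half half_arith if_False coord_zero)

lemma inj_half_linear:
  assumes "b < 2"
  shows "inj_half b (x + y) = inj_half b x + inj_half b y" "inj_half b (x - y) = inj_half b x - inj_half b y"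
    "inj_half b (c *\<^sub>C x) = c *\<^sub>C inj_half b x" "inj_half b (- x) = - inj_half b x"
  by (rule ell2_eqI; simp add: coord_inj_half[OF assms])+

lemma proj_half_linear:
  "proj_half b (x + y) = proj_half b x + proj_half b y" "proj_half b (c *\<^sub>C x) = c *\<^sub>C proj_half b x"
  by (rule ell2_eqI; simp)+

lemma cinner_inj_half:
  assumes "b < 2"
  shows "cinner (inj_half b x) (inj_half b y) = cinner x y"
    and "c < 2 \<Longrightarrow> b \<noteq> c \<Longrightarrow> cinner (inj_half b x) (inj_half c y) = 0"
proof -
  let ?f = "\<lambda>k. coord (inj_half b x) k * cnj (coord (inj_half b y) k)"
  have "(\<Sum>k. ?f (2 * k + b)) = suminf ?f"
  proof (rule suminf_mono_reindex[OF half_reindex])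
    fix k assume "k \<notin> range (\<lambda>k. 2 * k + b)"
    then have "k mod 2 \<noteq> b" by (rule half_range[OF assms])
    then show "?f k = 0" by (simp only: coord_inj_half[OF assms] if_False mult_zero_left)
  qed
  then show "cinner (inj_half b x) (inj_half b y) = cinner x y"
    by (simp only: cinner_ell2_def coord_inj_half[OF assms] half_arith[OF assms] simp_thms if_True)
  show "cinner (inj_half b x) (inj_half c y) = 0" if "c < 2" "b \<noteq> c"
  proof -
    have "coord (inj_half b x) k * cnj (coord (inj_half c y) k) = 0" for k
      using that by (cases "k mod 2 = b") (simp_all only: coord_inj_half[OF assms] coord_inj_half[OF that(1)]
          if_False if_True simp_thms mult_zero_left mult_zero_right complex_cnj_zero)
    then show ?thesis unfolding cinner_ell2_def by (simp only: suminf_zero)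
  qed
qed

lemma norm_inj_half: "b < 2 \<Longrightarrow> norm (inj_half b x) = norm x"
  by (simp add: norm_eq_sqrt_cinner cinner_inj_half)

lemma cinner_ket_right: "cinner x (ket k) = coord x k"
  by (simp add: cinner_ell2_def if_distrib[of cnj] if_distrib[of "\<lambda>x. _ * x"] cong: if_cong)
    (subst suminf_finite[of "{k}"]; simp)

lemma cinner_ket: "cinner (ket k) (ket l) = (if k = l then 1 else 0)"
  by (simp add: cinner_ket_right)

locale inner_form =
  fixes V :: "'v::complex_vector set" and H :: "'v \<Rightarrow> 'v \<Rightarrow> complex"
  assumes subspace: "csubspace V"
    and add_left: "x \<in> V \<Longrightarrow> y \<in> V \<Longrightarrow> z \<in> V \<Longrightarrow> H (x + y) z = H x z + H y z"
    and scale_left: "x \<in> V \<Longrightarrow> y \<in> V \<Longrightarrow> H (c *\<^sub>C x) y = c * H x y"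
    and commute: "x \<in> V \<Longrightarrow> y \<in> V \<Longrightarrow> H x y = cnj (H y x)"
    and nonneg: "x \<in> V \<Longrightarrow> 0 \<le> Re (H x x)"
    and definite: "x \<in> V \<Longrightarrow> Re (H x x) = 0 \<Longrightarrow> x = 0"
begin

lemma zero_mem: "0 \<in> V" and add_mem: "x \<in> V \<Longrightarrow> y \<in> V \<Longrightarrow> x + y \<in> V"
  and diff_mem: "x \<in> V \<Longrightarrow> y \<in> V \<Longrightarrow> x - y \<in> V" and scale_mem: "x \<in> V \<Longrightarrow> c *\<^sub>C x \<in> V"
  using subspace complex_vector.subspace_diff[OF subspace] by (auto simp: complex_vector.subspace_def)

lemma sum_mem: "(\<And>i. i \<in> A \<Longrightarrow> f i \<in> V) \<Longrightarrow> (\<Sum>i\<in>A. f i) \<in> V"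
  by (rule complex_vector.subspace_sum[OF subspace])

lemma zero_left: "y \<in> V \<Longrightarrow> H 0 y = 0"
  using scale_left[of 0 y 0] zero_mem by simp

lemma zero_right: "y \<in> V \<Longrightarrow> H y 0 = 0"
  using commute[of y 0] zero_mem zero_left by simp

lemma add_right: "x \<in> V \<Longrightarrow> y \<in> V \<Longrightarrow> z \<in> V \<Longrightarrow> H z (x + y) = H z x + H z y"
  using commute[of z "x + y"] commute[of z x] commute[of z y] add_left[of x y z] add_mem by simp

lemma scale_right: "x \<in> V \<Longrightarrow> y \<in> V \<Longrightarrow> H y (c *\<^sub>C x) = cnj c * H y x"
  using commute[of y "c *\<^sub>C x"] commute[of y x] scale_left[of x y c] scale_mem by simp

lemma diff_left: "x \<in> V \<Longrightarrow> y \<in> V \<Longrightarrow> z \<in> V \<Longrightarrow> H (x - y) z = H x z - H y z"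
  using add_left[of "x - y" y z] diff_mem by simp

lemma sum_left: "finite A \<Longrightarrow> (\<And>i. i \<in> A \<Longrightarrow> f i \<in> V) \<Longrightarrow> y \<in> V \<Longrightarrow> H (\<Sum>i\<in>A. f i) y = (\<Sum>i\<in>A. H (f i) y)"
  by (induction A rule: finite_induct) (auto simp: zero_left add_left sum_mem)

lemma sum_right: "finite A \<Longrightarrow> (\<And>i. i \<in> A \<Longrightarrow> f i \<in> V) \<Longrightarrow> y \<in> V \<Longrightarrow> H y (\<Sum>i\<in>A. f i) = (\<Sum>i\<in>A. H y (f i))"
  by (induction A rule: finite_induct) (auto simp: zero_right add_right sum_mem)

lemma self_real: "x \<in> V \<Longrightarrow> H x x = of_real (Re (H x x))"
  using commute[of x x] by (simp add: complex_eq_iff)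

lemma orthogonal_span: "y \<in> cspan W \<Longrightarrow> (\<And>w. w \<in> W \<Longrightarrow> w \<in> V \<and> H x w = 0) \<Longrightarrow> x \<in> V \<Longrightarrow> y \<in> V \<and> H x y = 0"
proof (induction y rule: complex_vector.span_induct_alt)
  case base
  then show ?case by (simp add: zero_mem zero_right)
next
  case (step c w y)
  then have "w \<in> V" "H x w = 0" "y \<in> V" "H x y = 0" by auto
  then show ?case using step.prems(2) by (simp add: add_mem scale_mem add_right scale_right)
qed

lemma pythagoras:
  assumes "x \<in> V" "y \<in> V" "H x y = 0"
  shows "Re (H (x + y) (x + y)) = Re (H x x) + Re (H y y)"
  using assms commute[of y x] by (simp add: add_left add_right add_mem)

text \<open>Zero entries are admitted, so that the orthonormalisation of a linearly dependent sequence
  keeps its indexing.\<close>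

definition onseq :: "(nat \<Rightarrow> 'v) \<Rightarrow> bool"
  where "onseq e \<longleftrightarrow> (\<forall>i. e i \<in> V) \<and> (\<forall>i j. i \<noteq> j \<longrightarrow> H (e i) (e j) = 0) \<and> (\<forall>i. e i = 0 \<or> H (e i) (e i) = 1)"

definition proj :: "(nat \<Rightarrow> 'v) \<Rightarrow> nat \<Rightarrow> 'v \<Rightarrow> 'v"
  where "proj e N u = (\<Sum>k<N. H u (e k) *\<^sub>C e k)"

text \<open>A vector in the span of its predecessors has residual zero, and the default value
  \<open>inverse 0 = 0\<close> turns it into a zero entry.\<close>

fun gram_schmidt :: "(nat \<Rightarrow> 'v) \<Rightarrow> nat \<Rightarrow> 'v" where
  "gram_schmidt w n =
    (let u = w n - (\<Sum>k<n. H (w n) (gram_schmidt w k) *\<^sub>C gram_schmidt w k)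
     in of_real (inverse (sqrt (Re (H u u)))) *\<^sub>C u)"

declare gram_schmidt.simps [simp del]

lemma proj_mem: "(\<And>k. k < N \<Longrightarrow> e k \<in> V) \<Longrightarrow> proj e N u \<in> V"
  unfolding proj_def by (intro sum_mem scale_mem) auto

lemma proj_span: "proj e N u \<in> cspan (e ` {..<N})"
  unfolding proj_def by (intro complex_vector.span_sum complex_vector.span_scale complex_vector.span_base) auto

lemma residual_orthogonal:
  assumes e: "\<And>i. i < N \<Longrightarrow> e i \<in> V" "\<And>i j. i < N \<Longrightarrow> j < N \<Longrightarrow> i \<noteq> j \<Longrightarrow> H (e i) (e j) = 0"
      "\<And>i. i < N \<Longrightarrow> e i = 0 \<or> H (e i) (e i) = 1"
    and u: "u \<in> V" and k: "k < N"
  shows "H (u - proj e N u) (e k) = 0"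
proof (cases "e k = 0")
  case True
  then show ?thesis using proj_mem[of N e u] e(1) u by (simp add: zero_right diff_mem)
next
  case False
  have "H (proj e N u) (e k) = (\<Sum>i<N. H u (e i) * H (e i) (e k))"
    unfolding proj_def using e(1) k
    by (subst sum_left) (auto intro!: sum.cong scale_mem simp: scale_left)
  also have "\<dots> = (\<Sum>i<N. if i = k then H u (e k) else 0)"
  proof (rule sum.cong[OF refl])
    fix i assume "i \<in> {..<N}"
    then show "H u (e i) * H (e i) (e k) = (if i = k then H u (e k) else 0)"
      using e(2)[of i k] e(3)[of k] k False by (cases "i = k") simp_all
  qed
  also have "\<dots> = H u (e k)" using k by simp
  finally have "H (proj e N u) (e k) = H u (e k)" .
  then show ?thesis using proj_mem[of N e u, OF e(1)] e(1)[OF k] u by (simp only: diff_left) simp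
qed

lemma gram_schmidt_onseq:
  assumes w: "\<And>n. w n \<in> V"
  shows "onseq (gram_schmidt w)"
    and "w n \<in> cspan (gram_schmidt w ` {..n})"
    and "gram_schmidt w n \<in> cspan (w ` {..n})"
proof -
  let ?e = "gram_schmidt w"
  define u where "u n = w n - proj ?e n (w n)" for n
  define r :: "nat \<Rightarrow> complex" where "r n = of_real (inverse (sqrt (Re (H (u n) (u n)))))" for n
  have e: "?e n = r n *\<^sub>C u n" for n
    by (subst gram_schmidt.simps) (simp add: Let_def u_def proj_def r_def)
  have main: "?e n \<in> V \<and> u n \<in> V \<and> (\<forall>k<n. H (?e n) (?e k) = 0) \<and> (?e n = 0 \<or> H (?e n) (?e n) = 1)" for n
  proof (induction n rule: less_induct)
    case (less n)
    have eV: "?e k \<in> V" if "k < n" for k using less that by blast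
    have un: "u n \<in> V" unfolding u_def by (intro diff_mem w proj_mem eV)
    have below: "H (?e j) (?e i) = 0" if "i < j" "j < n" for i j using less that by blast
    have unit: "?e k = 0 \<or> H (?e k) (?e k) = 1" if "k < n" for k using less that by blast
    have orth: "H (?e i) (?e j) = 0" if "i < n" "j < n" "i \<noteq> j" for i j
    proof (cases "j < i")
      case False
      then have "H (?e j) (?e i) = 0" using below that by simp
      then show ?thesis using commute[OF eV eV, of i j] that by simp
    qed (use below that in blast)
    have "H (u n) (?e k) = 0" if "k < n" for k
      unfolding u_def by (rule residual_orthogonal[OF eV orth unit w that])
    moreover have "?e n = 0 \<or> H (?e n) (?e n) = 1"
    proof (cases "u n = 0")
      case False
      then have pos: "0 < Re (H (u n) (u n))"
        using nonneg[OF un] definite[OF un] by linarith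
      have "H (?e n) (?e n) = (r n * cnj (r n)) * of_real (Re (H (u n) (u n)))"
        unfolding e using un self_real[OF un] by (simp add: scale_left scale_right scale_mem)
      also have "\<dots> = of_real (inverse (sqrt (Re (H (u n) (u n)))) * inverse (sqrt (Re (H (u n) (u n)))) * Re (H (u n) (u n)))"
        by (simp add: r_def)
      also have "inverse (sqrt (Re (H (u n) (u n)))) * inverse (sqrt (Re (H (u n) (u n)))) * Re (H (u n) (u n)) = 1"
        using pos by (simp flip: inverse_mult_distrib)
      finally show ?thesis by simp
    qed (simp add: e)
    ultimately show ?case
      using un eV by (auto simp: e[of n] scale_mem scale_left)
  qed
  show "onseq ?e"
    unfolding onseq_def
  proof (intro conjI allI impI)
    fix i j :: nat assume "i \<noteq> j"
    then consider "i < j" | "j < i" by linarith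
    then show "H (?e i) (?e j) = 0"
    proof cases
      case 1
      then have "H (?e j) (?e i) = 0" using main by blast
      then show ?thesis using commute[of "?e i" "?e j"] main by simp
    qed (use main in blast)
  next
    show "?e i \<in> V" and "?e i = 0 \<or> H (?e i) (?e i) = 1" for i using main by blast+
  qed
  show "w n \<in> cspan (?e ` {..n})"
  proof -
    have p: "proj ?e n (w n) \<in> cspan (?e ` {..n})"
      using proj_span[of ?e n "w n"] complex_vector.span_mono[of "?e ` {..<n}" "?e ` {..n}"] by fastforce
    have "u n \<in> cspan (?e ` {..n})"
    proof (cases "r n = 0")
      case True
      then have "Re (H (u n) (u n)) = 0" by (simp add: r_def)
      then have "u n = 0" using definite main by blast
      then show ?thesis by (simp add: complex_vector.span_zero)
    next
      case False
      then have "u n = inverse (r n) *\<^sub>C ?e n" by (simp add: e scaleC_scaleC scaleC_one)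
      then show ?thesis by (simp add: complex_vector.span_scale complex_vector.span_base)
    qed
    from complex_vector.span_add[OF this p] show ?thesis by (simp add: u_def)
  qed
  show "?e n \<in> cspan (w ` {..n})"
  proof (induction n rule: less_induct)
    case (less n)
    have "?e k \<in> cspan (w ` {..n})" if "k < n" for k
      using less[OF that] complex_vector.span_mono[of "w ` {..k}" "w ` {..n}"] that by fastforce
    then have "proj ?e n (w n) \<in> cspan (w ` {..n})"
      unfolding proj_def by (intro complex_vector.span_sum complex_vector.span_scale) auto
    moreover have "w n \<in> cspan (w ` {..n})" by (intro complex_vector.span_base) auto
    ultimately have "u n \<in> cspan (w ` {..n})" unfolding u_def by (rule complex_vector.span_diff[rotated])
    then show ?case unfolding e[of n] by (rule complex_vector.span_scale)
  qed
qed

lemma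
  assumes e: "onseq e" and u: "u \<in> V"
  shows bessel_eq: "Re (H u u) = Re (H (u - proj e N u) (u - proj e N u)) + (\<Sum>k<N. (cmod (H u (e k)))\<^sup>2)"
    and best_approximation: "y \<in> cspan (e ` {..<N}) \<Longrightarrow>
      Re (H (u - proj e N u) (u - proj e N u)) \<le> Re (H (u - y) (u - y))"
    and proj_sq: "Re (H (proj e N u) (proj e N u)) = (\<Sum>k<N. (cmod (H u (e k)))\<^sup>2)"
proof -
  let ?p = "proj e N u"
  have eV: "e k \<in> V" for k using e by (simp add: onseq_def)
  have p: "?p \<in> V" using eV by (rule proj_mem)
  have orth: "y \<in> V \<and> H (u - ?p) y = 0" if "y \<in> cspan (e ` {..<N})" for y
  proof (rule orthogonal_span[OF that])
    fix w assume "w \<in> e ` {..<N}"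
    then obtain k where k: "k < N" "w = e k" by auto
    have "H (u - ?p) (e k) = 0"
      by (rule residual_orthogonal) (use e u k in \<open>auto simp: onseq_def\<close>)
    then show "w \<in> V \<and> H (u - ?p) w = 0" using k eV by simp
  qed (intro diff_mem u p)
  have py: "Re (H (u - y) (u - y)) = Re (H (u - ?p) (u - ?p)) + Re (H (?p - y) (?p - y))"
    if "y \<in> cspan (e ` {..<N})" for y
  proof -
    have "?p - y \<in> cspan (e ` {..<N})" using that proj_span by (rule complex_vector.span_diff[rotated])
    then show ?thesis
      using pythagoras[of "u - ?p" "?p - y"] orth[of "?p - y"] u p by (simp add: diff_mem)
  qed
  have coeff: "H ?p (e k) = H u (e k)" if "k < N" for k
  proof -
    have "H (u - ?p) (e k) = 0" using orth[of "e k"] that by (simp add: complex_vector.span_base)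
    then show ?thesis using u p eV by (simp add: diff_left)
  qed
  have "H ?p ?p = (\<Sum>k<N. cnj (H u (e k)) * H ?p (e k))"
    using p eV by (subst (2) proj_def) (simp add: sum_right scale_mem scale_right)
  also have "\<dots> = (\<Sum>k<N. of_real ((cmod (H u (e k)))\<^sup>2))"
    by (intro sum.cong refl) (simp only: coeff lessThan_iff complex_norm_square mult.commute)
  finally show sq: "Re (H ?p ?p) = (\<Sum>k<N. (cmod (H u (e k)))\<^sup>2)" by simp
  show "Re (H u u) = Re (H (u - ?p) (u - ?p)) + (\<Sum>k<N. (cmod (H u (e k)))\<^sup>2)"
    using py[of 0] sq by (simp add: complex_vector.span_zero)
  show "Re (H (u - ?p) (u - ?p)) \<le> Re (H (u - y) (u - y))" if "y \<in> cspan (e ` {..<N})"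
    using py[OF that] nonneg[of "?p - y"] orth[OF that] p by (simp add: diff_mem)
qed

lemma proj_self:
  assumes e: "onseq e" and y: "y \<in> cspan (e ` {..<N})"
  shows "proj e N y = y"
proof -
  have eV: "e k \<in> V" for k using e by (simp add: onseq_def)
  then have "cspan (e ` {..<N}) \<subseteq> V" by (intro complex_vector.span_minimal subspace) auto
  then have yV: "y \<in> V" using y by blast
  have d: "y - proj e N y \<in> V" using yV proj_mem[of N e y] eV by (intro diff_mem) auto
  have "Re (H (y - proj e N y) (y - proj e N y)) \<le> 0"
    using best_approximation[OF e yV y] by (simp add: zero_left zero_mem)
  then have "y - proj e N y = 0" using nonneg[OF d] definite[OF d] by linarith
  then show ?thesis by simp
qed

end

interpretation ell2: inner_form "UNIV :: 'a::chilbert_space set" cinner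
proof
  show "csubspace (UNIV :: 'a set)" by (rule complex_vector.subspace_UNIV)
  fix x y z :: 'a and c
  show "cinner (x + y) z = cinner x z + cinner y z" by (rule cinner_add_left)
  show "cinner (c *\<^sub>C x) y = c * cinner x y" by (rule cinner_scaleC_left)
  show "cinner x y = cnj (cinner y x)" by (rule cinner_commute)
  show "0 \<le> Re (cinner x x)" by (simp add: cinner_self)
  show "x = 0" if "Re (cinner x x) = 0" using that by (simp add: cinner_self)
qed

lemma span_image_coefficients:
  fixes w :: "nat \<Rightarrow> 'a::complex_vector"
  assumes "u \<in> cspan (w ` {..<N})"
  obtains a where "u = (\<Sum>l<N. a l *\<^sub>C w l)"
proof -
  have "u \<in> range (\<lambda>a. \<Sum>l<N. a l *\<^sub>C w l)"
  proof (rule complex_vector.span_induct_alt[OF assms])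
    show "0 \<in> range (\<lambda>a. \<Sum>l<N. a l *\<^sub>C w l)" by (rule range_eqI[of _ _ "\<lambda>_. 0"]) simp
    fix c x y assume "x \<in> w ` {..<N}" "y \<in> range (\<lambda>a. \<Sum>l<N. a l *\<^sub>C w l)"
    then obtain k a where k: "k < N" "x = w k" "y = (\<Sum>l<N. a l *\<^sub>C w l)" by auto
    have "(\<Sum>l<N. (if l = k then c else 0) *\<^sub>C w l) = c *\<^sub>C w k"
      using k by (simp add: if_distrib[of "\<lambda>x. x *\<^sub>C _"] cong: if_cong)
    then show "c *\<^sub>C x + y \<in> range (\<lambda>a. \<Sum>l<N. a l *\<^sub>C w l)"
      using k by (intro range_eqI[of _ _ "\<lambda>l. (if l = k then c else 0) + a l"]) (simp add: scaleC_add_left sum.distrib)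
  qed
  then show ?thesis by (rule rangeE) (rule that)
qed

text \<open>The map is prescribed on the span of the vectors \<open>w l\<close> by the domination hypothesis and
  extended by the orthogonal projection onto that span.\<close>

lemma dominated_extension:
  fixes v w :: "nat \<Rightarrow> ell2"
  assumes dom: "\<And>c. norm (\<Sum>l<N. c l *\<^sub>C v l) \<le> K * norm (\<Sum>l<N. c l *\<^sub>C w l)" and K: "0 \<le> K"
  obtains T where "\<And>x y. T (x + y) = T x + T y" "\<And>c x. T (c *\<^sub>C x) = c *\<^sub>C T x"
    "\<And>x. norm (T x) \<le> K * norm x" "\<And>l. l < N \<Longrightarrow> T (w l) = v l"
proof -
  define e where "e = ell2.gram_schmidt w"
  note gs = ell2.gram_schmidt_onseq[of w, OF UNIV_I, folded e_def]
  have "\<exists>a. e k = (\<Sum>l<N. a l *\<^sub>C w l)" if "k < N" for k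
  proof -
    have "cspan (w ` {..k}) \<subseteq> cspan (w ` {..<N})" using that by (intro complex_vector.span_mono) auto
    then have "e k \<in> cspan (w ` {..<N})" using gs(3)[of k] by blast
    then show ?thesis by (rule span_image_coefficients) (rule exI)
  qed
  then obtain a where a: "\<And>k. k < N \<Longrightarrow> e k = (\<Sum>l<N. a k l *\<^sub>C w l)" by metis
  define t where "t k = (\<Sum>l<N. a k l *\<^sub>C v l)" for k
  define T where "T u = (\<Sum>k<N. cinner u (e k) *\<^sub>C t k)" for u
  have collect: "(\<Sum>k<N. c k *\<^sub>C (\<Sum>l<N. a k l *\<^sub>C f l)) = (\<Sum>l<N. (\<Sum>k<N. c k * a k l) *\<^sub>C f l)"
    for c and f :: "nat \<Rightarrow> ell2"
    unfolding complex_vector.scale_sum_right complex_vector.scale_sum_left scaleC_scaleC by (rule sum.swap)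
  have T_eq: "T u = (\<Sum>l<N. (\<Sum>k<N. cinner u (e k) * a k l) *\<^sub>C v l)" for u
    unfolding T_def t_def by (rule collect)
  have proj_eq: "ell2.proj e N u = (\<Sum>l<N. (\<Sum>k<N. cinner u (e k) * a k l) *\<^sub>C w l)" for u
    unfolding ell2.proj_def by (subst collect[symmetric]) (simp add: a)
  show ?thesis
  proof (rule that)
    show "T (x + y) = T x + T y" for x y
      by (simp add: T_def cinner_add_left scaleC_add_left sum.distrib)
    show "T (c *\<^sub>C x) = c *\<^sub>C T x" for c x
      by (simp add: T_def cinner_scaleC_left complex_vector.scale_sum_right scaleC_scaleC)
    show "norm (T u) \<le> K * norm u" for u
    proof -
      have "(norm (ell2.proj e N u))\<^sup>2 \<le> (norm u)\<^sup>2"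
        using ell2.bessel_eq[OF gs(1) UNIV_I, of u N] ell2.proj_sq[OF gs(1) UNIV_I, of N u]
          ell2.nonneg[OF UNIV_I, of "u - ell2.proj e N u"] by (simp add: norm_sq_cinner)
      then have "norm (ell2.proj e N u) \<le> norm u" by simp
      then show ?thesis
        using dom[of "\<lambda>l. \<Sum>k<N. cinner u (e k) * a k l"] mult_left_mono[OF _ K]
        unfolding T_eq proj_eq by (meson order_trans)
    qed
    show "T (w l) = v l" if l: "l < N" for l
    proof -
      let ?c = "\<lambda>i. (\<Sum>k<N. cinner (w l) (e k) * a k i) - (if i = l then 1 else 0)"
      have "cspan (e ` {..l}) \<subseteq> cspan (e ` {..<N})" using l by (intro complex_vector.span_mono) auto
      then have "ell2.proj e N (w l) = w l" using gs(2)[of l] by (intro ell2.proj_self gs(1)) auto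
      moreover have comb: "(\<Sum>i<N. ?c i *\<^sub>C f i) = (\<Sum>i<N. (\<Sum>k<N. cinner (w l) (e k) * a k i) *\<^sub>C f i) - f l"
        for f :: "nat \<Rightarrow> ell2"
        using l by (simp add: complex_vector.scale_left_diff_distrib sum_subtractf
            if_distrib[of "\<lambda>x. x *\<^sub>C _"] scaleC_one cong: if_cong)
      ultimately have "norm (\<Sum>i<N. ?c i *\<^sub>C v i) \<le> K * 0"
        using dom[of ?c] unfolding comb proj_eq by simp
      then show ?thesis unfolding comb T_eq by simp
    qed
  qed
qed

lemma inj_half_combination:
  "b < 2 \<Longrightarrow> inj_half b (\<Sum>l\<in>A. c l *\<^sub>C f l) = (\<Sum>l\<in>A. c l *\<^sub>C inj_half b (f l))"
  using inj_half_linear(3)[of b 0 0]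
  by (induction A rule: infinite_finite_induct) (auto simp: inj_half_linear)

lemma norm_combination_sq:
  fixes v :: "nat \<Rightarrow> 'a::chilbert_space"
  shows "complex_of_real ((norm (\<Sum>l<N. c l *\<^sub>C v l))\<^sup>2) = (\<Sum>l<N. \<Sum>m<N. c l * cnj (c m) * cinner (v l) (v m))"
proof -
  have "cinner (\<Sum>l<N. c l *\<^sub>C v l) (\<Sum>m<N. c m *\<^sub>C v m) = (\<Sum>l<N. c l * (\<Sum>m<N. cnj (c m) * cinner (v l) (v m)))"
    unfolding cinner_sum_left cinner_scaleC_left by (simp only: cinner_sum_right cinner_scaleC_right)
  then show ?thesis by (simp only: cinner_self sum_distrib_left mult.assoc)
qed

lemma norm_combination_ket: "(norm (\<Sum>l<N. c l *\<^sub>C ket l))\<^sup>2 = (\<Sum>l<N. (cmod (c l))\<^sup>2)"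
proof -
  have "complex_of_real ((norm (\<Sum>l<N. c l *\<^sub>C ket l))\<^sup>2) = (\<Sum>l<N. \<Sum>m<N. if l = m then c l * cnj (c m) else 0)"
    unfolding norm_combination_sq by (intro sum.cong refl) (simp add: cinner_ket)
  also have "\<dots> = (\<Sum>l<N. c l * cnj (c l))" by simp
  also have "\<dots> = complex_of_real (\<Sum>l<N. (cmod (c l))\<^sup>2)" by (simp only: of_real_sum complex_norm_square)
  finally show ?thesis by (simp only: of_real_eq_iff)
qed

lemma gram_perturbation:
  fixes v w :: "nat \<Rightarrow> 'a::chilbert_space"
  assumes "\<And>l m. l < N \<Longrightarrow> m < N \<Longrightarrow> cmod (cinner (v l) (v m) - cinner (w l) (w m)) \<le> \<delta>" "0 \<le> \<delta>"
  shows "(norm (\<Sum>l<N. c l *\<^sub>C v l))\<^sup>2 \<le> (norm (\<Sum>l<N. c l *\<^sub>C w l))\<^sup>2 + \<delta> * N * (\<Sum>l<N. (cmod (c l))\<^sup>2)"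
proof -
  let ?d = "(norm (\<Sum>l<N. c l *\<^sub>C v l))\<^sup>2 - (norm (\<Sum>l<N. c l *\<^sub>C w l))\<^sup>2"
  have "complex_of_real ?d
      = (\<Sum>l<N. \<Sum>m<N. c l * cnj (c m) * (cinner (v l) (v m) - cinner (w l) (w m)))"
    unfolding of_real_diff norm_combination_sq right_diff_distrib sum_subtractf ..
  then have "cmod (complex_of_real ?d)
      = cmod (\<Sum>l<N. \<Sum>m<N. c l * cnj (c m) * (cinner (v l) (v m) - cinner (w l) (w m)))" by (rule arg_cong)
  then have "\<bar>?d\<bar> = cmod (\<Sum>l<N. \<Sum>m<N. c l * cnj (c m) * (cinner (v l) (v m) - cinner (w l) (w m)))"
    by (simp only: norm_of_real)
  also have "\<dots> \<le> (\<Sum>l<N. \<Sum>m<N. cmod (c l) * cmod (c m) * \<delta>)"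
    using assms
    by (intro order_trans[OF norm_sum] sum_mono) (auto simp: norm_mult intro!: mult_left_mono)
  also have "\<dots> = \<delta> * (\<Sum>l<N. cmod (c l))\<^sup>2"
    by (simp add: power2_eq_square sum_product sum_distrib_left sum_distrib_right mult_ac)
  also have "\<dots> \<le> \<delta> * (N * (\<Sum>l<N. (cmod (c l))\<^sup>2))"
    using sum_squared_le_sum_of_squares[of "\<lambda>l. cmod (c l)" "{..<N}"] assms(2)
    by (intro mult_left_mono) (auto simp: mult.commute)
  finally show ?thesis by (simp add: mult.assoc)
qed

text \<open>Both families are made linearly independent by adding small orthogonal vectors. Closeness of the
  Gram matrices then turns into domination with a constant near one, so a bounded linear map carries
  the second family to the first.\<close>

lemma OH_gram_le:
  assumes v: "v \<in> Mat n UNIV" and w: "w \<in> Mat n UNIV" and \<epsilon>: "0 < \<epsilon>" and \<delta>: "0 \<le> \<delta>"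
    and gram: "\<And>i j k l. i < n \<Longrightarrow> j < n \<Longrightarrow> k < n \<Longrightarrow> l < n \<Longrightarrow>
      cmod (cinner (v i j) (v k l) - cinner (w i j) (w k l)) \<le> \<delta>"
  shows "mnorm OH n v \<le> sqrt (1 + \<delta> * real (n * n) / \<epsilon>) * (mnorm OH n w + exp 1 * (real (n * n) * sqrt \<epsilon>))"
proof -
  define N where "N = n * n"
  define K where "K = sqrt (1 + \<delta> * real N / \<epsilon>)"
  have K1: "1 \<le> K" using \<epsilon> \<delta> by (simp add: K_def)
  define idx where "idx f l = f (l div n) (l mod n)" for f :: "ell2 mtx" and l
  have idx: "idx f (i * n + j) = f i j" "i * n + j < N" if "i < n" "j < n" for f i j
  proof -
    have "i * n + j < i * n + n" using that by simp
    also have "\<dots> = Suc i * n" by simp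
    also have "\<dots> \<le> n * n" using that by (intro mult_le_mono1) simp
    finally show "i * n + j < N" by (simp add: N_def)
    show "idx f (i * n + j) = f i j" using that by (simp add: idx_def)
  qed
  have dm: "l div n < n" "l mod n < n" if "l < N" for l
    using that by (auto simp: N_def less_mult_imp_div_less intro!: mod_less_divisor) (metis gr0I mult_0 not_less0)
  define reg where "reg f l = inj_half 0 (f l) + inj_half 1 (of_real (sqrt \<epsilon>) *\<^sub>C ket l)"
    for f :: "nat \<Rightarrow> ell2" and l
  have reg_comb: "(norm (\<Sum>l<N. c l *\<^sub>C reg f l))\<^sup>2
      = (norm (\<Sum>l<N. c l *\<^sub>C f l))\<^sup>2 + \<epsilon> * (\<Sum>l<N. (cmod (c l))\<^sup>2)" for c f
  proof -
    have "(\<Sum>l<N. c l *\<^sub>C reg f l)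
        = inj_half 0 (\<Sum>l<N. c l *\<^sub>C f l) + of_real (sqrt \<epsilon>) *\<^sub>C inj_half 1 (\<Sum>l<N. c l *\<^sub>C ket l)"
      by (simp add: reg_def inj_half_linear inj_half_combination scaleC_add_right sum.distrib
          complex_vector.scale_sum_right scaleC_scaleC mult.commute)
    then have "(norm (\<Sum>l<N. c l *\<^sub>C reg f l))\<^sup>2
        = (norm (\<Sum>l<N. c l *\<^sub>C f l))\<^sup>2 + (sqrt \<epsilon> * norm (\<Sum>l<N. c l *\<^sub>C ket l))\<^sup>2"
      using \<epsilon> by (simp add: norm_add_sq norm_inj_half norm_scaleC cinner_scaleC_right cinner_inj_half(2))
    then show ?thesis using \<epsilon> by (simp only: power_mult_distrib norm_combination_ket) simp
  qed
  have dom: "norm (\<Sum>l<N. c l *\<^sub>C reg (idx v) l) \<le> K * norm (\<Sum>l<N. c l *\<^sub>C reg (idx w) l)" for c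
  proof (rule power2_le_imp_le)
    let ?s = "\<Sum>l<N. (cmod (c l))\<^sup>2" and ?w = "(norm (\<Sum>l<N. c l *\<^sub>C idx w l))\<^sup>2"
    have "(norm (\<Sum>l<N. c l *\<^sub>C reg (idx v) l))\<^sup>2 \<le> ?w + \<delta> * N * ?s + \<epsilon> * ?s"
      unfolding reg_comb using gram_perturbation[where N = N and v = "idx v" and w = "idx w" and \<delta> = \<delta> and c = c] gram dm \<delta> by (auto simp: idx_def)
    also have "\<dots> \<le> (1 + \<delta> * N / \<epsilon>) * (?w + \<epsilon> * ?s)"
    proof -
      have "(1 + \<delta> * N / \<epsilon>) * (?w + \<epsilon> * ?s) = ?w + \<delta> * N * ?s + \<epsilon> * ?s + \<delta> * N / \<epsilon> * ?w"
        using \<epsilon> by (simp add: field_simps)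
      moreover have "0 \<le> \<delta> * N / \<epsilon> * ?w" using \<epsilon> \<delta> by simp
      ultimately show ?thesis by linarith
    qed
    also have "\<dots> = (K * norm (\<Sum>l<N. c l *\<^sub>C reg (idx w) l))\<^sup>2"
      unfolding power_mult_distrib reg_comb using \<epsilon> \<delta> by (simp add: K_def)
    finally show "(norm (\<Sum>l<N. c l *\<^sub>C reg (idx v) l))\<^sup>2 \<le> (K * norm (\<Sum>l<N. c l *\<^sub>C reg (idx w) l))\<^sup>2" .
  qed (use K1 in simp)
  have K0: "0 \<le> K" using K1 by simp
  obtain T where T: "\<And>x y. T (x + y) = T x + T y" "\<And>c x. T (c *\<^sub>C x) = c *\<^sub>C T x"
      "\<And>x. norm (T x) \<le> K * norm x" "\<And>l. l < N \<Longrightarrow> T (reg (idx w) l) = reg (idx v) l"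
    using dominated_extension[where N = N and v = "reg (idx v)" and w = "reg (idx w)", OF dom K0] by metis
  \<comment> \<open>The perturbation that regularises \<open>w\<close>, arranged as a matrix.\<close>
  define E where "E = (\<lambda>i j. if i < n \<and> j < n then inj_half 1 (of_real (sqrt \<epsilon>) *\<^sub>C ket (i * n + j)) else 0)"
  let ?w' = "amp n (inj_half 0) w + E"
  have E: "E \<in> Mat n UNIV" by (simp add: E_def Mat_def)
  have w': "?w' \<in> Mat n UNIV" using E amp_in_Mat by (rule OH.add_mem[rotated])
  have "v = amp n (\<lambda>x. proj_half 0 (T x)) ?w'"
  proof (intro ext)
    fix i j
    show "v i j = amp n (\<lambda>x. proj_half 0 (T x)) ?w' i j"
    proof (cases "i < n \<and> j < n")
      case True
      then have "?w' i j = reg (idx w) (i * n + j)" by (simp add: amp_def E_def reg_def idx)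
      moreover have "T (reg (idx w) (i * n + j)) = reg (idx v) (i * n + j)" using True idx by (intro T) auto
      ultimately show ?thesis
        using True by (simp add: amp_def reg_def proj_half_linear proj_inj_half proj_inj_half_other idx)
    qed (use Mat_zero[OF v] in \<open>auto simp: amp_def\<close>)
  qed
  then have "mnorm OH n v = mnorm OH n (amp n (\<lambda>x. proj_half 0 (T x)) ?w')" by simp
  also have "\<dots> \<le> K * mnorm OH n ?w'"
  proof (rule OH_homogeneous[of id])
    show "norm (proj_half 0 (T x)) \<le> K * norm x" for x
      using norm_proj_half_le T(3) by (rule order_trans)
  qed (use K1 w' in \<open>simp_all add: T proj_half_linear\<close>)
  also have "\<dots> \<le> K * (mnorm OH n (amp n (inj_half 0) w) + mnorm OH n E)"
    using K1 by (intro mult_left_mono OH_triangle amp_in_Mat E) auto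
  also have "\<dots> \<le> K * (mnorm OH n w + exp 1 * (real N * sqrt \<epsilon>))"
  proof (intro mult_left_mono add_mono)
    have "mnorm OH n (amp n (inj_half 0) w) \<le> 1 * mnorm OH n w"
      by (rule OH_homogeneous[of id]) (use w in \<open>simp_all add: inj_half_linear norm_inj_half\<close>)
    then show "mnorm OH n (amp n (inj_half 0) w) \<le> mnorm OH n w" by simp
    have "(\<Sum>i<n. \<Sum>j<n. norm (E i j)) = (\<Sum>i<n. \<Sum>j<n. sqrt \<epsilon>)"
      using \<epsilon> by (intro sum.cong refl) (auto simp: E_def norm_inj_half norm_scaleC)
    then show "mnorm OH n E \<le> exp 1 * (real N * sqrt \<epsilon>)"
      using OH_le_sum[OF E] by (simp add: N_def)
  qed (use K1 in simp)
  finally show ?thesis by (simp add: K_def N_def)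
qed

text \<open>Gram matrices within \<open>\<epsilon>\<^sup>2\<close> of each other give norms that agree up to a factor and a summand
  which tend to one and to zero with \<open>\<epsilon>\<close>.\<close>

lemma OH_gram_tendsto:
  assumes v: "\<And>m. v m \<in> Mat n UNIV" and w: "w \<in> Mat n UNIV" and F: "F \<noteq> bot"
    and gram: "\<And>i j k l. i < n \<Longrightarrow> j < n \<Longrightarrow> k < n \<Longrightarrow> l < n \<Longrightarrow>
      ((\<lambda>m. cinner (v m i j) (v m k l)) \<longlongrightarrow> cinner (w i j) (w k l)) F"
  shows "(\<forall>\<^sub>F m in F. mnorm OH n (v m) \<le> C) \<Longrightarrow> mnorm OH n w \<le> C"
    and "(\<forall>\<^sub>F m in F. C \<le> mnorm OH n (v m)) \<Longrightarrow> C \<le> mnorm OH n w"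
proof -
  have close: "\<forall>\<^sub>F m in F. \<forall>i<n. \<forall>j<n. \<forall>k<n. \<forall>l<n.
      cmod (cinner (v m i j) (v m k l) - cinner (w i j) (w k l)) \<le> \<delta>" if "0 < \<delta>" for \<delta>
  proof -
    have "\<forall>\<^sub>F m in F. \<forall>i\<in>{..<n}. \<forall>j\<in>{..<n}. \<forall>k\<in>{..<n}. \<forall>l\<in>{..<n}.
        cmod (cinner (v m i j) (v m k l) - cinner (w i j) (w k l)) \<le> \<delta>"
    proof (intro eventually_ball_finite finite_lessThan ballI)
      fix i j k l assume "i \<in> {..<n}" "j \<in> {..<n}" "k \<in> {..<n}" "l \<in> {..<n}"
      then have "\<forall>\<^sub>F m in F. dist (cinner (v m i j) (v m k l)) (cinner (w i j) (w k l)) < \<delta>"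
        using tendstoD[OF gram that] by auto
      then show "\<forall>\<^sub>F m in F. cmod (cinner (v m i j) (v m k l) - cinner (w i j) (w k l)) \<le> \<delta>"
        by eventually_elim (simp add: dist_norm)
    qed
    then show ?thesis by (simp add: Ball_def)
  qed
  define r where "r \<epsilon> = sqrt (1 + \<epsilon> * real (n * n))" for \<epsilon> :: real
  define s where "s \<epsilon> = exp 1 * (real (n * n) * sqrt \<epsilon>)" for \<epsilon> :: real
  have lim: "((\<lambda>\<epsilon>. r \<epsilon> * (C + s \<epsilon>)) \<longlongrightarrow> C) (at_right 0)" for C
  proof -
    have "((\<lambda>\<epsilon>. r \<epsilon> * (C + s \<epsilon>)) \<longlongrightarrow> r 0 * (C + s 0)) (at_right 0)"
      unfolding r_def s_def by (intro tendsto_intros)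
    then show ?thesis by (simp add: r_def s_def)
  qed
  have r0: "0 \<le> r \<epsilon>" if "0 < \<epsilon>" for \<epsilon> using that by (simp add: r_def)
  have both: "\<forall>\<^sub>F m in F. mnorm OH n (v m) \<le> r \<epsilon> * (mnorm OH n w + s \<epsilon>) \<and>
      mnorm OH n w \<le> r \<epsilon> * (mnorm OH n (v m) + s \<epsilon>)" if "0 < \<epsilon>" for \<epsilon>
  proof -
    have "0 < \<epsilon> * \<epsilon>" using that by simp
    from close[OF this] show ?thesis
    proof eventually_elim
      case (elim m)
      have "cmod (cinner (w i j) (w k l) - cinner (v m i j) (v m k l)) \<le> \<epsilon> * \<epsilon>"
        if "i < n" "j < n" "k < n" "l < n" for i j k l
        using elim that norm_minus_commute by metis
      then show ?case
        using OH_gram_le[OF v[of m] w that, of "\<epsilon> * \<epsilon>"] OH_gram_le[OF w v[of m] that, of "\<epsilon> * \<epsilon>"] elim that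
        by (simp add: r_def s_def)
    qed
  qed
  show "mnorm OH n w \<le> C" if C: "\<forall>\<^sub>F m in F. mnorm OH n (v m) \<le> C"
  proof (rule tendsto_lowerbound[OF lim])
    have "mnorm OH n w \<le> r \<epsilon> * (C + s \<epsilon>)" if \<epsilon>: "0 < \<epsilon>" for \<epsilon>
    proof -
      obtain m where "mnorm OH n (v m) \<le> C" "mnorm OH n w \<le> r \<epsilon> * (mnorm OH n (v m) + s \<epsilon>)"
        using eventually_happens'[OF F eventually_conj[OF C both[OF \<epsilon>]]] by blast
      then show ?thesis using mult_left_mono[OF _ r0[OF \<epsilon>], of "mnorm OH n (v m) + s \<epsilon>" "C + s \<epsilon>"] by linarith
    qed
    then show "\<forall>\<^sub>F \<epsilon> in at_right 0. mnorm OH n w \<le> r \<epsilon> * (C + s \<epsilon>)"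
      by (auto intro: eventually_mono[OF eventually_at_right_less])
  qed simp
  show "C \<le> mnorm OH n w" if C: "\<forall>\<^sub>F m in F. C \<le> mnorm OH n (v m)"
  proof (rule tendsto_lowerbound[OF lim])
    have "C \<le> r \<epsilon> * (mnorm OH n w + s \<epsilon>)" if \<epsilon>: "0 < \<epsilon>" for \<epsilon>
    proof -
      obtain m where "C \<le> mnorm OH n (v m)" "mnorm OH n (v m) \<le> r \<epsilon> * (mnorm OH n w + s \<epsilon>)"
        using eventually_happens'[OF F eventually_conj[OF C both[OF \<epsilon>]]] by blast
      then show ?thesis by linarith
    qed
    then show "\<forall>\<^sub>F \<epsilon> in at_right 0. C \<le> r \<epsilon> * (mnorm OH n w + s \<epsilon>)"
      by (auto intro: eventually_mono[OF eventually_at_right_less])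
  qed simp
qed

section \<open>Sign matrices of small norm\<close>

fun hadamard :: "nat \<Rightarrow> nat \<Rightarrow> nat \<Rightarrow> real" where
  "hadamard 0 i j = 1"
| "hadamard (Suc k) i j = (if 2 ^ k \<le> i \<and> 2 ^ k \<le> j then - 1 else 1) * hadamard k (i mod 2 ^ k) (j mod 2 ^ k)"

lemma hadamard_sign: "hadamard k i j = 1 \<or> hadamard k i j = - 1"
  by (induction k i j rule: hadamard.induct) auto

lemma sum_lessThan_double: "(\<Sum>i<2 * n. f i) = (\<Sum>i<n. f i) + (\<Sum>i<n. f (n + i))" for n :: nat
proof -
  have "(\<Sum>i<n + m. f i) = (\<Sum>i<n. f i) + (\<Sum>i<m. f (n + i))" for m
    by (induction m) (simp_all add: add.assoc)
  from this[of n] show ?thesis by (simp add: mult_2)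
qed

lemma hadamard_blocks:
  assumes "i < 2 ^ k" "j < 2 ^ k"
  shows "hadamard (Suc k) i j = hadamard k i j" "hadamard (Suc k) i (2 ^ k + j) = hadamard k i j"
    "hadamard (Suc k) (2 ^ k + i) j = hadamard k i j" "hadamard (Suc k) (2 ^ k + i) (2 ^ k + j) = - hadamard k i j"
  using assms by auto

text \<open>Among \<open>4 ^ k\<close> signs the positive ones outnumber the negative ones by \<open>2 ^ k\<close> only, so in a sum over all
  entries the odd part of a function of the sign is negligible against its even part.\<close>

lemma hadamard_sum: "(\<Sum>i<2 ^ k. \<Sum>j<2 ^ k. hadamard k i j) = 2 ^ k"
proof (induction k)
  case (Suc k)
  have "(\<Sum>i<2 ^ Suc k. \<Sum>j<2 ^ Suc k. hadamard (Suc k) i j)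
      = (\<Sum>i<2 ^ k. \<Sum>j<2 ^ k. hadamard k i j) + (\<Sum>i<2 ^ k. \<Sum>j<2 ^ k. hadamard k i j)"
    unfolding power_Suc sum_lessThan_double sum.distrib[symmetric]
    by (intro sum.cong refl) (simp add: hadamard_blocks sum_negf del: hadamard.simps)
  then show ?case by (simp add: Suc.IH del: hadamard.simps)
qed simp

text \<open>The parallelogram law, applied to the two halves of the rows, doubles the constant at each step.\<close>

lemma hadamard_action:
  fixes \<xi> :: "nat \<Rightarrow> 'a::chilbert_space"
  shows "(\<Sum>i<2 ^ k. (norm (\<Sum>j<2 ^ k. hadamard k i j *\<^sub>R \<xi> j))\<^sup>2) = 2 ^ k * (\<Sum>j<2 ^ k. (norm (\<xi> j))\<^sup>2)"
proof (induction k arbitrary: \<xi>)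
  case (Suc k)
  let ?a = "\<lambda>i. \<Sum>j<2 ^ k. hadamard k i j *\<^sub>R \<xi> j"
  let ?b = "\<lambda>i. \<Sum>j<2 ^ k. hadamard k i j *\<^sub>R \<xi> (2 ^ k + j)"
  have "(\<Sum>j<2 ^ Suc k. hadamard (Suc k) i j *\<^sub>R \<xi> j) = ?a i + ?b i"
    "(\<Sum>j<2 ^ Suc k. hadamard (Suc k) (2 ^ k + i) j *\<^sub>R \<xi> j) = ?a i - ?b i" if "i < 2 ^ k" for i
    unfolding power_Suc sum_lessThan_double using that
    by (simp_all add: hadamard_blocks sum_negf del: hadamard.simps)
  then have "(\<Sum>i<2 ^ Suc k. (norm (\<Sum>j<2 ^ Suc k. hadamard (Suc k) i j *\<^sub>R \<xi> j))\<^sup>2)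
      = (\<Sum>i<2 ^ k. (norm (?a i + ?b i))\<^sup>2 + (norm (?a i - ?b i))\<^sup>2)"
    by (simp add: sum_lessThan_double sum.distrib del: hadamard.simps)
  also have "\<dots> = 2 * (\<Sum>i<2 ^ k. (norm (?a i))\<^sup>2) + 2 * (\<Sum>i<2 ^ k. (norm (?b i))\<^sup>2)"
    unfolding parallelogram by (simp add: sum.distrib sum_distrib_left)
  also have "\<dots> = 2 ^ Suc k * (\<Sum>j<2 ^ Suc k. (norm (\<xi> j))\<^sup>2)"
    unfolding Suc.IH[of \<xi>] Suc.IH[of "\<lambda>j. \<xi> (2 ^ k + j)"] by (simp add: sum_lessThan_double algebra_simps)
  finally show ?case .
qed simp

definition sign_matrix :: "nat \<Rightarrow> 'a::real_vector \<Rightarrow> 'a mtx"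
  where "sign_matrix k h = (\<lambda>i j. if i < 2 ^ k \<and> j < 2 ^ k then hadamard k i j *\<^sub>R h else 0)"

lemma op_mnorm_sign_matrix: "op_mnorm (2 ^ k) (sign_matrix k h) \<le> sqrt (2 ^ k) * norm h"
  for h :: "'h::chilbert_space \<Rightarrow>\<^sub>L 'h"
proof (rule op_mnorm_leI)
  fix \<xi> :: "nat \<Rightarrow> 'h"
  have "L2_set (\<lambda>i. norm (\<Sum>j<2 ^ k. blinfun_apply (sign_matrix k h i j) (\<xi> j))) {..<2 ^ k}
      \<le> L2_set (\<lambda>i. norm h * norm (\<Sum>j<2 ^ k. hadamard k i j *\<^sub>R \<xi> j)) {..<2 ^ k}"
  proof (rule L2_set_mono)
    fix i :: nat assume "i \<in> {..<2 ^ k}"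
    then have "(\<Sum>j<2 ^ k. blinfun_apply (sign_matrix k h i j) (\<xi> j)) = blinfun_apply h (\<Sum>j<2 ^ k. hadamard k i j *\<^sub>R \<xi> j)"
      by (simp add: sign_matrix_def blinfun.sum_right blinfun.scaleR_right blinfun.scaleR_left)
    then show "norm (\<Sum>j<2 ^ k. blinfun_apply (sign_matrix k h i j) (\<xi> j)) \<le> norm h * norm (\<Sum>j<2 ^ k. hadamard k i j *\<^sub>R \<xi> j)"
      by (simp only: norm_blinfun)
  qed simp
  also have "\<dots> = norm h * L2_set (\<lambda>i. norm (\<Sum>j<2 ^ k. hadamard k i j *\<^sub>R \<xi> j)) {..<2 ^ k}"
    by (simp add: L2_set_right_distrib)
  also have "\<dots> = norm h * (sqrt (2 ^ k) * L2_set (\<lambda>j. norm (\<xi> j)) {..<2 ^ k})"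
    unfolding L2_set_def hadamard_action by (simp add: real_sqrt_mult)
  finally show "L2_set (\<lambda>i. norm (\<Sum>j<2 ^ k. blinfun_apply (sign_matrix k h i j) (\<xi> j))) {..<2 ^ k}
      \<le> sqrt (2 ^ k) * norm h * L2_set (\<lambda>j. norm (\<xi> j)) {..<2 ^ k}" by (simp add: mult_ac)
qed simp


section \<open>Coarse embeddings into OH are asymptotically additive\<close>

lemma telescope: "(a - b) + (b - c) = a - (c :: 'a::ab_group_add)"
  by simp

locale coarse_into_OH =
  fixes X :: "('h::chilbert_space \<Rightarrow>\<^sub>L 'h) set" and f :: "nat \<Rightarrow> ('h \<Rightarrow>\<^sub>L 'h) \<Rightarrow> ell2"
  assumes opsp: "operator_space X"
    and coarse: "equi_coarse_embedding
        (\<lambda>n. mball (opsp X) n (real n)) (\<lambda>n x y. mnorm (opsp X) n (x - y))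
        (\<lambda>n. Mat n (carr OH)) (\<lambda>n x y. mnorm OH n (x - y)) (\<lambda>n. amp n (f n))"
begin

lemma sub: "csubspace X"
  using opsp by (simp add: operator_space_def)

lemma X_zero: "0 \<in> X" and X_add: "x \<in> X \<Longrightarrow> y \<in> X \<Longrightarrow> x + y \<in> X" and X_scale: "x \<in> X \<Longrightarrow> c *\<^sub>C x \<in> X"
  and X_diff: "x \<in> X \<Longrightarrow> y \<in> X \<Longrightarrow> x - y \<in> X"
  using sub complex_vector.subspace_diff[OF sub] by (auto simp: complex_vector.subspace_def)

lemma X_scaleR: "x \<in> X \<Longrightarrow> r *\<^sub>R x \<in> X"
  by (simp add: scaleR_scaleC X_scale)

lemma Mat_linear:
  "x \<in> Mat n X \<Longrightarrow> y \<in> Mat n X \<Longrightarrow> x + y \<in> Mat n X" "x \<in> Mat n X \<Longrightarrow> y \<in> Mat n X \<Longrightarrow> x - y \<in> Mat n X"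
  "x \<in> Mat n X \<Longrightarrow> c *\<^sub>C x \<in> Mat n X" "0 \<in> Mat n X"
  by (auto simp: Mat_def scaleC_fun_def X_zero X_add X_diff X_scale)

lemma expansion:
  assumes "0 \<le> t"
  shows "\<exists>W. \<forall>n x y. 1 \<le> n \<longrightarrow> x \<in> mball (opsp X) n n \<longrightarrow> y \<in> mball (opsp X) n n \<longrightarrow>
    op_mnorm n (x - y) \<le> t \<longrightarrow> mnorm OH n (amp n (f n) x - amp n (f n) y) \<le> W"
proof -
  let ?S = "expansion_modulus (\<lambda>n. mball (opsp X) n (real n)) (\<lambda>n x y. mnorm (opsp X) n (x - y))
      (\<lambda>n x y. mnorm OH n (x - y)) (\<lambda>n. amp n (f n)) t"
  have fin: "?S < \<infinity>" using coarse assms by (simp add: equi_coarse_embedding_def)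
  have le: "ereal (mnorm OH n (amp n (f n) x - amp n (f n) y)) \<le> ?S"
    if "1 \<le> n" "x \<in> mball (opsp X) n n" "y \<in> mball (opsp X) n n" "op_mnorm n (x - y) \<le> t" for n x y
    unfolding expansion_modulus_def
    by (rule SUP_upper2[of n], use that in simp, rule SUP_upper2[of "(x, y)"]) (use that in \<open>auto simp: opsp_def\<close>)
  have "mnorm OH n (amp n (f n) x - amp n (f n) y) \<le> real_of_ereal ?S"
    if "1 \<le> n" "x \<in> mball (opsp X) n n" "y \<in> mball (opsp X) n n" "op_mnorm n (x - y) \<le> t" for n x y
    using le[OF that] fin by (cases ?S) auto
  then show ?thesis by blast
qed

lemma compression:
  obtains t0 where "0 < t0" "\<And>n x y. 1 \<le> n \<Longrightarrow> x \<in> mball (opsp X) n n \<Longrightarrow> y \<in> mball (opsp X) n n \<Longrightarrow>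
    t0 \<le> op_mnorm n (x - y) \<Longrightarrow> 1 \<le> mnorm OH n (amp n (f n) x - amp n (f n) y)"
proof -
  let ?S = "compression_modulus (\<lambda>n. mball (opsp X) n (real n)) (\<lambda>n x y. mnorm (opsp X) n (x - y))
      (\<lambda>n x y. mnorm OH n (x - y)) (\<lambda>n. amp n (f n))"
  have "\<forall>\<^sub>F t in at_top. ereal 1 < ?S t"
    using coarse unfolding equi_coarse_embedding_def by (intro order_tendstoD(1)) auto
  then have "\<forall>\<^sub>F t in at_top. ereal 1 < ?S t \<and> 0 < t"
    using eventually_gt_at_top by (rule eventually_conj)
  then obtain t where t: "ereal 1 < ?S t" "0 < t"
    using eventually_happens' trivial_limit_at_top_linorder by blast
  have "?S t \<le> ereal (mnorm OH n (amp n (f n) x - amp n (f n) y))"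
    if "1 \<le> n" "x \<in> mball (opsp X) n n" "y \<in> mball (opsp X) n n" "t \<le> op_mnorm n (x - y)" for n x y
    unfolding compression_modulus_def
    by (rule INF_lower2[of n], use that in simp, rule INF_lower2[of "(x, y)"]) (use that in \<open>auto simp: opsp_def\<close>)
  then show ?thesis
    using t by (intro that[of t]) (meson ereal_less_eq(3) less_imp_le order_trans)+
qed

text \<open>By \<open>expansion\<close> a real number with this property exists for every \<open>t \<ge> 0\<close>.\<close>

definition W :: "real \<Rightarrow> real"
  where "W t = (SOME W. \<forall>n x y. 1 \<le> n \<longrightarrow> x \<in> mball (opsp X) n n \<longrightarrow> y \<in> mball (opsp X) n n \<longrightarrow>
    op_mnorm n (x - y) \<le> t \<longrightarrow> mnorm OH n (amp n (f n) x - amp n (f n) y) \<le> W)"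

text \<open>The maps are normalised to vanish at zero. Outside the domain of \<open>f m\<close> they are set to zero, so that
  \<open>g m x\<close> is bounded uniformly in \<open>m\<close> for every single \<open>x\<close>.\<close>

definition g :: "nat \<Rightarrow> ('h \<Rightarrow>\<^sub>L 'h) \<Rightarrow> ell2"
  where "g m x = (if x \<in> X \<and> norm x \<le> m \<and> 1 \<le> m then f m x - f m 0 else 0)"

text \<open>An \<open>n \<times> n\<close> matrix is viewed as the corner of an \<open>m \<times> m\<close> matrix; outside the corner the
  two amplifications agree and cancel.\<close>

lemma amp_g_diff:
  assumes "x \<in> Mat n X" "y \<in> Mat n X" "n \<le> m" "1 \<le> m" "op_mnorm n x \<le> m" "op_mnorm n y \<le> m"
  shows "x \<in> mball (opsp X) m m" "y \<in> mball (opsp X) m m" "op_mnorm m (x - y) = op_mnorm n (x - y)"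
    and "mnorm OH m (amp m (f m) x - amp m (f m) y) = mnorm OH n (amp n (g m) x - amp n (g m) y)"
proof -
  have mem: "z \<in> Mat m X" if "z \<in> Mat n X" for z
  proof -
    have "if i < m \<and> j < m then z i j \<in> X else z i j = 0" for i j
      using that assms(3) X_zero Mat_zero[OF that, of i j] by (cases "i < n \<and> j < n") (auto simp: Mat_def)
    then show ?thesis by (simp add: Mat_def)
  qed
  have corner: "op_mnorm m z = op_mnorm n z" if "z \<in> Mat n X" for z
    using that by (intro op_mnorm_corner assms(3) Mat_UNIV_mono[of z n X]) auto
  show "x \<in> mball (opsp X) m m" "y \<in> mball (opsp X) m m"
    using assms mem corner by (auto simp: mball_def opsp_def)
  show "op_mnorm m (x - y) = op_mnorm n (x - y)"
    using assms by (intro corner Mat_linear)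
  have g: "g m (z i j) = f m (z i j) - f m 0" if "z \<in> Mat n X" "op_mnorm n z \<le> m" "i < n" "j < n" for z i j
    using that assms(4) norm_entry_le_op_mnorm[of i n j z] by (auto simp: g_def Mat_def)
  have "amp m (f m) x - amp m (f m) y = amp n (g m) x - amp n (g m) y"
    using assms g Mat_zero[OF assms(1)] Mat_zero[OF assms(2)] by (auto simp: amp_def fun_eq_iff)
  moreover have "amp n (g m) x - amp n (g m) y \<in> Mat n UNIV"
    by (intro OH.diff_mem amp_in_Mat)
  ultimately show "mnorm OH m (amp m (f m) x - amp m (f m) y) = mnorm OH n (amp n (g m) x - amp n (g m) y)"
    using OH_corner[OF assms(3)] by simp
qed

lemma g_expansion:
  assumes "x \<in> Mat n X" "y \<in> Mat n X" "n \<le> m" "1 \<le> m" "op_mnorm n x \<le> m" "op_mnorm n y \<le> m"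
    and "op_mnorm n (x - y) \<le> t"
  shows "mnorm OH n (amp n (g m) x - amp n (g m) y) \<le> W t"
proof -
  have "0 \<le> t" using assms(7) op_mnorm_nonneg order_trans by blast
  from someI_ex[OF expansion[OF this]]
  have "\<forall>n x y. 1 \<le> n \<longrightarrow> x \<in> mball (opsp X) n n \<longrightarrow> y \<in> mball (opsp X) n n \<longrightarrow>
    op_mnorm n (x - y) \<le> t \<longrightarrow> mnorm OH n (amp n (f n) x - amp n (f n) y) \<le> W t"
    unfolding W_def .
  then show ?thesis using amp_g_diff[OF assms(1-6)] assms(4,7) by metis
qed

lemma W_nonneg: "0 \<le> t \<Longrightarrow> 0 \<le> W t"
  using g_expansion[of 0 1 0 1 t] OH_nonneg[of "0 :: ell2 mtx" 1] Mat_linear(4)[of 1]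
  by (simp add: op_mnorm_scaleC[of 1 0, simplified] OH.zero_mem)

lemma entry_Mat: "x \<in> X \<Longrightarrow> entry x \<in> Mat 1 X"
  by (simp add: entry_def Mat_def)

lemma op_mnorm_entry: "op_mnorm 1 (entry x) = norm x" for x :: "'h \<Rightarrow>\<^sub>L 'h"
  using norm1_opsp[of UNIV x] by (simp add: norm1_def opsp_def)

lemma g_zero: "g m 0 = 0"
  by (simp add: g_def)

lemma entry_diff: "entry x - entry y = entry (x - y)" for x y :: "'b::ab_group_add"
  by (simp add: entry_def fun_eq_iff)

lemma amp_entry: "amp 1 h (entry x) = entry (h x)"
  by (simp add: amp_def entry_def fun_eq_iff)

lemma norm_g_le:
  assumes "norm x \<le> t"
  shows "norm (g m x) \<le> W t"
proof (cases "x \<in> X \<and> norm x \<le> m \<and> 1 \<le> m")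
  case True
  have "mnorm OH 1 (amp 1 (g m) (entry x) - amp 1 (g m) (entry 0)) \<le> W t"
    using True assms by (intro g_expansion entry_Mat X_zero) (simp_all add: op_mnorm_entry entry_diff del: One_nat_def)
  moreover have "norm ((amp 1 (g m) (entry x) - amp 1 (g m) (entry 0)) 0 0)
      \<le> mnorm OH 1 (amp 1 (g m) (entry x) - amp 1 (g m) (entry 0))"
    by (intro norm_entry_le_OH OH.diff_mem amp_in_Mat) auto
  ultimately show ?thesis by (simp add: amp_def entry_def g_zero)
next
  case False
  then show ?thesis using W_nonneg[of t] assms order_trans[OF norm_ge_zero assms] by (auto simp: g_def)
qed

text \<open>On a convex set a coarse map is Lipschitz at large distances: a segment is cut into pieces of
  length at most one.\<close>

lemma g_coarse_lipschitz:
  assumes x: "x \<in> Mat n X" and y: "y \<in> Mat n X" and m: "n \<le> m" "1 \<le> m" "op_mnorm n x \<le> m" "op_mnorm n y \<le> m"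
  shows "mnorm OH n (amp n (g m) x - amp n (g m) y) \<le> W 1 * (op_mnorm n (x - y) + 1)"
proof -
  define K where "K = nat \<lfloor>op_mnorm n (x - y)\<rfloor> + 1"
  have K: "op_mnorm n (x - y) \<le> real K" "real K \<le> op_mnorm n (x - y) + 1" "0 < K"
    using op_mnorm_nonneg[of n "x - y"] real_of_int_floor_add_one_ge[of "op_mnorm n (x - y)"]
    unfolding K_def by (simp_all add: add.commute)
  define z where "z k = y + complex_of_real (real k / real K) *\<^sub>C (x - y)" for k
  have zM: "z k \<in> Mat n X" for k unfolding z_def by (intro Mat_linear x y)
  have zn: "op_mnorm n (z k) \<le> m" if "k \<le> K" for k
  proof -
    let ?c = "real k / real K"
    have c: "0 \<le> ?c" "?c \<le> 1" using that K(3) by auto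
    have "z k = complex_of_real (1 - ?c) *\<^sub>C y + complex_of_real ?c *\<^sub>C x"
      unfolding z_def complex_vector.scale_right_diff_distrib of_real_diff complex_vector.scale_left_diff_distrib
      by (simp add: scaleC_one)
    then have "op_mnorm n (z k) \<le> cmod (complex_of_real (1 - ?c)) * op_mnorm n y + cmod (complex_of_real ?c) * op_mnorm n x"
      using op_mnorm_triangle[of n "complex_of_real (1 - ?c) *\<^sub>C y" "complex_of_real ?c *\<^sub>C x"] by (simp only: op_mnorm_scaleC)
    also have "\<dots> = (1 - ?c) * op_mnorm n y + ?c * op_mnorm n x" using c by (simp only: norm_of_real abs_of_nonneg)
    also have "\<dots> \<le> (1 - ?c) * m + ?c * m" using c m by (intro add_mono mult_left_mono) auto
    also have "\<dots> = m" by (simp add: algebra_simps)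
    finally show ?thesis .
  qed
  have "mnorm OH n (amp n (g m) (z k) - amp n (g m) y) \<le> k * W 1" if "k \<le> K" for k
    using that
  proof (induction k)
    case 0
    have "mnorm OH n 0 \<le> 0" using OH_le_sum[of "0 :: ell2 mtx" n] OH.zero_mem by simp
    moreover have "z 0 = y" by (simp add: z_def)
    ultimately show ?case by (simp only: diff_self of_nat_0 mult_zero_left)
  next
    case (Suc k)
    have "z (Suc k) - z k = complex_of_real (1 / real K) *\<^sub>C (x - y)"
      by (simp add: z_def add_divide_distrib complex_vector.scale_left_distrib)
    then have "op_mnorm n (z (Suc k) - z k) = (1 / real K) * op_mnorm n (x - y)"
      by (simp only: op_mnorm_scaleC norm_of_real) simp
    then have "op_mnorm n (z (Suc k) - z k) \<le> 1" using K by simp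
    then have "mnorm OH n (amp n (g m) (z (Suc k)) - amp n (g m) (z k)) \<le> W 1"
      using Suc.prems by (intro g_expansion zM m zn) auto
    moreover have "mnorm OH n ((amp n (g m) (z (Suc k)) - amp n (g m) (z k)) + (amp n (g m) (z k) - amp n (g m) y))
        \<le> mnorm OH n (amp n (g m) (z (Suc k)) - amp n (g m) (z k)) + mnorm OH n (amp n (g m) (z k) - amp n (g m) y)"
      by (intro OH_triangle OH.diff_mem amp_in_Mat)
    moreover have "mnorm OH n (amp n (g m) (z k) - amp n (g m) y) \<le> k * W 1" using Suc by linarith
    ultimately show ?case by (simp only: telescope of_nat_Suc distrib_right mult_1)
  qed
  from this[of K] have "mnorm OH n (amp n (g m) (z K) - amp n (g m) y) \<le> K * W 1" by simp
  moreover have "z K = x" using K(3) by (simp add: z_def scaleC_one)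
  moreover have "K * W 1 \<le> (op_mnorm n (x - y) + 1) * W 1"
    using K(2) W_nonneg[of 1] by (intro mult_right_mono) auto
  ultimately show ?thesis by (simp add: mult.commute)
qed

text \<open>Two matrices of size \<open>M = 2 ^ k\<close> are compared: one has the entries \<open>a \<plusminus> h\<close> with the signs of the
  Hadamard matrix, the other the constant entry \<open>a\<close>. Their distance is only of order \<open>sqrt M\<close>. The sum
  of all entries of the difference of their images is at most \<open>M\<close> times its norm, and it contains
  the second difference with weight \<open>M\<^sup>2 / 2\<close>.\<close>

lemma second_difference_le:
  assumes a: "a \<in> X" and h: "h \<in> X" and m: "4 ^ k * (norm a + norm h) \<le> m" "2 ^ k \<le> m" "norm a + norm h \<le> t"
  shows "norm (g m (a + h) + g m (a - h) - 2 *\<^sub>R g m a) \<le> (2 * W 1 * (sqrt (2 ^ k) * norm h + 1) + 2 * W t) / 2 ^ k"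
proof -
  let ?M = "2 ^ k :: nat"
  let ?D = "g m (a + h) + g m (a - h) - 2 *\<^sub>R g m a"
  define y where "y = (\<lambda>i j. if i < ?M \<and> j < ?M then a else 0)"
  define x where "x = y + sign_matrix k h"
  have yM: "y \<in> Mat ?M X" using a by (auto simp: y_def Mat_def)
  have sM: "sign_matrix k h \<in> Mat ?M X" using h by (auto simp: sign_matrix_def Mat_def X_scaleR)
  have xM: "x \<in> Mat ?M X" unfolding x_def by (intro Mat_linear yM sM)
  have M1: "1 \<le> m" using m(2) order_trans[OF one_le_power[of "2::nat" k]] by simp
  have small: "op_mnorm ?M z \<le> m" if "\<And>i j. norm (z i j) \<le> norm a + norm h" for z :: "('h \<Rightarrow>\<^sub>L 'h) mtx"
  proof -
    have "op_mnorm ?M z \<le> (\<Sum>i<?M. \<Sum>j<?M. norm (z i j))" by (rule op_mnorm_le_sum)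
    also have "\<dots> \<le> (\<Sum>i<?M. \<Sum>j<?M. norm a + norm h)" by (intro sum_mono that)
    also have "\<dots> = 4 ^ k * (norm a + norm h)" by (simp flip: power_mult_distrib add: mult.assoc[symmetric])
    finally show ?thesis using m(1) by linarith
  qed
  have ab: "\<bar>hadamard k i j\<bar> = 1" for i j using hadamard_sign[of k i j] by auto
  have yn: "op_mnorm ?M y \<le> m" by (intro small) (auto simp: y_def)
  have xn: "op_mnorm ?M x \<le> m"
  proof (rule small)
    show "norm (x i j) \<le> norm a + norm h" for i j
      using norm_triangle_ineq[of a "hadamard k i j *\<^sub>R h"] by (auto simp: x_def y_def sign_matrix_def ab)
  qed
  define v where "v = amp ?M (g m) x - amp ?M (g m) y"
  have vM: "v \<in> Mat ?M UNIV" unfolding v_def by (intro OH.diff_mem amp_in_Mat)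
  have "mnorm OH ?M v \<le> W 1 * (op_mnorm ?M (x - y) + 1)"
    unfolding v_def by (rule g_coarse_lipschitz[OF xM yM m(2) M1 xn yn])
  also have "\<dots> \<le> W 1 * (sqrt (2 ^ k) * norm h + 1)"
    using op_mnorm_sign_matrix[of k h] W_nonneg[of 1] by (intro mult_left_mono) (auto simp: x_def)
  finally have vn: "mnorm OH ?M v \<le> W 1 * (sqrt (2 ^ k) * norm h + 1)" .
  \<comment> \<open>Decomposition of each entry into the parts that are even and odd in the sign.\<close>
  have v_eq: "2 *\<^sub>R v i j = ?D + hadamard k i j *\<^sub>R (g m (a + h) - g m (a - h))" if "i < ?M" "j < ?M" for i j
    using hadamard_sign[of k i j] that
    by (auto simp: v_def amp_def x_def y_def sign_matrix_def scaleR_2 algebra_simps)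
  have "2 *\<^sub>R (\<Sum>i<?M. \<Sum>j<?M. v i j) = (\<Sum>i<?M. \<Sum>j<?M. ?D + hadamard k i j *\<^sub>R (g m (a + h) - g m (a - h)))"
    unfolding scaleR_sum_right by (intro sum.cong refl v_eq) auto
  also have "\<dots> = real (?M * ?M) *\<^sub>R ?D + (2 ^ k) *\<^sub>R (g m (a + h) - g m (a - h))"
  proof -
    have "(\<Sum>i<?M. \<Sum>j<?M. ?D) = real (?M * ?M) *\<^sub>R ?D"
      by (simp only: sum_constant_scaleR card_lessThan scaleR_scaleR of_nat_mult)
    moreover have "(\<Sum>i<?M. \<Sum>j<?M. hadamard k i j *\<^sub>R z) = 2 ^ k *\<^sub>R z" for z :: ell2
      unfolding scaleR_sum_left[symmetric] hadamard_sum ..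
    ultimately show ?thesis by (simp only: sum.distrib)
  qed
  finally have "real (?M * ?M) *\<^sub>R ?D = 2 *\<^sub>R (\<Sum>i<?M. \<Sum>j<?M. v i j) - (2 ^ k) *\<^sub>R (g m (a + h) - g m (a - h))"
    by (simp only: add_diff_cancel_right')
  then have "norm (real (?M * ?M) *\<^sub>R ?D)
      \<le> norm (2 *\<^sub>R (\<Sum>i<?M. \<Sum>j<?M. v i j)) + norm ((2 ^ k :: real) *\<^sub>R (g m (a + h) - g m (a - h)))"
    by (simp only: norm_triangle_ineq4)
  also have "\<dots> = 2 * norm (\<Sum>i<?M. \<Sum>j<?M. v i j) + 2 ^ k * norm (g m (a + h) - g m (a - h))" by simp
  also have "\<dots> \<le> 2 * (real ?M * (W 1 * (sqrt (2 ^ k) * norm h + 1))) + 2 ^ k * (2 * W t)"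
  proof (intro add_mono mult_left_mono)
    show "norm (\<Sum>i<?M. \<Sum>j<?M. v i j) \<le> real ?M * (W 1 * (sqrt (2 ^ k) * norm h + 1))"
      by (rule order_trans[OF norm_total_le_OH[OF vM _ le_refl] mult_left_mono[OF vn]]) simp_all
    have "norm (a + h) \<le> t" "norm (a - h) \<le> t"
      using norm_triangle_ineq[of a h] norm_triangle_ineq4[of a h] m(3) by linarith+
    then show "norm (g m (a + h) - g m (a - h)) \<le> 2 * W t"
      using norm_triangle_ineq4[of "g m (a + h)" "g m (a - h)"] norm_g_le[of "a + h" t m] norm_g_le[of "a - h" t m] by linarith
  qed auto
  also have "\<dots> = 2 ^ k * (2 * W 1 * (sqrt (2 ^ k) * norm h + 1) + 2 * W t)" by (simp add: algebra_simps)
  finally have "2 ^ k * (2 ^ k * norm ?D) \<le> 2 ^ k * (2 * W 1 * (sqrt (2 ^ k) * norm h + 1) + 2 * W t)"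
    by (simp add: mult.assoc)
  then have "2 ^ k * norm ?D \<le> 2 * W 1 * (sqrt (2 ^ k) * norm h + 1) + 2 * W t"
    by (rule mult_left_le_imp_le) simp
  then show ?thesis by (simp add: field_simps)
qed

lemma g_midpoint:
  assumes a: "a \<in> X" and h: "h \<in> X"
  shows "(\<lambda>m. g m (a + h) + g m (a - h) - 2 *\<^sub>R g m a) \<longlonglongrightarrow> 0"
proof (rule metric_LIMSEQ_I)
  fix e :: real assume e: "0 < e"
  let ?B = "\<lambda>k. (2 * W 1 * (sqrt (2 ^ k) * norm h + 1) + 2 * W (norm a + norm h)) / 2 ^ k"
  have "(\<lambda>k. 2 * W 1 * norm h * (1 / sqrt 2) ^ k + (2 * W 1 + 2 * W (norm a + norm h)) * (1 / 2) ^ k)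
      \<longlonglongrightarrow> 2 * W 1 * norm h * 0 + (2 * W 1 + 2 * W (norm a + norm h)) * 0"
    by (intro tendsto_intros LIMSEQ_realpow_zero) auto
  moreover have "?B k = 2 * W 1 * norm h * (1 / sqrt 2) ^ k + (2 * W 1 + 2 * W (norm a + norm h)) * (1 / 2) ^ k" for k
  proof -
    have "(1 / sqrt 2) ^ k = sqrt (2 ^ k) / 2 ^ k"
    proof -
      have "1 / sqrt 2 = sqrt 2 / 2" by (simp add: real_div_sqrt field_simps)
      then show ?thesis by (simp only: power_divide real_sqrt_power)
    qed
    then show ?thesis by (simp add: power_divide algebra_simps add_divide_distrib)
  qed
  ultimately have "?B \<longlonglongrightarrow> 0" by simp
  then have "\<forall>\<^sub>F k in sequentially. ?B k < e" using e by (rule order_tendstoD)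
  then obtain k where k: "?B k < e" by (auto simp: eventually_sequentially)
  obtain N where N: "4 ^ k * (norm a + norm h) \<le> real N" using real_arch_simple by blast
  have "dist (g m (a + h) + g m (a - h) - 2 *\<^sub>R g m a) 0 < e" if "max N (2 ^ k) \<le> m" for m
    using second_difference_le[OF a h, of k m "norm a + norm h"] N that k by (simp add: dist_norm)
  then show "\<exists>N. \<forall>m\<ge>N. dist (g m (a + h) + g m (a - h) - 2 *\<^sub>R g m a) 0 < e" by blast
qed

text \<open>The points \<open>x\<close>, \<open>y\<close> and the points \<open>x + y\<close>, \<open>0\<close> have the same midpoint.\<close>

lemma g_additive:
  assumes x: "x \<in> X" and y: "y \<in> X"
  shows "(\<lambda>m. g m (x + y) - g m x - g m y) \<longlonglongrightarrow> 0"
proof -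
  let ?a = "(1/2) *\<^sub>R (x + y)" and ?h = "(1/2) *\<^sub>R (x - y)"
  have mem: "?a \<in> X" "?h \<in> X" using x y by (auto intro: X_scaleR X_add X_diff)
  have half: "(1/2) *\<^sub>R z + (1/2) *\<^sub>R z = z" for z :: "'h \<Rightarrow>\<^sub>L 'h"
    by (simp flip: scaleR_add_left)
  have eq: "?a + ?h = x" "?a - ?h = y" "?a + ?a = x + y"
    using half[of x] half[of y] half[of "x + y"] by (simp_all add: scaleR_diff_right scaleR_add_right)
  have "(\<lambda>m. (g m (x + y) + g m 0 - 2 *\<^sub>R g m ?a) - (g m x + g m y - 2 *\<^sub>R g m ?a)) \<longlonglongrightarrow> 0 - 0"
    using g_midpoint[OF mem(1) mem(1), unfolded eq diff_self] g_midpoint[OF mem, unfolded eq] by (rule tendsto_diff)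
  then show ?thesis by (simp add: g_zero algebra_simps)
qed

end

context coarse_into_OH
begin

lemma g_compression:
  obtains t0 where "0 < t0" "\<And>n m x y. x \<in> Mat n X \<Longrightarrow> y \<in> Mat n X \<Longrightarrow> n \<le> m \<Longrightarrow> 1 \<le> m \<Longrightarrow>
    op_mnorm n x \<le> m \<Longrightarrow> op_mnorm n y \<le> m \<Longrightarrow> t0 \<le> op_mnorm n (x - y) \<Longrightarrow>
    1 \<le> mnorm OH n (amp n (g m) x - amp n (g m) y)"
proof -
  obtain t0 where t0: "0 < t0" "\<And>n x y. 1 \<le> n \<Longrightarrow> x \<in> mball (opsp X) n n \<Longrightarrow> y \<in> mball (opsp X) n n \<Longrightarrow>
      t0 \<le> op_mnorm n (x - y) \<Longrightarrow> 1 \<le> mnorm OH n (amp n (f n) x - amp n (f n) y)"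
    using compression by blast
  show ?thesis
  proof (rule that[OF t0(1)])
    fix n m x y
    assume a: "x \<in> Mat n X" "y \<in> Mat n X" "n \<le> m" "1 \<le> m" "op_mnorm n x \<le> m" "op_mnorm n y \<le> m"
      and d: "t0 \<le> op_mnorm n (x - y)"
    show "1 \<le> mnorm OH n (amp n (g m) x - amp n (g m) y)"
      using t0(2)[OF a(4) amp_g_diff(1,2)[OF a]] d unfolding amp_g_diff(3,4)[OF a] by blast
  qed
qed

text \<open>Asymptotically the maps \<open>g m\<close> are linear over the reals, but in general not over the complex numbers.
  Up to null sequences \<open>s m\<close> lists the complex linear part and the conjugate of the antilinear part of
  \<open>g m\<close> in the two halves of the coordinates.\<close>

definition s :: "nat \<Rightarrow> ('h \<Rightarrow>\<^sub>L 'h) \<Rightarrow> ell2"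
  where "s m x = inj_half 0 ((1/2) *\<^sub>C (g m x - \<i> *\<^sub>C g m (\<i> *\<^sub>C x)))
    + inj_half 1 (conj_ell2 ((1/2) *\<^sub>C (g m x + \<i> *\<^sub>C g m (\<i> *\<^sub>C x))))"

definition lin_half :: "ell2 \<Rightarrow> ell2" where "lin_half u = inj_half 0 ((1/2) *\<^sub>C u)"

definition anti_half :: "ell2 \<Rightarrow> ell2" where "anti_half u = inj_half 1 (conj_ell2 ((1/2) *\<^sub>C u))"

lemma s_halves: "s m x = lin_half (g m x - \<i> *\<^sub>C g m (\<i> *\<^sub>C x)) + anti_half (g m x + \<i> *\<^sub>C g m (\<i> *\<^sub>C x))"
  by (simp add: s_def lin_half_def anti_half_def)

lemma conj_ell2_uminus: "conj_ell2 (- x) = - conj_ell2 x"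
  by (simp add: ell2_eqI)

lemma half_linear:
  "lin_half (u + v) = lin_half u + lin_half v" "lin_half (u - v) = lin_half u - lin_half v"
  "lin_half (c *\<^sub>C u) = c *\<^sub>C lin_half u"
  "anti_half (u + v) = anti_half u + anti_half v" "anti_half (u - v) = anti_half u - anti_half v"
  "anti_half (c *\<^sub>C u) = cnj c *\<^sub>C anti_half u"
  "lin_half (- u) = - lin_half u" "anti_half (- u) = - anti_half u"
  by (simp_all add: lin_half_def anti_half_def inj_half_linear conj_ell2_linear scaleC_add_right
      complex_vector.scale_right_diff_distrib scaleC_scaleC mult.commute conj_ell2_uminus)

lemma norm_half: "norm (lin_half u) = norm u / 2" "norm (anti_half u) = norm u / 2"
  by (simp_all add: lin_half_def anti_half_def norm_inj_half norm_scaleC)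

lemma norm_i [simp]: "norm (\<i> *\<^sub>C x) = norm x" for x :: "'a::complex_normed_vector"
  by (simp add: norm_scaleC)

lemma norm_i_combinations: "norm (a - \<i> *\<^sub>C b) / 2 + norm (a + \<i> *\<^sub>C b) / 2 \<le> norm a + norm b"
  for a b :: "'a::complex_normed_vector"
proof -
  have "norm (a - \<i> *\<^sub>C b) \<le> norm a + norm b" using norm_triangle_ineq4[of a "\<i> *\<^sub>C b"] by simp
  moreover have "norm (a + \<i> *\<^sub>C b) \<le> norm a + norm b" using norm_triangle_ineq[of a "\<i> *\<^sub>C b"] by simp
  ultimately show ?thesis by linarith
qed

lemma i_i: "\<i> *\<^sub>C (\<i> *\<^sub>C x) = - x" for x :: "'a::complex_vector"
  by (simp add: scaleC_scaleC scaleC_minus1)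

lemma s_additive:
  assumes "x \<in> X" "y \<in> X"
  shows "(\<lambda>m. s m (x + y) - s m x - s m y) \<longlonglongrightarrow> 0"
proof (rule Lim_null_comparison)
  let ?d = "\<lambda>x y m. g m (x + y) - g m x - g m y"
  have "(\<lambda>m. norm (?d x y m) + norm (?d (\<i> *\<^sub>C x) (\<i> *\<^sub>C y) m)) \<longlonglongrightarrow> 0 + 0"
    by (intro tendsto_add tendsto_norm_zero g_additive assms X_scale)
  then show "(\<lambda>m. norm (?d x y m) + norm (?d (\<i> *\<^sub>C x) (\<i> *\<^sub>C y) m)) \<longlonglongrightarrow> 0" by simp
  have "norm (s m (x + y) - s m x - s m y) \<le> norm (?d x y m) + norm (?d (\<i> *\<^sub>C x) (\<i> *\<^sub>C y) m)" for m
  proof -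
    let ?a = "?d x y m" and ?b = "?d (\<i> *\<^sub>C x) (\<i> *\<^sub>C y) m"
    have eq: "s m (x + y) - s m x - s m y = lin_half (?a - \<i> *\<^sub>C ?b) + anti_half (?a + \<i> *\<^sub>C ?b)"
      by (simp add: s_halves half_linear scaleC_add_right complex_vector.scale_right_diff_distrib)
    have "norm (s m (x + y) - s m x - s m y) \<le> norm (?a - \<i> *\<^sub>C ?b) / 2 + norm (?a + \<i> *\<^sub>C ?b) / 2"
      unfolding eq by (rule order_trans[OF norm_triangle_ineq]) (simp only: norm_half)
    also have "\<dots> \<le> norm ?a + norm ?b"
      by (rule norm_i_combinations)
    finally show ?thesis .
  qed
  then show "\<forall>\<^sub>F m in sequentially. norm (s m (x + y) - s m x - s m y) \<le> norm (?d x y m) + norm (?d (\<i> *\<^sub>C x) (\<i> *\<^sub>C y) m)"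
    by simp
qed

lemma s_imaginary:
  assumes "x \<in> X"
  shows "(\<lambda>m. s m (\<i> *\<^sub>C x) - \<i> *\<^sub>C s m x) \<longlonglongrightarrow> 0"
proof (rule Lim_null_comparison)
  have "- x \<in> X" using X_scale[OF assms, of "- 1"] by (simp add: scaleC_minus1)
  from tendsto_norm_zero[OF g_additive[OF assms this]]
  show "(\<lambda>m. norm (g m (x + - x) - g m x - g m (- x))) \<longlonglongrightarrow> 0" .
  have "norm (s m (\<i> *\<^sub>C x) - \<i> *\<^sub>C s m x) \<le> norm (g m (x + - x) - g m x - g m (- x))" for m
  proof -
    let ?e = "g m x + g m (- x)"
    have eq: "s m (\<i> *\<^sub>C x) - \<i> *\<^sub>C s m x = lin_half ((- \<i>) *\<^sub>C ?e) + anti_half (\<i> *\<^sub>C ?e)"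
      by (simp add: s_halves half_linear i_i scaleC_add_right complex_vector.scale_right_diff_distrib scaleC_scaleC)
    have "norm (s m (\<i> *\<^sub>C x) - \<i> *\<^sub>C s m x) \<le> norm ?e / 2 + norm ?e / 2"
      unfolding eq by (rule order_trans[OF norm_triangle_ineq]) (simp add: norm_half norm_scaleC)
    also have "\<dots> = norm (- ?e)" by (simp only: norm_minus_cancel)
    finally show ?thesis by (simp add: g_zero)
  qed
  then show "\<forall>\<^sub>F m in sequentially. norm (s m (\<i> *\<^sub>C x) - \<i> *\<^sub>C s m x) \<le> norm (g m (x + - x) - g m x - g m (- x))"
    by simp
qed

lemma norm_s_le:
  assumes "norm x \<le> t"
  shows "norm (s m x) \<le> 2 * W t"
proof -
  have "norm (s m x) \<le> norm (g m x - \<i> *\<^sub>C g m (\<i> *\<^sub>C x)) / 2 + norm (g m x + \<i> *\<^sub>C g m (\<i> *\<^sub>C x)) / 2"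
    unfolding s_halves by (rule order_trans[OF norm_triangle_ineq]) (simp only: norm_half)
  also have "\<dots> \<le> norm (g m x) + norm (g m (\<i> *\<^sub>C x))"
    by (rule norm_i_combinations)
  also have "\<dots> \<le> W t + W t" by (intro add_mono norm_g_le) (simp_all add: assms)
  finally show ?thesis by simp
qed

lemma amp_s_le: "mnorm OH n (amp n (s m) x) \<le> mnorm OH n (amp n (g m) x) + mnorm OH n (amp n (g m) (\<i> *\<^sub>C x))"
proof -
  let ?u = "amp n (g m) x" and ?w = "amp n (g m) (\<i> *\<^sub>C x)"
  let ?p = "?u + (- \<i>) *\<^sub>C ?w" and ?q = "?u + \<i> *\<^sub>C ?w"
  have M: "?u \<in> Mat n UNIV" "c *\<^sub>C ?w \<in> Mat n UNIV" "?u + c *\<^sub>C ?w \<in> Mat n UNIV" for c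
    by (intro OH.add_mem OH.scale_mem amp_in_Mat)+
  have le: "mnorm OH n (?u + c *\<^sub>C ?w) \<le> mnorm OH n ?u + mnorm OH n ?w" if "cmod c = 1" for c
    using OH_triangle[OF M(1) M(2), of c] OH_scale_le[OF _ amp_in_Mat, of c n "g m" "\<i> *\<^sub>C x"] that by fastforce
  have "amp n (s m) x = amp n lin_half ?p + amp n anti_half ?q"
    by (simp add: amp_def fun_eq_iff scaleC_fun_def s_halves)
  then have "mnorm OH n (amp n (s m) x) \<le> mnorm OH n (amp n lin_half ?p) + mnorm OH n (amp n anti_half ?q)"
    using OH_triangle[OF amp_in_Mat amp_in_Mat] by simp
  also have "\<dots> \<le> (1/2) * mnorm OH n ?p + (1/2) * mnorm OH n ?q"
  proof (rule add_mono)
    show "mnorm OH n (amp n lin_half ?p) \<le> (1/2) * mnorm OH n ?p"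
      by (rule OH_homogeneous[of id, OF _ _ _ _ _ M(3)]) (simp_all add: half_linear norm_half)
    show "mnorm OH n (amp n anti_half ?q) \<le> (1/2) * mnorm OH n ?q"
      by (rule OH_homogeneous[of cnj, OF _ _ _ _ _ M(3)]) (simp_all add: half_linear norm_half)
  qed
  also have "\<dots> \<le> mnorm OH n ?u + mnorm OH n ?w" using le[of "- \<i>"] le[of \<i>] by simp
  finally show ?thesis .
qed

text \<open>The map \<open>g m\<close> is exactly the sum of the two parts that \<open>s m\<close> lists, so this estimate and the previous
  one hold for every \<open>m\<close>, without a limit.\<close>

lemma amp_g_le: "mnorm OH n (amp n (g m) x) \<le> 2 * mnorm OH n (amp n (s m) x)"
proof -
  let ?s = "amp n (s m) x"
  let ?J = "\<lambda>u. conj_ell2 (proj_half 1 u)"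
  have "proj_half 0 (s m y) + ?J (s m y) = g m y" for y
  proof -
    have "(1/2) *\<^sub>C (a - b) + (1/2) *\<^sub>C (a + b) = a" for a b :: ell2
      by (rule ell2_eqI) (simp add: algebra_simps)
    then show ?thesis
      by (simp add: s_def proj_half_linear proj_inj_half proj_inj_half_other conj_ell2_linear del: One_nat_def)
  qed
  then have "amp n (g m) x = amp n (proj_half 0) ?s + amp n ?J ?s"
    by (simp add: amp_def fun_eq_iff)
  then have "mnorm OH n (amp n (g m) x) \<le> mnorm OH n (amp n (proj_half 0) ?s) + mnorm OH n (amp n ?J ?s)"
    using OH_triangle[OF amp_in_Mat amp_in_Mat] by simp
  also have "\<dots> \<le> 1 * mnorm OH n ?s + 1 * mnorm OH n ?s"
  proof (rule add_mono)
    show "mnorm OH n (amp n (proj_half 0) ?s) \<le> 1 * mnorm OH n ?s"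
      by (rule OH_homogeneous[of id]) (simp_all add: proj_half_linear norm_proj_half_le amp_in_Mat)
    show "mnorm OH n (amp n ?J ?s) \<le> 1 * mnorm OH n ?s"
      by (rule OH_homogeneous[of cnj]) (simp_all add: proj_half_linear conj_ell2_linear norm_proj_half_le amp_in_Mat)
  qed
  finally show ?thesis by simp
qed

lemma amp_g_zero: "amp n (g m) 0 = 0"
  by (simp add: amp_def fun_eq_iff g_zero)

lemma eventually_size: "\<forall>\<^sub>F m in sequentially. n \<le> m \<and> 1 \<le> m \<and> r \<le> real m"
  using eventually_ge_at_top[of n] eventually_ge_at_top[of "1::nat"] eventually_ge_at_top[of "nat \<lceil>r\<rceil>"]
  by eventually_elim linarith

lemma amp_s_upper:
  assumes x: "x \<in> Mat n X" and le: "op_mnorm n x \<le> 1"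
  shows "\<forall>\<^sub>F m in sequentially. mnorm OH n (amp n (s m) x) \<le> 2 * W 1"
  using eventually_size[of n 1]
proof eventually_elim
  case (elim m)
  have z: "op_mnorm n (0 :: ('h \<Rightarrow>\<^sub>L 'h) mtx) = 0" using op_mnorm_scaleC[of n 0 x] by simp
  have "mnorm OH n (amp n (g m) y) \<le> W 1" if "y \<in> Mat n X" "op_mnorm n y \<le> 1" for y
  proof -
    have "op_mnorm n y \<le> m" using that(2) elim by linarith
    then show ?thesis
      using g_expansion[OF that(1) Mat_linear(4), of m 1] that elim by (simp only: diff_zero amp_g_zero z)
  qed
  from this[OF x le] this[OF Mat_linear(3)[OF x, of \<i>]] show ?case
    using amp_s_le[of n m x] le by (simp add: op_mnorm_scaleC)
qed

lemma amp_s_lower: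
  obtains t0 where "0 < t0"
    "\<And>n x. x \<in> Mat n X \<Longrightarrow> t0 \<le> op_mnorm n x \<Longrightarrow> \<forall>\<^sub>F m in sequentially. 1 / 2 \<le> mnorm OH n (amp n (s m) x)"
proof -
  obtain t0 where t0: "0 < t0" "\<And>n m x y. x \<in> Mat n X \<Longrightarrow> y \<in> Mat n X \<Longrightarrow> n \<le> m \<Longrightarrow> 1 \<le> m \<Longrightarrow>
      op_mnorm n x \<le> m \<Longrightarrow> op_mnorm n y \<le> m \<Longrightarrow> t0 \<le> op_mnorm n (x - y) \<Longrightarrow>
      1 \<le> mnorm OH n (amp n (g m) x - amp n (g m) y)" using g_compression by blast
  show ?thesis
  proof (rule that[OF t0(1)])
    fix n x assume x: "x \<in> Mat n X" "t0 \<le> op_mnorm n x"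
    show "\<forall>\<^sub>F m in sequentially. 1 / 2 \<le> mnorm OH n (amp n (s m) x)"
      using eventually_size[of n "op_mnorm n x"]
    proof eventually_elim
      case (elim m)
      have z: "op_mnorm n (0 :: ('h \<Rightarrow>\<^sub>L 'h) mtx) = 0" using op_mnorm_scaleC[of n 0 x] by simp
      have "1 \<le> mnorm OH n (amp n (g m) x)"
        using t0(2)[OF x(1) Mat_linear(4), of m] x(2) elim by (simp only: diff_zero amp_g_zero z)
      then show ?case using amp_g_le[of n m x] by linarith
    qed
  qed
qed

end


section \<open>The limit inner product\<close>

text \<open>Tychonoff's theorem in the form of a filter along which all coordinates converge.\<close>

lemma bounded_family_convergent_filter:
  fixes b :: "nat \<Rightarrow> 'p \<Rightarrow> complex"
  assumes "\<And>m p. cmod (b m p) \<le> R p"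
  obtains F h where "F \<noteq> bot" "F \<le> sequentially" "\<And>p. ((\<lambda>m. b m p) \<longlongrightarrow> h p) F"
proof -
  let ?K = "PiE UNIV (\<lambda>p. cball (0 :: complex) (R p))"
  have "compactin (product_topology (\<lambda>p. euclidean) UNIV) ?K"
    by (subst compactin_PiE) simp
  then have "compact ?K" by (simp add: euclidean_product_topology)
  moreover have "filtermap b sequentially \<noteq> bot" by (simp add: filtermap_bot_iff)
  moreover have "eventually (\<lambda>x. x \<in> ?K) (filtermap b sequentially)"
    using assms by (simp add: eventually_filtermap PiE_UNIV_domain)
  ultimately obtain h where h: "inf (nhds h) (filtermap b sequentially) \<noteq> bot"
    unfolding compact_filter by blast
  define F where "F = inf sequentially (filtercomap b (nhds h))"
  show ?thesis
  proof
    show "F \<noteq> bot"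
    proof
      assume "F = bot"
      then have "eventually (\<lambda>_. False) F" by simp
      then obtain P Q where P: "eventually P sequentially" and Q: "eventually Q (filtercomap b (nhds h))"
        and PQ: "\<And>m. P m \<Longrightarrow> Q m \<Longrightarrow> False"
        unfolding F_def eventually_inf by blast
      obtain Q' where Q': "eventually Q' (nhds h)" "\<And>m. Q' (b m) \<Longrightarrow> Q m"
        using Q unfolding eventually_filtercomap by blast
      have "eventually (\<lambda>y. \<not> Q' y) (filtermap b sequentially)"
        unfolding eventually_filtermap using P by eventually_elim (use PQ Q'(2) in blast)
      then have "eventually (\<lambda>_. False) (inf (nhds h) (filtermap b sequentially))"
        unfolding eventually_inf using Q'(1) by blast
      then show False using h by (simp add: eventually_False)
    qed
    show "F \<le> sequentially" by (simp add: F_def)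
    have "filterlim b (nhds h) (filtercomap b (nhds h))" by (rule filterlim_filtercomap)
    then have lim: "(b \<longlongrightarrow> h) F" by (rule filterlim_mono) (simp_all add: F_def)
    show "((\<lambda>m. b m p) \<longlongrightarrow> h p) F" for p
    proof (rule topological_tendstoI)
      fix U assume U: "open U" "h p \<in> U"
      have "open ((\<lambda>x :: 'p \<Rightarrow> complex. x p) -` U)"
        by (rule open_vimage[OF U(1) continuous_on_product_coordinates])
      from topological_tendstoD[OF lim this] U(2) show "\<forall>\<^sub>F m in F. b m p \<in> U" by simp
    qed
  qed
qed

text \<open>The difference of the two sides is additive and vanishes at the integers, so it is periodic and its bound
  on the unit interval is a bound everywhere. A bounded additive function is zero.\<close>

lemma additive_bounded_imp_homogeneous:
  fixes \<phi> :: "real \<Rightarrow> complex"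
  assumes add: "\<And>a b. \<phi> (a + b) = \<phi> a + \<phi> b" and bdd: "\<And>t. \<bar>t\<bar> \<le> 1 \<Longrightarrow> cmod (\<phi> t) \<le> M"
  shows "\<phi> t = of_real t * \<phi> 1"
proof -
  define \<psi> where "\<psi> t = \<phi> t - of_real t * \<phi> 1" for t
  have padd: "\<psi> (a + b) = \<psi> a + \<psi> b" for a b by (simp add: \<psi>_def add algebra_simps)
  have nat: "\<psi> (of_nat n * t) = of_nat n * \<psi> t" for n t
  proof (induction n)
    case 0
    show ?case using padd[of 0 0] by simp
  next
    case (Suc n)
    have "of_nat (Suc n) * t = t + of_nat n * t" by (simp add: algebra_simps)
    then show ?case by (simp only: padd Suc.IH) (simp add: algebra_simps)
  qed
  have one: "\<psi> 1 = 0" by (simp add: \<psi>_def)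
  have neg: "\<psi> (- a) = - \<psi> a" for a using padd[of a "- a"] padd[of 0 0] by (simp add: eq_neg_iff_add_eq_0 add.commute)
  have int: "\<psi> (of_int k) = 0" for k
  proof (cases k)
    case (nonneg n)
    then show ?thesis using nat[of n 1] one by simp
  next
    case (neg n)
    then show ?thesis using nat[of "Suc n" 1] one \<open>\<And>a. \<psi> (- a) = - \<psi> a\<close>[of "of_nat (Suc n)"] by simp
  qed
  have bd: "cmod (\<psi> t) \<le> 2 * M" for t
  proof -
    have M: "0 \<le> M" using bdd[of 0] norm_ge_zero order_trans by (metis abs_zero zero_le_one)
    have "\<psi> t = \<psi> (of_int \<lfloor>t\<rfloor>) + \<psi> (frac t)" using padd[of "of_int \<lfloor>t\<rfloor>" "frac t"] by (simp add: frac_def)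
    then have "\<psi> t = \<psi> (frac t)" by (simp add: int)
    then have "\<psi> t = \<phi> (frac t) - of_real (frac t) * \<phi> 1" by (simp only: \<psi>_def[of "frac t"])
    also have "cmod \<dots> \<le> cmod (\<phi> (frac t)) + frac t * cmod (\<phi> 1)"
      using norm_triangle_ineq4[of "\<phi> (frac t)" "of_real (frac t) * \<phi> 1"] frac_ge_0[of t] by (simp add: norm_mult)
    also have "\<dots> \<le> M + 1 * M"
      using bdd[of "frac t"] bdd[of 1] frac_ge_0[of t] frac_lt_1[of t] M by (intro add_mono mult_mono) auto
    finally show ?thesis by simp
  qed
  have "cmod (\<psi> t) = 0"
  proof (rule ccontr)
    assume "cmod (\<psi> t) \<noteq> 0"
    then have pos: "0 < cmod (\<psi> t)" by simp
    obtain n where "2 * M < real n * cmod (\<psi> t)" using reals_Archimedean3[OF pos] by blast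
    then show False using bd[of "of_nat n * t"] by (simp add: nat norm_mult)
  qed
  then show ?thesis by (simp add: \<psi>_def)
qed

locale asymptotic_embedding =
  fixes X :: "('h::chilbert_space \<Rightarrow>\<^sub>L 'h) set" and s :: "nat \<Rightarrow> ('h \<Rightarrow>\<^sub>L 'h) \<Rightarrow> ell2"
    and C t0 :: real and B :: "real \<Rightarrow> real"
  assumes opsp: "operator_space X"
    and additive: "x \<in> X \<Longrightarrow> y \<in> X \<Longrightarrow> (\<lambda>m. s m (x + y) - s m x - s m y) \<longlonglongrightarrow> 0"
    and imaginary: "x \<in> X \<Longrightarrow> (\<lambda>m. s m (\<i> *\<^sub>C x) - \<i> *\<^sub>C s m x) \<longlonglongrightarrow> 0"
    and bounded: "norm x \<le> t \<Longrightarrow> norm (s m x) \<le> B t"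
    and upper: "v \<in> Mat n X \<Longrightarrow> op_mnorm n v \<le> 1 \<Longrightarrow> \<forall>\<^sub>F m in sequentially. mnorm OH n (amp n (s m) v) \<le> C"
    and lower: "v \<in> Mat n X \<Longrightarrow> t0 \<le> op_mnorm n v \<Longrightarrow> \<forall>\<^sub>F m in sequentially. 1 / 2 \<le> mnorm OH n (amp n (s m) v)"
    and t0: "0 < t0"
begin

lemma sub: "csubspace X"
  using opsp by (simp add: operator_space_def)

lemma X_add: "x \<in> X \<Longrightarrow> y \<in> X \<Longrightarrow> x + y \<in> X" and X_scale: "x \<in> X \<Longrightarrow> c *\<^sub>C x \<in> X"
  using sub by (auto simp: complex_vector.subspace_def)

lemma X_scaleR: "x \<in> X \<Longrightarrow> r *\<^sub>R x \<in> X"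
  by (simp add: scaleR_scaleC X_scale)

text \<open>Asymptotic additivity and compatibility with \<open>\<i>\<close> become exact in the limit; compatibility with real
  scalars follows from additivity and boundedness. The lower bound for \<open>H\<close> comes from the lower bound
  for matrices of size one on the sphere of radius \<open>t0\<close>.\<close>

theorem limit_form:
  obtains H F where "inner_form X H" "F \<noteq> bot" "F \<le> sequentially"
    "\<And>x y. x \<in> X \<Longrightarrow> y \<in> X \<Longrightarrow> ((\<lambda>m. cinner (s m x) (s m y)) \<longlongrightarrow> H x y) F"
    "\<exists>c>0. \<forall>x\<in>X. c * (norm x)\<^sup>2 \<le> Re (H x x)" "\<exists>K. \<forall>x\<in>X. Re (H x x) \<le> K * (norm x)\<^sup>2"
proof -
  have B0: "0 \<le> B (norm x)" for x :: "'h \<Rightarrow>\<^sub>L 'h" using bounded[of x "norm x" 0] norm_ge_zero order_trans by blast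
  have le: "cmod (cinner (s m x) (s m y)) \<le> B (norm x) * B (norm y)" for m x y
    by (rule order_trans[OF cauchy_schwarz]) (intro mult_mono bounded order_refl B0 norm_ge_zero)
  obtain F h where F: "F \<noteq> bot" "F \<le> sequentially"
    and h: "\<And>p. ((\<lambda>m. cinner (s m (fst p)) (s m (snd p))) \<longlongrightarrow> h p) F"
    using bounded_family_convergent_filter[of "\<lambda>m p. cinner (s m (fst p)) (s m (snd p))" "\<lambda>p. B (norm (fst p)) * B (norm (snd p))"] le
    by metis
  define H where "H x y = h (x, y)" for x y
  have lim: "((\<lambda>m. cinner (s m x) (s m y)) \<longlongrightarrow> H x y) F" for x y
    using h[of "(x, y)"] by (simp add: H_def)
  have null: "((\<lambda>m. cinner (d m) (s m y)) \<longlongrightarrow> 0) F" if "d \<longlonglongrightarrow> 0" for d y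
  proof (rule Lim_null_comparison)
    have "((\<lambda>m. norm (d m) * B (norm y)) \<longlongrightarrow> 0 * B (norm y)) F"
      using that F(2) by (intro tendsto_intros tendsto_norm_zero) (rule tendsto_mono)
    then show "((\<lambda>m. norm (d m) * B (norm y)) \<longlongrightarrow> 0) F" by simp
    show "\<forall>\<^sub>F m in F. cmod (cinner (d m) (s m y)) \<le> norm (d m) * B (norm y)"
      by (intro always_eventually allI order_trans[OF cauchy_schwarz] mult_left_mono bounded) simp_all
  qed
  have uniq: "a = b" if "((\<lambda>m. p m) \<longlongrightarrow> a) F" "((\<lambda>m. q m) \<longlongrightarrow> b) F" "((\<lambda>m. p m - q m) \<longlongrightarrow> 0) F"
    for a b :: complex and p q
    using tendsto_unique[OF F(1) tendsto_diff[OF that(1,2)] that(3)] by simp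
  have Hadd: "H (x + y) z = H x z + H y z" if "x \<in> X" "y \<in> X" for x y z
    by (rule uniq[OF lim tendsto_add[OF lim lim]])
      (use null[OF additive[OF that], of z] in \<open>simp add: cinner_diff_left cinner_add_left diff_diff_add\<close>)
  have Hi: "H (\<i> *\<^sub>C x) y = \<i> * H x y" if "x \<in> X" for x y
    by (rule uniq[OF lim tendsto_mult_left[OF lim]])
      (use null[OF imaginary[OF that], of y] in \<open>simp add: cinner_diff_left cinner_scaleC_left\<close>)
  have HR: "H (r *\<^sub>R x) y = of_real r * H x y" if "x \<in> X" for r x y
  proof -
    have "H (r *\<^sub>R x) y = of_real r * H (1 *\<^sub>R x) y"
    proof (rule additive_bounded_imp_homogeneous[where \<phi> = "\<lambda>r. H (r *\<^sub>R x) y" and M = "B (norm x) * B (norm y)"])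
      show "H ((a + b) *\<^sub>R x) y = H (a *\<^sub>R x) y + H (b *\<^sub>R x) y" for a b
        unfolding scaleR_add_left by (intro Hadd X_scaleR that)
      fix t :: real assume "\<bar>t\<bar> \<le> 1"
      then have "norm (t *\<^sub>R x) \<le> norm x" using mult_right_mono[of "\<bar>t\<bar>" 1 "norm x"] by simp
      then have "cmod (cinner (s m (t *\<^sub>R x)) (s m y)) \<le> B (norm x) * B (norm y)" for m
        by (intro order_trans[OF cauchy_schwarz] mult_mono bounded B0) simp_all
      then show "cmod (H (t *\<^sub>R x) y) \<le> B (norm x) * B (norm y)"
        by (intro tendsto_upperbound[OF tendsto_norm[OF lim[of "t *\<^sub>R x" y]] _ F(1)] always_eventually) blast
    qed
    then show ?thesis by simp
  qed
  have Hscale: "H (c *\<^sub>C x) y = c * H x y" if "x \<in> X" for c x y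
  proof -
    have "c *\<^sub>C x = Re c *\<^sub>R x + \<i> *\<^sub>C (Im c *\<^sub>R x)"
      by (simp add: scaleR_scaleC scaleC_scaleC flip: scaleC_add_left complex_eq)
    then have "H (c *\<^sub>C x) y = (of_real (Re c) + \<i> * of_real (Im c)) * H x y"
      using that by (simp add: Hadd X_scaleR X_scale Hi HR distrib_right mult.assoc)
    then show ?thesis by (simp flip: complex_eq)
  qed
  have Hcomm: "H x y = cnj (H y x)" for x y
    using tendsto_unique[OF F(1) lim[of x y]] tendsto_cnj[OF lim[of y x]] by (simp flip: cinner_commute)
  have ReH: "((\<lambda>m. (norm (s m x))\<^sup>2) \<longlongrightarrow> Re (H x x)) F" for x
    using tendsto_Re[OF lim[of x x]] by (simp add: norm_sq_cinner)
  have H0: "0 \<le> Re (H x x)" for x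
    by (rule tendsto_lowerbound[OF ReH _ F(1)]) simp
  have sq: "Re (H (r *\<^sub>R x) (r *\<^sub>R x)) = r\<^sup>2 * Re (H x x)" if "x \<in> X" for r x
    using HR[OF that, of r "r *\<^sub>R x"] Hcomm[of x "r *\<^sub>R x"] HR[OF that, of r x] Hcomm[of x x]
    by (simp add: power2_eq_square)
  have unit_upper: "Re (H x x) \<le> (B 1)\<^sup>2" if "norm x \<le> 1" for x
    using bounded[OF that] by (intro tendsto_upperbound[OF ReH _ F(1)] always_eventually allI power_mono) auto
  have unit_lower: "(1 / (2 * exp 1))\<^sup>2 \<le> Re (H x x)" if "x \<in> X" "norm x = t0" for x
  proof (rule tendsto_lowerbound[OF ReH _ F(1)])
    have e: "entry x \<in> Mat 1 X" using that by (simp add: entry_def Mat_def)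
    have "op_mnorm 1 (entry x) = t0" using that norm1_opsp[of UNIV x] by (simp add: norm1_def opsp_def)
    then have "\<forall>\<^sub>F m in F. 1 / 2 \<le> mnorm OH 1 (amp 1 (s m) (entry x))"
      using lower[OF e] F(2) by (simp add: filter_leD)
    then show "\<forall>\<^sub>F m in F. (1 / (2 * exp 1))\<^sup>2 \<le> (norm (s m x))\<^sup>2"
    proof eventually_elim
      case (elim m)
      have "mnorm OH 1 (amp 1 (s m) (entry x)) \<le> exp 1 * norm (s m x)"
        using OH_le_sum[OF amp_in_Mat, of 1 "s m" "entry x"] by (simp add: amp_def entry_def)
      then have "1 / (2 * exp 1) \<le> norm (s m x)" using elim by (simp add: field_simps)
      then show ?case by (intro power_mono) auto
    qed
  qed
  have upperH: "Re (H x x) \<le> (B 1)\<^sup>2 * (norm x)\<^sup>2" if "x \<in> X" for x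
  proof (cases "x = 0")
    case True
    then show ?thesis using sq[OF that, of 0] by simp
  next
    case False
    have "Re (H (inverse (norm x) *\<^sub>R x) (inverse (norm x) *\<^sub>R x)) \<le> (B 1)\<^sup>2"
      using False by (intro unit_upper) simp
    then show ?thesis using False by (simp add: sq[OF that] field_simps)
  qed
  define c where "c = (1 / (2 * exp 1 * t0))\<^sup>2"
  have c: "0 < c" using t0 by (simp add: c_def)
  have lowerH: "c * (norm x)\<^sup>2 \<le> Re (H x x)" if "x \<in> X" for x
  proof (cases "x = 0")
    case False
    have "(1 / (2 * exp 1))\<^sup>2 \<le> Re (H ((t0 / norm x) *\<^sub>R x) ((t0 / norm x) *\<^sub>R x))"
      using False t0 that by (intro unit_lower X_scaleR) simp_all
    then show ?thesis using False t0 by (simp add: sq[OF that] c_def field_simps)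
  qed (use H0 in simp)
  have "inner_form X H"
  proof
    show "x = 0" if "x \<in> X" "Re (H x x) = 0" for x
    proof -
      have "(norm x)\<^sup>2 \<le> 0" using lowerH[OF that(1)] that(2) c by (simp add: mult_le_0_iff)
      then show ?thesis by simp
    qed
    show "csubspace X" by (rule sub)
    show "H x y = cnj (H y x)" for x y by (rule Hcomm)
    show "0 \<le> Re (H x x)" for x by (rule H0)
  qed (simp_all add: Hadd Hscale)
  then show ?thesis using F lim c lowerH upperH by (rule_tac that[of H F]) blast+
qed

end

section \<open>Orthonormal coordinates and separability\<close>

text \<open>The dense sequence is orthonormalised and its zero entries are dropped; infinitely many entries
  remain, since otherwise \<open>X\<close> would be the span of finitely many vectors. The best approximation property
  of projections gives Parseval's identity, and completeness of \<open>X\<close> gives surjectivity.\<close>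

lemma hilbert_coordinates:
  fixes X :: "'a::{complex_normed_vector,banach} set" and w :: "nat \<Rightarrow> 'a"
  assumes form: "inner_form X H" and cl: "closed X" and inf: "infinite_dimensional X"
    and c: "0 < c" and lower: "\<And>x. x \<in> X \<Longrightarrow> c * (norm x)\<^sup>2 \<le> Re (H x x)"
    and upper: "\<And>x. x \<in> X \<Longrightarrow> Re (H x x) \<le> K * (norm x)\<^sup>2"
    and w: "\<And>n. w n \<in> X" and dense: "X \<subseteq> closure (cspan (range w))"
  obtains G :: "'a \<Rightarrow> ell2" where "\<And>x y. x \<in> X \<Longrightarrow> y \<in> X \<Longrightarrow> G (x + y) = G x + G y"
    "\<And>c x. x \<in> X \<Longrightarrow> G (c *\<^sub>C x) = c *\<^sub>C G x"
    "\<And>x y. x \<in> X \<Longrightarrow> y \<in> X \<Longrightarrow> cinner (G x) (G y) = H x y" "G ` X = UNIV"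
proof -
  interpret inner_form X H by (rule form)
  define e' where "e' = gram_schmidt w"
  note gs = gram_schmidt_onseq[of w, OF w, folded e'_def]
  have e'X: "e' k \<in> X" for k using gs(1) by (simp add: onseq_def)
  have mono: "cspan (e' ` {..<M}) \<subseteq> cspan (e' ` {..<N})" if "M \<le> N" for M N
    using that by (intro complex_vector.span_mono) auto
  have fin: "\<exists>N. y \<in> cspan (e' ` {..<N})" if "y \<in> cspan (range w)" for y
    using that
  proof (induction y rule: complex_vector.span_induct_alt)
    case base
    show ?case by (auto intro: complex_vector.span_zero)
  next
    case (step a u y)
    obtain k where k: "u = w k" using step by blast
    obtain N where N: "y \<in> cspan (e' ` {..<N})" using step by blast
    have "{..k} = {..<Suc k}" by auto
    then have "w k \<in> cspan (e' ` {..<max (Suc k) N})" using gs(2)[of k] mono[of "Suc k" "max (Suc k) N"] by auto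
    moreover have "y \<in> cspan (e' ` {..<max (Suc k) N})" using N mono[of N "max (Suc k) N"] by auto
    ultimately have "a *\<^sub>C u + y \<in> cspan (e' ` {..<max (Suc k) N})"
      unfolding k by (intro complex_vector.span_add complex_vector.span_scale)
    then show ?case by blast
  qed
  define res where "res x N = Re (H (x - proj e' N x) (x - proj e' N x))" for x N
  have res: "res x N = Re (H x x) - (\<Sum>k<N. (cmod (H x (e' k)))\<^sup>2)" if "x \<in> X" for x N
    using bessel_eq[OF gs(1) that, of N] by (simp add: res_def)
  have res0: "0 \<le> res x N" if "x \<in> X" for x N
    unfolding res_def using e'X that by (intro nonneg diff_mem proj_mem)
  have res_mono: "res x N \<le> res x M" if "x \<in> X" "M \<le> N" for x M N
    unfolding res[OF that(1)] using that(2) by (intro diff_left_mono sum_mono2) auto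
  have res_lim: "res x \<longlonglongrightarrow> 0" if x: "x \<in> X" for x
  proof (rule LIMSEQ_I)
    fix r :: real assume r: "0 < r"
    define d where "d = sqrt (r / (\<bar>K\<bar> + 1))"
    have d: "0 < d" "(\<bar>K\<bar> + 1) * d\<^sup>2 = r" using r by (auto simp: d_def)
    obtain y where y: "y \<in> cspan (range w)" "norm (x - y) < d"
      using dense x d(1) closure_approachable[of x "cspan (range w)"] by (auto simp: dist_norm norm_minus_commute)
    obtain N where N: "y \<in> cspan (e' ` {..<N})" using fin[OF y(1)] by blast
    have yX: "y \<in> X"
      using N complex_vector.span_minimal[OF _ subspace, of "e' ` {..<N}"] e'X by auto
    have "res x N \<le> Re (H (x - y) (x - y))"
      unfolding res_def by (rule best_approximation[OF gs(1) x N])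
    also have "\<dots> \<le> K * (norm (x - y))\<^sup>2" using x yX by (intro upper diff_mem)
    also have "\<dots> \<le> (\<bar>K\<bar> + 1) * (norm (x - y))\<^sup>2" by (intro mult_right_mono) auto
    also have "\<dots> < (\<bar>K\<bar> + 1) * d\<^sup>2" using y(2) by (intro mult_strict_left_mono power_strict_mono) auto
    finally have "res x N < r" using d(2) by simp
    then have "norm (res x n - 0) < r" if "N \<le> n" for n
      using res_mono[OF x that] res0[OF x, of n] by simp
    then show "\<exists>N. \<forall>n\<ge>N. norm (res x n - 0) < r" by blast
  qed
  have parseval': "(\<lambda>k. (cmod (H x (e' k)))\<^sup>2) sums Re (H x x)" if "x \<in> X" for x
    using tendsto_diff[OF tendsto_const res_lim[OF that], of "Re (H x x)"] unfolding sums_def by (simp add: res[OF that])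
  define S where "S = {i. e' i \<noteq> 0}"
  have S: "infinite S"
  proof
    assume "finite S"
    then obtain N where N: "\<And>i. N \<le> i \<Longrightarrow> e' i = 0" unfolding S_def
      by (metis (mono_tags, lifting) finite_nat_iff_bounded lessThan_iff linorder_not_less mem_Collect_eq subset_eq)
    have "x \<in> cspan (e' ` {..<N})" if x: "x \<in> X" for x
    proof -
      have "res x n = res x N" if "N \<le> n" for n
      proof -
        have "(\<Sum>k<n. (cmod (H x (e' k)))\<^sup>2) = (\<Sum>k<N. (cmod (H x (e' k)))\<^sup>2)"
          using that N zero_right[OF x] by (intro sum.mono_neutral_right) auto
        then show ?thesis by (simp add: res[OF x])
      qed
      then have "\<forall>\<^sub>F n in sequentially. res x n = res x N" unfolding eventually_sequentially by blast
      then have "(res x \<longlongrightarrow> res x N) sequentially" by (rule tendsto_eventually)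
      then have r0: "res x N = 0" by (rule LIMSEQ_unique[OF _ res_lim[OF x]])
      have "x - proj e' N x = 0"
        by (rule definite[OF diff_mem[OF x proj_mem[OF e'X]] r0[unfolded res_def]])
      then show ?thesis using proj_span[of e' N x] by simp
    qed
    then show False using inf unfolding infinite_dimensional_def by (metis finite_imageI finite_lessThan subsetI)
  qed
  define e where "e = e' \<circ> enumerate S"
  have eX: "e k \<in> X" for k by (simp add: e_def e'X)
  have on: "H (e i) (e j) = (if j = i then 1 else 0)" for i j
  proof (cases "i = j")
    case True
    have "e' (enumerate S i) \<noteq> 0" using enumerate_in_set[OF S, of i] by (simp add: S_def)
    then show ?thesis using gs(1) True by (auto simp: onseq_def e_def)
  next
    case False
    then have "enumerate S i \<noteq> enumerate S j" using strict_mono_enumerate[OF S] by (simp add: strict_mono_eq)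
    then show ?thesis using gs(1) False by (simp add: onseq_def e_def)
  qed
  have parseval: "(\<lambda>k. (cmod (H x (e k)))\<^sup>2) sums Re (H x x)" if "x \<in> X" for x
  proof -
    have "(\<lambda>k. (cmod (H x (e' (enumerate S k))))\<^sup>2) sums Re (H x x) \<longleftrightarrow> (\<lambda>k. (cmod (H x (e' k)))\<^sup>2) sums Re (H x x)"
    proof (rule sums_mono_reindex[OF strict_mono_enumerate[OF S]])
      show "(cmod (H x (e' n)))\<^sup>2 = 0" if "n \<notin> range (enumerate S)" for n
        using that range_enumerate[OF S] zero_right[OF \<open>x \<in> X\<close>] by (auto simp: S_def)
    qed
    then show ?thesis using parseval'[OF that] by (simp add: e_def)
  qed
  define G where "G x = Abs_ell2 (\<lambda>k. H x (e k))" for x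
  have coordG: "coord (G x) k = H x (e k)" if "x \<in> X" for x k
    unfolding G_def by (rule coord_Abs_ell2[of "\<lambda>k. H x (e k)", THEN fun_cong, OF sums_summable[OF parseval[OF that]]])
  have normG: "(norm (G x))\<^sup>2 = Re (H x x)" if "x \<in> X" for x
    using sums_unique[OF parseval[OF that]] nonneg[OF that] by (simp add: norm_ell2_def coordG[OF that])
  have Gadd: "G (x + y) = G x + G y" if "x \<in> X" "y \<in> X" for x y
    by (rule ell2_eqI) (simp add: coordG that add_mem add_left eX)
  have Gscale: "G (a *\<^sub>C x) = a *\<^sub>C G x" if "x \<in> X" for a x
    by (rule ell2_eqI) (simp add: coordG that scale_mem scale_left eX)
  have GRe: "Re (cinner (G x) (G y)) = Re (H x y)" if "x \<in> X" "y \<in> X" for x y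
  proof -
    have "(norm (G x + G y))\<^sup>2 = Re (H (x + y) (x + y))"
      using normG[OF add_mem[OF that]] by (simp add: Gadd that)
    also have "\<dots> = Re (H x x) + 2 * Re (H x y) + Re (H y y)"
      using that commute[OF that] by (simp add: add_left add_right add_mem)
    finally show ?thesis using norm_add_sq[of "G x" "G y"] normG that by simp
  qed
  have Ginner: "cinner (G x) (G y) = H x y" if "x \<in> X" "y \<in> X" for x y
  proof (rule complex_eqI)
    show "Re (cinner (G x) (G y)) = Re (H x y)" by (rule GRe[OF that])
    show "Im (cinner (G x) (G y)) = Im (H x y)"
      using GRe[OF that(1) scale_mem[OF that(2), of \<i>]] that by (simp add: Gscale cinner_scaleC_right scale_right)
  qed
  have "u \<in> G ` X" for u
  proof -
    define p where "p N = (\<Sum>k<N. coord u k *\<^sub>C e k)" for N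
    have pX: "p N \<in> X" for N unfolding p_def by (intro sum_mem scale_mem eX)
    have Gp: "G (p N) = (\<Sum>k<N. coord u k *\<^sub>C ket k)" for N
      by (rule ell2_eqI) (simp add: coordG[OF pX], simp add: p_def sum_left scale_mem eX scale_left on coord_sum cong: if_cong)
    have Glim: "(\<lambda>N. G (p N)) \<longlonglongrightarrow> u"
      using ell2_sums_ket[of u] by (simp add: sums_def Gp)
    have Gdiff: "G (x - y) = G x - G y" if "x \<in> X" "y \<in> X" for x y
      using Gadd[OF diff_mem[OF that] that(2)] by simp
    have "Cauchy p"
    proof (rule metric_CauchyI)
      fix r :: real assume r: "0 < r"
      then have "0 < sqrt c * r" using c by simp
      then obtain M where M: "\<And>m n. m \<ge> M \<Longrightarrow> n \<ge> M \<Longrightarrow> dist (G (p m)) (G (p n)) < sqrt c * r"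
        using metric_CauchyD[OF LIMSEQ_imp_Cauchy[OF Glim]] by meson
      have "dist (p m) (p n) < r" if "m \<ge> M" "n \<ge> M" for m n
      proof -
        have "c * (norm (p m - p n))\<^sup>2 \<le> (norm (G (p m) - G (p n)))\<^sup>2"
          using lower[OF diff_mem[OF pX pX]] normG[OF diff_mem[OF pX pX]] by (simp add: Gdiff pX)
        also have "\<dots> < (sqrt c * r)\<^sup>2" using M[OF that] by (intro power_strict_mono) (auto simp: dist_norm)
        also have "\<dots> = c * r\<^sup>2" using c by (simp add: power_mult_distrib)
        finally have "(norm (p m - p n))\<^sup>2 < r\<^sup>2" using c by simp
        then show ?thesis using r by (simp add: dist_norm power2_less_imp_less)
      qed
      then show "\<exists>M. \<forall>m\<ge>M. \<forall>n\<ge>M. dist (p m) (p n) < r" by blast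
    qed
    then obtain x where x: "p \<longlonglongrightarrow> x" using Cauchy_convergent convergent_def by blast
    then have xX: "x \<in> X" using closed_sequentially[OF cl] pX by blast
    have "(\<lambda>N. (norm (G (p N) - G x))\<^sup>2) \<longlonglongrightarrow> 0"
    proof (rule tendsto_sandwich[OF _ _ tendsto_const])
      have "(\<lambda>N. K * (norm (p N - x))\<^sup>2) \<longlonglongrightarrow> K * 0\<^sup>2"
        using x by (intro tendsto_intros tendsto_norm_zero) (simp add: LIM_zero)
      then show "(\<lambda>N. K * (norm (p N - x))\<^sup>2) \<longlonglongrightarrow> 0" by simp
      show "\<forall>\<^sub>F N in sequentially. (norm (G (p N) - G x))\<^sup>2 \<le> K * (norm (p N - x))\<^sup>2"
        using upper[OF diff_mem[OF pX xX]] normG[OF diff_mem[OF pX xX]] by (simp add: Gdiff pX xX)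
    qed simp
    then have "(\<lambda>N. sqrt ((norm (G (p N) - G x))\<^sup>2)) \<longlonglongrightarrow> sqrt 0" by (rule tendsto_real_sqrt)
    then have "(\<lambda>N. G (p N)) \<longlonglongrightarrow> G x" by (simp add: LIM_zero_iff tendsto_norm_zero_iff)
    then have "u = G x" using LIMSEQ_unique[OF Glim] by blast
    then show ?thesis using xX by blast
  qed
  then have "G ` X = UNIV" by blast
  then show ?thesis using Gadd Gscale Ginner by (rule_tac that[of G]) blast+
qed

lemma ell2_dense_sequence:
  obtains d :: "nat \<Rightarrow> ell2" where "\<And>u r. 0 < r \<Longrightarrow> \<exists>k. norm (u - d k) < r"
proof -
  obtain Q :: "complex set" where Q: "countable Q" "\<And>U. open U \<Longrightarrow> U \<noteq> {} \<Longrightarrow> \<exists>q\<in>Q. q \<in> U"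
    using countable_dense_setE by blast
  define D where "D = (\<Union>n. (\<lambda>q. \<Sum>j<n. q j *\<^sub>C ket j) ` PiE {..<n} (\<lambda>_. Q))"
  have D: "countable D" unfolding D_def using Q(1) by (intro countable_UN countable_image countable_PiE) auto
  have near: "\<exists>v\<in>D. norm (u - v) < r" if r: "0 < r" for u r
  proof -
    have "\<forall>\<^sub>F n in sequentially. dist (\<Sum>j<n. coord u j *\<^sub>C ket j) u < r / 2"
      using ell2_sums_ket[of u] r unfolding sums_def by (intro tendstoD) auto
    then obtain n where n: "norm ((\<Sum>j<n. coord u j *\<^sub>C ket j) - u) < r / 2"
      by (auto simp: eventually_sequentially dist_norm)
    define t where "t = r / (2 * (real n + 1))"
    have t: "0 < t" using r by (simp add: t_def)
    have "\<exists>q\<in>Q. q \<in> ball (coord u j) t" for j using t by (intro Q(2)) auto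
    then obtain q where q: "\<And>j. q j \<in> Q" "\<And>j. dist (coord u j) (q j) < t" by (metis mem_ball)
    let ?v = "\<Sum>j<n. restrict q {..<n} j *\<^sub>C ket j"
    have "?v \<in> D" unfolding D_def using q(1) by (intro UN_I[of n] imageI restrict_PiE_iff[THEN iffD2]) auto
    moreover have "norm ((\<Sum>j<n. coord u j *\<^sub>C ket j) - ?v) \<le> r / 2"
    proof -
      have "(\<Sum>j<n. coord u j *\<^sub>C ket j) - ?v = (\<Sum>j<n. (coord u j - q j) *\<^sub>C ket j)"
        by (simp add: sum_subtractf complex_vector.scale_left_diff_distrib)
      also have "norm \<dots> \<le> (\<Sum>j<n. t)"
        using q(2) by (intro order_trans[OF norm_sum] sum_mono) (simp add: norm_scaleC dist_norm less_imp_le)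
      also have "\<dots> \<le> r / 2" using r by (simp add: t_def field_simps)
      finally show ?thesis .
    qed
    moreover have "norm (u - ?v) \<le> norm ((\<Sum>j<n. coord u j *\<^sub>C ket j) - u) + norm ((\<Sum>j<n. coord u j *\<^sub>C ket j) - ?v)"
      using norm_triangle_ineq4[of "(\<Sum>j<n. coord u j *\<^sub>C ket j) - ?v" "(\<Sum>j<n. coord u j *\<^sub>C ket j) - u"] by simp
    ultimately show ?thesis using n by (intro bexI[of _ ?v]) auto
  qed
  then have "D \<noteq> {}" using zero_less_one by blast
  then show ?thesis
    using near D by (intro that[of "from_nat_into D"]) (metis from_nat_into_surj)
qed

context coarse_into_OH
begin

text \<open>A coarse embedding separates points that are far apart, so a countable dense subset of the sequence
  space yields countable nets of one fixed mesh in all balls of \<open>X\<close>; scaling makes the mesh small.\<close>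

lemma dense_sequence:
  obtains w :: "nat \<Rightarrow> 'h \<Rightarrow>\<^sub>L 'h" where "\<And>n. w n \<in> X" "X \<subseteq> closure (cspan (range w))"
proof -
  obtain t0 where t0: "0 < t0" "\<And>n m x y. x \<in> Mat n X \<Longrightarrow> y \<in> Mat n X \<Longrightarrow> n \<le> m \<Longrightarrow> 1 \<le> m \<Longrightarrow>
      op_mnorm n x \<le> m \<Longrightarrow> op_mnorm n y \<le> m \<Longrightarrow> t0 \<le> op_mnorm n (x - y) \<Longrightarrow>
      1 \<le> mnorm OH n (amp n (g m) x - amp n (g m) y)" using g_compression by blast
  \<comment> \<open>The constant \<open>exp 1\<close> is the one in the upper bound for the norm of a matrix over OH.\<close>
  define \<delta> :: real where "\<delta> = inverse (exp 1)"
  have \<delta>: "0 < \<delta>" by (simp add: \<delta>_def)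
  have sep: "norm (x - y) < t0" if "x \<in> X" "y \<in> X" "1 \<le> m" "norm x \<le> real m" "norm y \<le> real m"
    "norm (g m x - g m y) < \<delta>" for x y m
  proof (rule ccontr)
    assume "\<not> ?thesis"
    then have far: "t0 \<le> op_mnorm 1 (entry x - entry y)" unfolding entry_diff op_mnorm_entry by simp
    have "1 \<le> mnorm OH 1 (amp 1 (g m) (entry x) - amp 1 (g m) (entry y))"
      using that far by (intro t0(2) entry_Mat) (simp_all only: op_mnorm_entry)
    also have "\<dots> \<le> exp 1 * norm (g m x - g m y)"
      unfolding amp_entry entry_diff using OH_le_sum[of "entry (g m x - g m y)" 1] by (simp add: entry_def Mat_def)
    also have "\<dots> < exp 1 * \<delta>" using that(6) by (intro mult_strict_left_mono) auto
    finally show False by (simp add: \<delta>_def)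
  qed
  obtain d :: "nat \<Rightarrow> ell2" where d: "\<And>u r. 0 < r \<Longrightarrow> \<exists>k. norm (u - d k) < r" using ell2_dense_sequence by blast
  define ok where "ok m k x \<longleftrightarrow> x \<in> X \<and> norm x \<le> real m \<and> norm (g m x - d k) < \<delta> / 2" for m k x
  define pick where "pick m k = (if \<exists>x. ok m k x then SOME x. ok m k x else 0)" for m k
  have pick: "ok m k (pick m k)" if "ok m k x" for m k x
    using that someI_ex[of "ok m k"] by (auto simp: pick_def)
  have pickX: "pick m k \<in> X" for m k
  proof (cases "\<exists>x. ok m k x")
    case True
    then show ?thesis using pick ok_def by blast
  next
    case False
    then show ?thesis using X_zero by (simp only: pick_def if_False)
  qed
  define w where "w n = pick (fst (prod_decode n)) (snd (prod_decode n))" for n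
  have "x \<in> closure (cspan (range w))" if x: "x \<in> X" for x
    unfolding closure_approachable
  proof (intro allI impI)
    fix r :: real assume r: "0 < r"
    obtain k :: nat where k: "t0 / r < real k" using reals_Archimedean2 by blast
    have k0: "0 < real k" using k t0(1) r by (meson divide_pos_pos less_trans)
    obtain m :: nat where m: "real k * norm x + 1 \<le> real m" using real_arch_simple by blast
    have m1: "1 \<le> m" "norm (real k *\<^sub>R x) \<le> real m"
    proof -
      have "1 \<le> real m" using m mult_nonneg_nonneg[OF less_imp_le[OF k0] norm_ge_zero[of x]] by linarith
      then show "1 \<le> m" by simp
      show "norm (real k *\<^sub>R x) \<le> real m" using m by simp
    qed
    obtain j where j: "norm (g m (real k *\<^sub>R x) - d j) < \<delta> / 2" using d[of "\<delta> / 2"] \<delta> by auto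
    have okx: "ok m j (real k *\<^sub>R x)" using j m1 x by (simp add: ok_def X_scaleR)
    define p where "p = pick m j"
    have p: "ok m j p" using pick[OF okx] by (simp add: p_def)
    have "norm (g m p - g m (real k *\<^sub>R x)) \<le> norm (g m p - d j) + norm (g m (real k *\<^sub>R x) - d j)"
      using norm_triangle_ineq4[of "g m p - d j" "g m (real k *\<^sub>R x) - d j"] by simp
    also have "\<dots> < \<delta>" using p j by (simp add: ok_def)
    finally have "norm (p - real k *\<^sub>R x) < t0"
      using p okx m1 by (intro sep[of _ _ m]) (auto simp: ok_def)
    moreover have "p - real k *\<^sub>R x = real k *\<^sub>R ((1 / real k) *\<^sub>R p - x)" using k0 by (simp add: scaleR_diff_right)
    ultimately have "real k * norm ((1 / real k) *\<^sub>R p - x) < t0" by simp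
    also have "t0 < real k * r" using k r by (simp add: field_simps)
    finally have "dist ((1 / real k) *\<^sub>R p) x < r" using k0 by (simp add: dist_norm)
    moreover have "p = w (prod_encode (m, j))" by (simp add: w_def p_def)
    then have "(1 / real k) *\<^sub>R p \<in> cspan (range w)"
      unfolding scaleR_scaleC by (intro complex_vector.span_scale complex_vector.span_base) blast
    ultimately show "\<exists>y\<in>cspan (range w). dist y x < r" by blast
  qed
  then show ?thesis using pickX by (intro that[of w]) (auto simp: w_def)
qed

end


section \<open>Comparison of the matrix norms\<close>

lemma completely_boundedI:
  assumes "clinear_between (carr E) (carr F) f"
    and "\<And>n x. 1 \<le> n \<Longrightarrow> x \<in> mball E n 1 \<Longrightarrow> mnorm F n (amp n f x) \<le> K"
  shows "completely_bounded E F f"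
proof -
  have "(SUP n\<in>{1..}. SUP x\<in>mball E n 1. ereal (mnorm F n (amp n f x))) \<le> ereal K"
    using assms(2) by (intro SUP_least) auto
  then show ?thesis using assms(1) by (auto simp: completely_bounded_def)
qed

theorem corollary1p5:
  fixes X :: "('h::chilbert_space \<Rightarrow>\<^sub>L 'h) set"
  assumes "operator_space X"
    and "infinite_dimensional X"
    and "almost_completely_coarsely_embed (opsp X) OH"
  shows "completely_isomorphic (opsp X) OH"
proof -
  obtain f where "equi_coarse_embedding
        (\<lambda>n. mball (opsp X) n (real n)) (\<lambda>n x y. mnorm (opsp X) n (x - y))
        (\<lambda>n. Mat n (carr OH)) (\<lambda>n x y. mnorm OH n (x - y)) (\<lambda>n. amp n (f n))"
    using assms(3) unfolding almost_completely_coarsely_embed_def by blast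
  then interpret A: coarse_into_OH X f by unfold_locales (rule assms(1))
  obtain t0 where t0: "0 < t0"
    "\<And>n x. x \<in> Mat n X \<Longrightarrow> t0 \<le> op_mnorm n x \<Longrightarrow> \<forall>\<^sub>F m in sequentially. 1 / 2 \<le> mnorm OH n (amp n (A.s m) x)"
    using A.amp_s_lower by blast
  interpret B: asymptotic_embedding X A.s "2 * A.W 1" t0 "\<lambda>t. 2 * A.W t"
    by unfold_locales (fact assms(1) A.s_additive A.s_imaginary A.norm_s_le A.amp_s_upper t0)+
  obtain H F where H: "inner_form X H" and F: "F \<noteq> bot" "F \<le> sequentially"
    and lim: "\<And>x y. x \<in> X \<Longrightarrow> y \<in> X \<Longrightarrow> ((\<lambda>m. cinner (A.s m x) (A.s m y)) \<longlongrightarrow> H x y) F"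
    and bounds: "\<exists>c>0. \<forall>x\<in>X. c * (norm x)\<^sup>2 \<le> Re (H x x)" "\<exists>K. \<forall>x\<in>X. Re (H x x) \<le> K * (norm x)\<^sup>2"
    using B.limit_form by blast
  obtain c K where c: "0 < c" "\<And>x. x \<in> X \<Longrightarrow> c * (norm x)\<^sup>2 \<le> Re (H x x)"
    and K: "\<And>x. x \<in> X \<Longrightarrow> Re (H x x) \<le> K * (norm x)\<^sup>2" using bounds by blast
  obtain w :: "nat \<Rightarrow> 'h \<Rightarrow>\<^sub>L 'h" where w: "\<And>n. w n \<in> X" "X \<subseteq> closure (cspan (range w))" using A.dense_sequence by blast
  have cl: "closed X" using assms(1) by (simp add: operator_space_def)
  obtain G :: "('h \<Rightarrow>\<^sub>L 'h) \<Rightarrow> ell2" where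
      Gadd: "\<And>x y. x \<in> X \<Longrightarrow> y \<in> X \<Longrightarrow> G (x + y) = G x + G y"
    and Gscale: "\<And>c x. x \<in> X \<Longrightarrow> G (c *\<^sub>C x) = c *\<^sub>C G x"
    and Ginner: "\<And>x y. x \<in> X \<Longrightarrow> y \<in> X \<Longrightarrow> cinner (G x) (G y) = H x y" and Gsurj: "G ` X = UNIV"
    using hilbert_coordinates[OF H cl assms(2) c K w] by metis
  interpret H: inner_form X H by (rule H)
  have Gdiff: "G (x - y) = G x - G y" if "x \<in> X" "y \<in> X" for x y
    using Gadd[OF H.diff_mem[OF that] that(2)] by simp
  have Ginj: "inj_on G X"
  proof (rule inj_onI)
    fix x y assume xy: "x \<in> X" "y \<in> X" "G x = G y"
    have "x - y = 0"
      using Ginner[of "x - y" "x - y"] xy by (intro H.definite H.diff_mem) (simp_all add: Gdiff H.diff_mem cinner_zero_left)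
    then show "x = y" by simp
  qed
  have entries: "x i j \<in> X" if "x \<in> Mat n X" "i < n" "j < n" for x i j n
    using that by (simp add: Mat_def)
  \<comment> \<open>The Gram matrices of the entries of \<open>s m x\<close> converge to that of the entries of \<open>G x\<close>, which
    transports the norm estimates for \<open>s m\<close> to \<open>G\<close>.\<close>
  have gram: "((\<lambda>m. cinner (amp n (A.s m) x i j) (amp n (A.s m) x k l)) \<longlongrightarrow> cinner (amp n G x i j) (amp n G x k l)) F"
    if "x \<in> Mat n X" "i < n" "j < n" "k < n" "l < n" for x n i j k l
    using that lim[OF entries entries] by (simp add: amp_def Ginner entries)
  have upper: "mnorm OH n (amp n G x) \<le> 2 * A.W 1" if x: "x \<in> Mat n X" "op_mnorm n x \<le> 1" for n x
    by (rule OH_gram_tendsto(1)[OF amp_in_Mat amp_in_Mat F(1) gram[OF x(1)]])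
      (use B.upper[OF x] F(2) in \<open>auto intro: filter_leD\<close>)
  have lower: "1 / 2 \<le> mnorm OH n (amp n G x)" if x: "x \<in> Mat n X" "t0 \<le> op_mnorm n x" for n x
    by (rule OH_gram_tendsto(2)[OF amp_in_Mat amp_in_Mat F(1) gram[OF x(1)]])
      (use B.lower[OF x] F(2) in \<open>auto intro: filter_leD\<close>)
  let ?G' = "inv_into X G"
  have G': "?G' u \<in> X" "G (?G' u) = u" for u
    using Gsurj by (auto intro: inv_into_into f_inv_into_f)
  have G'eq: "?G' u = x" if "x \<in> X" "G x = u" for u x
    using inv_into_f_f[OF Ginj that(1)] that(2) by simp
  have inverse: "op_mnorm n (amp n ?G' u) \<le> 2 * t0" if u: "u \<in> Mat n UNIV" "mnorm OH n u \<le> 1" for n u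
  proof (rule ccontr)
    let ?x = "amp n ?G' u" and ?r = "op_mnorm n (amp n ?G' u)"
    assume "\<not> ?r \<le> 2 * t0"
    then have r: "2 * t0 < ?r" "0 < ?r" using t0(1) by linarith+
    \<comment> \<open>The lower estimate holds for matrices of norm at least \<open>t0\<close>, so the preimage is scaled to norm \<open>t0\<close>.\<close>
    let ?c = "complex_of_real (t0 / ?r)"
    have xM: "?x \<in> Mat n X" using G' by (simp add: Mat_def amp_def)
    have "cmod ?c * ?r = t0" using r t0(1) by (simp only: norm_of_real) simp
    then have "t0 \<le> op_mnorm n (?c *\<^sub>C ?x)" unfolding op_mnorm_scaleC by simp
    then have "1 / 2 \<le> mnorm OH n (amp n G (?c *\<^sub>C ?x))" by (intro lower A.Mat_linear xM)
    also have "amp n G (?c *\<^sub>C ?x) = ?c *\<^sub>C u"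
      using Mat_zero[OF u(1)] G' by (auto simp: amp_def fun_eq_iff scaleC_fun_def Gscale)
    also have "mnorm OH n (?c *\<^sub>C u) \<le> cmod ?c * mnorm OH n u"
      using r t0(1) by (intro OH_scale_le u) auto
    also have "\<dots> \<le> cmod ?c * 1" using u(2) by (intro mult_left_mono) auto
    also have "\<dots> = t0 / ?r" using r t0(1) by (simp only: norm_of_real) simp
    finally show False using r by (simp add: field_simps)
  qed
  have "completely_bounded (opsp X) OH G"
    by (rule completely_boundedI[where K = "2 * A.W 1"])
      (auto simp: clinear_between_def opsp_def carr_OH Gadd Gscale mball_def intro: upper)
  moreover have "completely_bounded OH (opsp X) ?G'"
  proof (rule completely_boundedI[where K = "2 * t0"])
    have "?G' (u + v) = ?G' u + ?G' v" "?G' (c *\<^sub>C u) = c *\<^sub>C ?G' u" for u v c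
      using G' by (auto intro!: G'eq simp: Gadd Gscale H.add_mem H.scale_mem)
    then show "clinear_between (carr OH) (carr (opsp X)) ?G'"
      using G' by (auto simp: clinear_between_def opsp_def carr_OH)
  qed (auto simp: mball_def opsp_def carr_OH intro: inverse)
  moreover have "bij_betw G (carr (opsp X)) (carr OH)"
    using Ginj Gsurj by (simp add: bij_betw_def opsp_def carr_OH)
  ultimately show ?thesis
    unfolding completely_isomorphic_def by (intro exI[of _ G]) (simp add: opsp_def)
qed

end
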